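(* Let $\{e^{\mathcal{A}_1t}\}_{t\ge0}$ be the $C_0$-semigroup on $\mathcal{H}_1$ generated by $\mathcal{A}_1$. Then it is polynomially stable, in the following sense, where $\|U_0\|_{\mathcal{D}(\mathcal{A}_1)}:=\|\mathcal{A}_1U_0\|_{\mathcal{H}_1}$: (i) If $\frac{\rho_1}{\kappa}=\frac{\rho_2}{b}$, there exists a constant $C>0$ (independent of $t$) such that $$\|e^{\mathcal{A}_1t}U_0\|_{\mathcal{H}_1}\le\frac{C}{t^{1/2}}\|U_0\|_{\mathcal{D}(\mathcal{A}_1)}\quad\text{for all }t>0\text{ and }U_0\in\mathcal{D}(\mathcal{A}_1).$$ (ii) If $\frac{\rho_1}{\kappa}\ne\frac{\rho_2}{b}$, there exists a constant $C>0$ (independent of $t$) such that $$\|e^{\mathcal{A}_1t}U_0\|_{\mathcal{H}_1}\le\frac{C}{t^{1/4}}\|U_0\|_{\mathcal{D}(\mathcal{A}_1)}\quad\text{for all }t>0\text{ and }U_0\in\mathcal{D}(\mathcal{A}_1).$$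
   Context: Let $L>0$, let $\rho,\rho_1,\rho_2,\rho_3,\alpha,\kappa,b,\tau,\sigma,\beta,\gamma>0$ and $m\in\mathbb{R}\setminus\{0\}$ be constants. All functions are complex-valued on $(0,L)$; $L^2=L^2(0,L)$, $H^1=H^1(0,L)$, $H^2=H^2(0,L)$, $H_0^1=H_0^1(0,L)$; $(\cdot,\cdot)$ and $\|\cdot\|$ denote the inner product and norm of $L^2$. Let $L_*^2=\{\omega\in L^2:\int_0^L\omega\,dx=0\}$ and $H_*^1=H^1\cap L_*^2$. Put $$\mathcal{H}_1=H_*^1\times L_*^2\times H_*^1\times L_*^2\times H_0^1\times L^2\times L^2\times L^2,$$ with elements $U=(u,v,\varphi,\Phi,\psi,\Psi,\theta,q)$; it is a Hilbert space with the inner product inducing the norm $$\|U\|_{\mathcal{H}_1}^2=\rho\|v\|^2+\alpha\|u_x\|^2+\rho_1\|\Phi\|^2+\rho_2\|\Psi\|^2+b\|\psi_x\|^2+\beta\|\varphi-u\|^2+\kappa\|\varphi_x+\psi\|^2+\rho_3\|\theta\|^2+\tau\|q\|^2.$$ The linear operator $\mathcal{A}_1$ has domain $$\mathcal{D}(\mathcal{A}_1)=\{U\in\mathcal{H}_1: v,\Phi\in H_*^1;\ u_x,\varphi_x,\theta,\Psi\in H_0^1;\ \psi\in H^2;\ q\in H^1\}$$ and is given by $$\mathcal{A}_1U=\begin{pmatrix} v\\ \rho^{-1}[\alpha u_{xx}+\beta(\varphi-u)-\gamma v]\\ \Phi\\ \rho_1^{-1}[\kappa(\varphi_x+\psi)_x-\beta(\varphi-u)-m\theta_x]\\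 \Psi\\ \rho_2^{-1}[b\psi_{xx}-\kappa(\varphi_x+\psi)+m\theta]\\ \rho_3^{-1}[-q_x-m(\Phi_x+\Psi)]\\ \tau^{-1}(-\sigma q-\theta_x)\end{pmatrix}.$$ It generates a $C_0$-semigroup of contractions on $\mathcal{H}_1$. *)

theory Defs
  imports "HOL-Analysis.Analysis" "HOL-Library.Function_Algebras"
begin

text \<open>
  Elements of \<open>L\<^sup>2(0,L)\<close> are represented by functions \<open>real \<Rightarrow> complex\<close>; values outside
  \<open>(0,L)\<close> and on null sets are irrelevant.  Two representatives are identified when the norm of
  their difference vanishes, and the statements about operators below are made modulo this
  identification.
\<close>

definition L2 :: "real \<Rightarrow> (real \<Rightarrow> complex) set" where
  "L2 L = {f. f \<in> borel_measurable (lebesgue_on {0<..<L}) \<and>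
              integrable (lebesgue_on {0<..<L}) (\<lambda>x. (cmod (f x))\<^sup>2)}"

definition L2_norm :: "real \<Rightarrow> (real \<Rightarrow> complex) \<Rightarrow> real" where
  "L2_norm L f = sqrt (LINT x|lebesgue_on {0<..<L}. (cmod (f x))\<^sup>2)"

definition L2_star :: "real \<Rightarrow> (real \<Rightarrow> complex) set" where
  "L2_star L = {f \<in> L2 L. (LINT x|lebesgue_on {0<..<L}. f x) = 0}"

text \<open>The space \<open>C\<^sub>c\<^sup>\<infinity>(0,L)\<close>, each function being extended by zero to the real line; \<open>D n\<close> is
  the \<open>n\<close>-th derivative.\<close>

definition test_function :: "real \<Rightarrow> (real \<Rightarrow> complex) \<Rightarrow> bool" where
  "test_function L \<eta> \<longleftrightarrow>
     (\<exists>D. D 0 = \<eta> \<and> (\<forall>n x. (D n has_vector_derivative D (Suc n) x) (at x))) \<and>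
     (\<exists>K. compact K \<and> K \<subseteq> {0<..<L} \<and> (\<forall>x. x \<notin> K \<longrightarrow> \<eta> x = 0))"

definition has_weak_deriv :: "real \<Rightarrow> (real \<Rightarrow> complex) \<Rightarrow> (real \<Rightarrow> complex) \<Rightarrow> bool" where
  "has_weak_deriv L f g \<longleftrightarrow> f \<in> L2 L \<and> g \<in> L2 L \<and>
     (\<forall>\<eta>. test_function L \<eta> \<longrightarrow>
        (LINT x|lebesgue_on {0<..<L}. f x * vector_derivative \<eta> (at x)) =
        - (LINT x|lebesgue_on {0<..<L}. g x * \<eta> x))"

text \<open>The weak derivative is unique up to null sets; \<open>wderiv\<close> selects a representative, and is
  meaningful only on \<open>H\<^sup>1\<close>.\<close>

definition wderiv :: "real \<Rightarrow> (real \<Rightarrow> complex) \<Rightarrow> real \<Rightarrow> complex" where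
  "wderiv L f = (SOME g. has_weak_deriv L f g)"

definition H1 :: "real \<Rightarrow> (real \<Rightarrow> complex) set" where
  "H1 L = {f. \<exists>g. has_weak_deriv L f g}"

definition H1_norm :: "real \<Rightarrow> (real \<Rightarrow> complex) \<Rightarrow> real" where
  "H1_norm L f = sqrt ((L2_norm L f)\<^sup>2 + (L2_norm L (wderiv L f))\<^sup>2)"

definition H2 :: "real \<Rightarrow> (real \<Rightarrow> complex) set" where
  "H2 L = {f \<in> H1 L. wderiv L f \<in> H1 L}"

text \<open>\<open>H\<^sub>0\<^sup>1\<close> is the closure of the test functions in \<open>H\<^sup>1\<close>.\<close>

definition H1_0 :: "real \<Rightarrow> (real \<Rightarrow> complex) set" where
  "H1_0 L = {f \<in> H1 L. \<forall>\<epsilon>>0. \<exists>\<eta>. test_function L \<eta> \<and> H1_norm L (f - \<eta>) < \<epsilon>}"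

definition H1_star :: "real \<Rightarrow> (real \<Rightarrow> complex) set" where
  "H1_star L = H1 L \<inter> L2_star L"

text \<open>States \<open>(u, v, \<phi>, \<Phi>, \<psi>, \<Psi>, \<theta>, q)\<close>; addition and subtraction are the
  componentwise and pointwise ones.\<close>

type_synonym state =
  "(real \<Rightarrow> complex) \<times> (real \<Rightarrow> complex) \<times> (real \<Rightarrow> complex) \<times> (real \<Rightarrow> complex) \<times>
   (real \<Rightarrow> complex) \<times> (real \<Rightarrow> complex) \<times> (real \<Rightarrow> complex) \<times> (real \<Rightarrow> complex)"

fun scale_state :: "complex \<Rightarrow> state \<Rightarrow> state" where
  "scale_state c (u, v, \<phi>, \<Phi>, \<psi>, \<Psi>, \<theta>, q) =
     (\<lambda>x. c * u x, \<lambda>x. c * v x, \<lambda>x. c * \<phi> x, \<lambda>x. c * \<Phi> x,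
      \<lambda>x. c * \<psi> x, \<lambda>x. c * \<Psi> x, \<lambda>x. c * \<theta> x, \<lambda>x. c * q x)"

definition state_space :: "real \<Rightarrow> state set" where
  "state_space L = H1_star L \<times> L2_star L \<times> H1_star L \<times> L2_star L \<times> H1_0 L \<times> L2 L \<times> L2 L \<times> L2 L"

fun state_norm ::
  "real \<Rightarrow> real \<Rightarrow> real \<Rightarrow> real \<Rightarrow> real \<Rightarrow> real \<Rightarrow> real \<Rightarrow> real \<Rightarrow> real \<Rightarrow> real \<Rightarrow> state \<Rightarrow> real" where
  "state_norm L \<rho> \<rho>\<^sub>1 \<rho>\<^sub>2 \<rho>\<^sub>3 \<alpha> \<kappa> b \<tau> \<beta> (u, v, \<phi>, \<Phi>, \<psi>, \<Psi>, \<theta>, q) =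
     sqrt (\<rho> * (L2_norm L v)\<^sup>2 + \<alpha> * (L2_norm L (wderiv L u))\<^sup>2
         + \<rho>\<^sub>1 * (L2_norm L \<Phi>)\<^sup>2 + \<rho>\<^sub>2 * (L2_norm L \<Psi>)\<^sup>2
         + b * (L2_norm L (wderiv L \<psi>))\<^sup>2 + \<beta> * (L2_norm L (\<lambda>x. \<phi> x - u x))\<^sup>2
         + \<kappa> * (L2_norm L (\<lambda>x. wderiv L \<phi> x + \<psi> x))\<^sup>2
         + \<rho>\<^sub>3 * (L2_norm L \<theta>)\<^sup>2 + \<tau> * (L2_norm L q)\<^sup>2)"

definition dom_A1 :: "real \<Rightarrow> state set" where
  "dom_A1 L = {(u, v, \<phi>, \<Phi>, \<psi>, \<Psi>, \<theta>, q). (u, v, \<phi>, \<Phi>, \<psi>, \<Psi>, \<theta>, q) \<in> state_space L \<and>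
     v \<in> H1_star L \<and> \<Phi> \<in> H1_star L \<and>
     wderiv L u \<in> H1_0 L \<and> wderiv L \<phi> \<in> H1_0 L \<and> \<theta> \<in> H1_0 L \<and> \<Psi> \<in> H1_0 L \<and>
     \<psi> \<in> H2 L \<and> q \<in> H1 L}"

fun A1 ::
  "real \<Rightarrow> real \<Rightarrow> real \<Rightarrow> real \<Rightarrow> real \<Rightarrow> real \<Rightarrow> real \<Rightarrow> real \<Rightarrow> real \<Rightarrow> real \<Rightarrow> real \<Rightarrow> real \<Rightarrow> real
   \<Rightarrow> state \<Rightarrow> state" where
  "A1 L \<rho> \<rho>\<^sub>1 \<rho>\<^sub>2 \<rho>\<^sub>3 \<alpha> \<kappa> b \<tau> \<sigma> \<beta> \<gamma> m (u, v, \<phi>, \<Phi>, \<psi>, \<Psi>, \<theta>, q) =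
     (v,
      \<lambda>x. (\<alpha> * wderiv L (wderiv L u) x + \<beta> * (\<phi> x - u x) - \<gamma> * v x) / \<rho>,
      \<Phi>,
      \<lambda>x. (\<kappa> * wderiv L (\<lambda>y. wderiv L \<phi> y + \<psi> y) x - \<beta> * (\<phi> x - u x) - m * wderiv L \<theta> x) / \<rho>\<^sub>1,
      \<Psi>,
      \<lambda>x. (b * wderiv L (wderiv L \<psi>) x - \<kappa> * (wderiv L \<phi> x + \<psi> x) + m * \<theta> x) / \<rho>\<^sub>2,
      \<lambda>x. (- wderiv L q x - m * (wderiv L \<Phi> x + \<Psi> x)) / \<rho>\<^sub>3,
      \<lambda>x. (- \<sigma> * q x - wderiv L \<theta> x) / \<tau>)"

text \<open>
  \<open>X\<close> is the carrier and \<open>N\<close> its norm.  Since states are representatives, equality of \<open>U\<close> and \<open>V\<close>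
  as elements of the quotient space reads \<open>N (U - V) = 0\<close>.  Linearity and boundedness together
  ensure that \<open>S t\<close> respects this identification.
\<close>

definition C0_semigroup ::
  "state set \<Rightarrow> (state \<Rightarrow> real) \<Rightarrow> (real \<Rightarrow> state \<Rightarrow> state) \<Rightarrow> bool" where
  "C0_semigroup X N S \<longleftrightarrow>
     (\<forall>t\<ge>0. \<forall>U\<in>X. S t U \<in> X) \<and>
     (\<forall>t\<ge>0. \<forall>U\<in>X. \<forall>V\<in>X. \<forall>c d.
        N (S t (scale_state c U + scale_state d V)
           - (scale_state c (S t U) + scale_state d (S t V))) = 0) \<and>
     (\<forall>t\<ge>0. \<exists>M. \<forall>U\<in>X. N (S t U) \<le> M * N U) \<and>
     (\<forall>U\<in>X. N (S 0 U - U) = 0) \<and>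
     (\<forall>s\<ge>0. \<forall>t\<ge>0. \<forall>U\<in>X. N (S (s + t) U - S s (S t U)) = 0) \<and>
     (\<forall>U\<in>X. ((\<lambda>t. N (S t U - U)) \<longlongrightarrow> 0) (at_right 0))"

text \<open>The operator \<open>A\<close> with domain \<open>D\<close> is the infinitesimal generator of \<open>S\<close>: \<open>U\<close> lies in \<open>D\<close>
  exactly when the difference quotients converge in \<open>X\<close>, and then the limit is \<open>A U\<close>.\<close>

definition is_generator ::
  "state set \<Rightarrow> (state \<Rightarrow> real) \<Rightarrow> (real \<Rightarrow> state \<Rightarrow> state) \<Rightarrow> state set \<Rightarrow> (state \<Rightarrow> state) \<Rightarrow> bool" where
  "is_generator X N S D A \<longleftrightarrow>
     (\<forall>U\<in>X. \<forall>F\<in>X.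
        ((\<lambda>h. N (scale_state (of_real (1 / h)) (S h U - U) - F)) \<longlongrightarrow> 0) (at_right 0)
        \<longleftrightarrow> U \<in> D \<and> N (A U - F) = 0)"

end

theory Submission
  imports Defs
begin

text \<open>
  For an orbit in the domain the energy of \<open>U\<close> dissipates \<open>\<parallel>v\<parallel>\<^sup>2\<close> and \<open>\<parallel>q\<parallel>\<^sup>2\<close>, and the energy of
  \<open>U\<^sub>t\<close> dissipates \<open>\<parallel>v\<^sub>t\<parallel>\<^sup>2\<close> and \<open>\<parallel>q\<^sub>t\<parallel>\<^sup>2\<close>, hence also \<open>\<parallel>\<theta>\<^sub>x\<parallel>\<^sup>2\<close>.  Write \<open>s = \<phi>\<^sub>x + \<psi>\<close> and
  \<open>e = \<kappa> s + \<alpha> u\<^sub>x\<close>.  Up to time derivatives of forms bounded by the energy and up to products of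
  energy terms with dissipated terms, pairing \<open>u\<^sub>x\<close> and \<open>m s + \<rho>\<^sub>3 \<theta>\<close> with the primitive of \<open>\<Phi>\<close>
  annihilates \<open>\<parallel>e\<parallel>\<^sup>2\<close>; the pairing of \<open>\<phi> - u\<close> with \<open>\<Phi>\<close> then bounds \<open>\<parallel>\<Phi>\<parallel>\<^sup>2\<close> by products with \<open>e\<close>, and
  the Timoshenko pairings of \<open>(\<Psi>, s)\<close> and \<open>(\<psi>\<^sub>x, \<Phi>)\<close> bound \<open>\<parallel>\<Psi>\<parallel>\<^sup>2\<close>.  Their usual obstruction
  \<open>(\<rho>\<^sub>2 - b \<rho>\<^sub>1 / \<kappa>) (\<Psi>, \<Phi>\<^sub>x)\<close> is harmless: \<open>m s\<^sub>t = - \<rho>\<^sub>3 \<theta>\<^sub>t - q\<^sub>x\<close>, so \<open>(\<Psi>, \<Phi>\<^sub>x)\<close> equals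
  \<open>- \<parallel>\<Psi>\<parallel>\<^sup>2\<close> up to terms of the above kind.  This yields \<open>\<parallel>U(t)\<parallel>\<^sup>2 \<le> C t\<^sup>-\<^sup>1 \<parallel>A U(0)\<parallel>\<^sup>2\<close> whatever the
  wave speeds are, and \<open>\<parallel>U\<parallel> \<le> C \<parallel>A U\<parallel>\<close>, which covers the exponent \<open>1/4\<close> for small \<open>t\<close>.
\<close>

section \<open>Semigroups on normed spaces that need not be complete\<close>

text \<open>The stress e comes from adding the equations for u and \<phi>: the spring force cancels,
  and integrating the sum from 0 gives e as \<open>\<rho>\<^sub>1\<close> times the time derivative
  of the primitive of \<Phi>, up to dissipated terms. Its partners u_x and m s +
  \<open>\<rho>\<^sub>3\<close> \<theta> have the time derivatives v_x and - q_x, whose pairings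
  with that primitive reduce to - (v, \<Phi>) and (q, \<Phi>), because the zero mean of \<Phi>
  removes the boundary terms. All integrations by parts are collected in the relation
  \<open>config\<close>, so the identities are algebra in an arbitrary real inner product space, and
  the analysis reduces to showing that states in the domain satisfy this relation. The given
  semigroup acts on representatives. It is carried over to the nine energy components as classes of
  square integrable functions, where its laws hold as equations. Completeness of that space is not
  established; local boundedness of the operator norms, which left continuity of orbits rests on,
  therefore comes from a measure argument instead of the uniform boundedness principle.\<close>

text \<open>A point of \<open>E\<close> outside the interior cannot lie in the interval to the right
  of another such point, so these intervals are disjoint and the exceptional points are countable.
  The lemma serves orbits known to be continuous from the right only: the set of times where an
  operator norm exceeds n is then open merely to the right.\<close>

lemma right_open_borel:
  fixes E :: "real set"
  assumes E: "\<And>s. s \<in> E \<Longrightarrow> \<exists>\<delta>>0. {s..<s+\<delta>} \<subseteq> E"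
  shows "E \<in> sets borel"
proof -
  define B where "B = E - interior E"
  obtain \<delta> where \<delta>: "\<And>s. s \<in> E \<Longrightarrow> \<delta> s > 0 \<and> {s..<s+\<delta> s} \<subseteq> E"
    using E by metis
  have int: "{s<..<s + \<delta> s} \<subseteq> interior E" if "s \<in> E" for s
    using \<delta>[OF that] by (intro interior_maximal) auto
  have disj: "disjnt {s<..<s + \<delta> s} {t<..<t + \<delta> t}" if "s \<in> B" "t \<in> B" "s < t" for s t
  proof -
    have "t \<notin> {s<..<s + \<delta> s}"
      using int[of s] that by (auto simp: B_def)
    then show ?thesis using that by (auto simp: disjnt_def)
  qed
  have "pairwise (\<lambda>s t. disjnt {s<..<s + \<delta> s} {t<..<t + \<delta> t}) B"
    unfolding pairwise_def by (metis disj disjnt_sym linorder_neqE)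
  then have pwB: "x = y \<or> disjnt {x<..<x + \<delta> x} {y<..<y + \<delta> y}" if "x \<in> B" "y \<in> B" for x y
    using that by (auto simp: pairwise_def)
  have ne: "{s<..<s + \<delta> s} \<noteq> {}" if "s \<in> B" for s
    using \<delta>[of s] that by (auto simp: B_def)
  have inj: "inj_on (\<lambda>s. {s<..<s + \<delta> s}) B"
    using pwB ne by (intro inj_onI) (metis disjnt_self_iff_empty)
  have pw: "disjoint ((\<lambda>s. {s<..<s + \<delta> s}) ` B)"
    unfolding disjoint_def using pwB by (metis (no_types, lifting) disjnt_def imageE)
  have "countable ((\<lambda>s. {s<..<s + \<delta> s}) ` B)"
    by (rule countable_disjoint_open_subsets[OF _ pw]) auto
  then have "countable B" using inj countable_image_inj_on by blast
  then have "B \<in> sets borel" by (rule sets.countable[rotated]) auto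
  moreover have "E = interior E \<union> B" using interior_subset by (auto simp: B_def)
  ultimately show ?thesis
    by (metis borel_open open_interior sets.Un)
qed

text \<open>Orbits in the domain are differentiated from the right only, so monotonicity is proved
  by continuation: the largest initial interval on which \<open>F\<close> stays below a line of
  small positive slope \<epsilon> through its initial value is all of [a,b].\<close>

lemma right_deriv_nonpos_imp_le:
  fixes F :: "real \<Rightarrow> real"
  assumes ab: "a \<le> b" and cont: "continuous_on {a..b} F"
    and der: "\<And>t. a \<le> t \<Longrightarrow> t < b \<Longrightarrow> \<exists>D\<le>0. (F has_vector_derivative D) (at_right t)"
  shows "F b \<le> F a"
proof (rule field_le_epsilon)
  fix e :: real assume "e > 0"
  \<comment> \<open>The summand 1 keeps the denominator positive when a = b.\<close>
  define \<epsilon> where "\<epsilon> = e / (b - a + 1)"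
  have e: "\<epsilon> > 0" "\<epsilon> * (b - a) \<le> e" using \<open>e > 0\<close> ab by (auto simp: \<epsilon>_def field_simps)
  define G where "G t = F t - F a - \<epsilon> * (t - a)" for t
  define A where "A = {t\<in>{a..b}. \<forall>s\<in>{a..t}. G s \<le> 0}"
  have G: "continuous_on {a..b} G" unfolding G_def by (intro continuous_intros cont)
  have aA: "a \<in> A" using ab by (auto simp: A_def G_def)
  have bdd: "bdd_above A" by (auto simp: A_def)
  define c where "c = Sup A"
  have ac: "a \<le> c" using aA bdd by (auto simp: c_def intro: cSup_upper)
  have cb: "c \<le> b" unfolding c_def by (rule cSup_least) (use aA in \<open>auto simp: A_def\<close>)
  have lt: "G s \<le> 0" if s: "a \<le> s" "s < c" for s
  proof -
    obtain t where "t \<in> A" "s < t"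
      using s(2) aA less_cSupD[of A s] unfolding c_def by blast
    then show ?thesis using s by (auto simp: A_def)
  qed
  have Gc: "G c \<le> 0"
  proof (cases "a = c")
    case True then show ?thesis by (simp add: G_def)
  next
    case False
    have "(G \<longlongrightarrow> G c) (at c within {a..b})" using G ac cb by (auto simp: continuous_on_def)
    then have "(G \<longlongrightarrow> G c) (at c within {a..c})"
      by (rule tendsto_within_subset) (use cb in auto)
    then have "(G \<longlongrightarrow> G c) (at_left c)"
      using False ac by (simp add: at_within_Icc_at_left)
    then show ?thesis
    proof (rule tendsto_upperbound)
      show "\<forall>\<^sub>F x in at_left c. G x \<le> 0"
        using False ac by (intro eventually_at_leftI[of a]) (auto intro: lt)
    qed auto
  qed
  \<comment> \<open>If c < b, the right derivative at c is below \<epsilon>, so \<open>G\<close>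
    stays nonpositive a little beyond c, against the choice of c as a supremum.\<close>
  have "c = b"
  proof (rule ccontr)
    assume "c \<noteq> b"
    then have cb: "c < b" using cb by simp
    obtain D where D: "D \<le> 0" "(F has_vector_derivative D) (at_right c)" using der[OF ac cb] by auto
    have "((\<lambda>t. (F t - F c) / (t - c)) \<longlongrightarrow> D) (at_right c)"
      using D(2) by (simp add: has_field_derivative_iff flip: has_real_derivative_iff_has_vector_derivative)
    then have "\<forall>\<^sub>F t in at_right c. (F t - F c) / (t - c) < \<epsilon>"
      by (rule order_tendstoD(2)) (use D(1) e in linarith)
    then obtain d where d: "d > c" "\<And>t. c < t \<Longrightarrow> t < d \<Longrightarrow> (F t - F c) / (t - c) < \<epsilon>"
      unfolding eventually_at_right[OF cb] by blast
    define t where "t = min ((c + d)/2) b"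
    have t: "c < t" "t < d" "t \<le> b" using d(1) cb by (auto simp: t_def min_def)
    have "G s \<le> 0" if "s \<in> {a..t}" for s
    proof (cases "s \<le> c")
      case True then show ?thesis using lt[of s] Gc that by (cases "s = c") auto
    next
      case False
      then have "(F s - F c) / (s - c) < \<epsilon>" using d(2)[of s] that t by auto
      then have "F s - F c < \<epsilon> * (s - c)" using False by (simp add: field_simps)
      then show ?thesis using Gc by (simp add: G_def algebra_simps)
    qed
    then have "t \<in> A" using t ac by (auto simp: A_def)
    then have "t \<le> c" using bdd by (auto simp: c_def intro: cSup_upper)
    then show False using t by simp
  qed
  then show "F b \<le> F a + e" using Gc e by (auto simp: G_def)
qed

section \<open>Strong continuity and the graph of the generator\<close>

text \<open>\<open>Y\<close> will be the set of energy components of all states.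
  \<open>T_bounded\<close> bounds each single operator; uniformity in t has to be derived.\<close>

locale semigroup_on =
  fixes Y :: "'b::real_normed_vector set" and T :: "real \<Rightarrow> 'b \<Rightarrow> 'b"
  assumes subspace_Y: "subspace Y"
    and T_in: "\<lbrakk>0 \<le> t; y \<in> Y\<rbrakk> \<Longrightarrow> T t y \<in> Y"
    and T_lin: "\<lbrakk>0 \<le> t; x \<in> Y; y \<in> Y\<rbrakk> \<Longrightarrow> T t (c *\<^sub>R x + d *\<^sub>R y) = c *\<^sub>R T t x + d *\<^sub>R T t y"
    and T_bounded: "0 \<le> t \<Longrightarrow> \<exists>M. \<forall>y\<in>Y. norm (T t y) \<le> M * norm y"
    and T_zero: "y \<in> Y \<Longrightarrow> T 0 y = y"
    and T_add: "\<lbrakk>0 \<le> s; 0 \<le> t; y \<in> Y\<rbrakk> \<Longrightarrow> T (s + t) y = T s (T t y)"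
    and T_cont: "y \<in> Y \<Longrightarrow> ((\<lambda>t. T t y) \<longlongrightarrow> y) (at_right 0)"
begin

text \<open>The graph of the generator. A relation fits the later use, where the operator is given
  on representatives and the classes of a state and of its image are merely related.\<close>

definition gen :: "'b \<Rightarrow> 'b \<Rightarrow> bool" where
  "gen y f \<longleftrightarrow> y \<in> Y \<and> f \<in> Y \<and> ((\<lambda>h. (1 / h) *\<^sub>R (T h y - y)) \<longlongrightarrow> f) (at_right 0)"

lemma T_diff: "\<lbrakk>0 \<le> t; x \<in> Y; y \<in> Y\<rbrakk> \<Longrightarrow> T t (x - y) = T t x - T t y"
  using T_lin[of t x y 1 "-1"] by simp

lemma T_scale: "\<lbrakk>0 \<le> t; x \<in> Y\<rbrakk> \<Longrightarrow> T t (c *\<^sub>R x) = c *\<^sub>R T t x"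
  using T_lin[of t x x c 0] by simp

lemma diff_in: "\<lbrakk>x \<in> Y; y \<in> Y\<rbrakk> \<Longrightarrow> x - y \<in> Y"
  using subspace_Y by (rule subspace_diff)

lemma scale_in: "x \<in> Y \<Longrightarrow> c *\<^sub>R x \<in> Y"
  using subspace_Y by (rule subspace_scale)

lemma T_tendsto:
  assumes "0 \<le> t" "(g \<longlongrightarrow> y) F" "\<forall>\<^sub>F h in F. g h \<in> Y" "y \<in> Y"
  shows "((\<lambda>h. T t (g h)) \<longlongrightarrow> T t y) F"
proof -
  obtain M where M: "\<And>y. y \<in> Y \<Longrightarrow> norm (T t y) \<le> M * norm y" using T_bounded[OF assms(1)] by blast
  have "((\<lambda>h. M * norm (g h - y)) \<longlongrightarrow> M * norm (y - y)) F"
    by (intro tendsto_intros assms)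
  then have "((\<lambda>h. M * norm (g h - y)) \<longlongrightarrow> 0) F" by simp
  then have "((\<lambda>h. T t (g h) - T t y) \<longlongrightarrow> 0) F"
  proof (rule Lim_null_comparison[rotated])
    show "\<forall>\<^sub>F h in F. norm (T t (g h) - T t y) \<le> M * norm (g h - y)"
      using assms(3) by eventually_elim (metis M T_diff assms(1) assms(4) diff_in)
  qed
  then show ?thesis using LIM_zero_iff by blast
qed

lemma at_right_shift: "filterlim f F (at_right (t::real)) \<longleftrightarrow> filterlim (\<lambda>h. f (t + h)) F (at_right 0)"
  by (subst at_right_to_0) (simp add: filterlim_filtermap add.commute)

lemma T_right_cont:
  assumes "0 \<le> t" "y \<in> Y" shows "((\<lambda>s. T s y) \<longlongrightarrow> T t y) (at_right t)"
proof -
  have "((\<lambda>h. T t (T h y)) \<longlongrightarrow> T t y) (at_right 0)"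
    by (rule T_tendsto[OF assms(1) T_cont]) (auto simp: assms eventually_at_filter intro!: T_in always_eventually)
  then show ?thesis unfolding at_right_shift[of _ _ t]
    by (rule Lim_transform_eventually) (auto simp: eventually_at_filter T_add assms)
qed

text \<open>If the operator norms were unbounded on \<open>[a,b]\<close>, submultiplicativity would force
  \<open>\<parallel>T s\<parallel> > n\<close> on a subset of \<open>(0,b)\<close> of measure at least \<open>a/2\<close>, for every \<open>n\<close>.\<close>

lemma T_locally_bounded:
  assumes ab: "0 < a" "a \<le> b"
  shows "\<exists>M. \<forall>t\<in>{a..b}. \<forall>y\<in>Y. norm (T t y) \<le> M * norm y"
proof (rule ccontr)
  assume contra: "\<not> ?thesis"
  define K where "K n t \<longleftrightarrow> (\<forall>y\<in>Y. norm (T t y) \<le> real n * norm y)" for n t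
  define E where "E n = {t\<in>{0<..<b}. \<not> K n t}" for n
  have E_borel: "E n \<in> sets borel" for n
  proof (rule right_open_borel)
    fix s assume s: "s \<in> E n"
    then obtain y where y: "y \<in> Y" "norm (T s y) > real n * norm y" and sb: "0 < s" "s < b"
      by (auto simp: E_def K_def not_le)
    have "((\<lambda>t. norm (T t y)) \<longlongrightarrow> norm (T s y)) (at_right s)"
      using sb y by (intro tendsto_norm T_right_cont) auto
    then have "\<forall>\<^sub>F t in at_right s. norm (T t y) > real n * norm y"
      using y(2) by (rule order_tendstoD(1))
    then obtain d where d: "d > s" "\<And>t. s < t \<Longrightarrow> t < d \<Longrightarrow> norm (T t y) > real n * norm y"
      unfolding eventually_at_right[OF sb(2)] by blast
    have "{s..<s + (min d b - s)} \<subseteq> E n"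
      using s d y sb by (force simp: E_def K_def not_le)
    then show "\<exists>\<delta>>0. {s..<s+\<delta>} \<subseteq> E n" using d(1) sb by (intro exI[of _ "min d b - s"]) auto
  qed
  have low: "measure lborel (E n) \<ge> a / 2" for n
  proof -
    \<comment> \<open>The bound n * n is the product of two bounds n: since T t = T s T (t - s), one
      of the two factors must exceed n. Hence (0,t) is covered by \<open>E n\<close> and its mirror
      image, which have equal measure.\<close>
    obtain t where t: "t \<in> {a..b}" "\<not> K (n * n) t"
      using contra unfolding K_def by (metis)
    have cover: "{0<..<t} \<subseteq> E n \<union> (\<lambda>x. t - x) -` E n"
    proof
      fix s assume s: "s \<in> {0<..<t}"
      show "s \<in> E n \<union> (\<lambda>x. t - x) -` E n"
      proof (rule ccontr)
        assume "\<not> ?thesis"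
        then have K: "K n s" "K n (t - s)" using s t by (auto simp: E_def)
        have "K (n * n) t" unfolding K_def
        proof
          fix y assume y: "y \<in> Y"
          have "T t y = T s (T (t - s) y)" using T_add[of s "t - s" y] s y by simp
          then have "norm (T t y) \<le> real n * norm (T (t - s) y)"
            using K(1) T_in[of "t - s" y] s y by (auto simp: K_def)
          also have "\<dots> \<le> real n * (real n * norm y)"
            using K(2) y by (intro mult_left_mono) (auto simp: K_def)
          finally show "norm (T t y) \<le> real (n * n) * norm y" by simp
        qed
        then show False using t by simp
      qed
    qed
    have refl: "(\<lambda>x. t - x) -` E n \<in> sets borel"
      using measurable_sets[of "\<lambda>x. t - x" borel borel "E n"] E_borel by simp
    have fin: "emeasure lborel (E n) < \<infinity>" 
      by (rule le_less_trans[OF emeasure_mono[of _ "{0<..<b}"]]) (use ab in \<open>auto simp: E_def\<close>)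
    have eqm: "emeasure lborel ((\<lambda>x. t - x) -` E n) = emeasure lborel (E n)"
    proof -
      have "lborel = distr lborel borel (\<lambda>x. t + (-1) * x)"
        using lborel_real_affine[of "-1" t] by (simp add: density_1)
      then have "emeasure lborel (E n) = emeasure (distr lborel borel (\<lambda>x. t + (-1) * x)) (E n)" by simp
      also have "\<dots> = emeasure lborel ((\<lambda>x. t - x) -` E n)"
        by (subst emeasure_distr) (use E_borel in auto)
      finally show ?thesis by simp
    qed
    have "ennreal t = emeasure lborel {0<..<t}" using t ab by simp
    also have "\<dots> \<le> emeasure lborel (E n \<union> (\<lambda>x. t - x) -` E n)"
      by (rule emeasure_mono[OF cover]) (use E_borel refl in auto)
    also have "\<dots> \<le> emeasure lborel (E n) + emeasure lborel ((\<lambda>x. t - x) -` E n)"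
      by (rule emeasure_subadditive) (use E_borel refl in auto)
    also have "\<dots> = ennreal (2 * measure lborel (E n))"
      unfolding eqm using fin by (simp add: emeasure_eq_ennreal_measure ennreal_plus[symmetric] del: ennreal_plus)
    finally have "t \<le> 2 * measure lborel (E n)" by (simp add: ennreal_le_iff)
    then show ?thesis using t by auto
  qed
  \<comment> \<open>The sets decrease to the empty set because each single operator is bounded, so
    their measures tend to 0, against the lower bound a/2.\<close>
  have "(\<lambda>n. measure lborel (E n)) \<longlonglongrightarrow> measure lborel (\<Inter>n. E n)"
  proof (rule Lim_measure_decseq)
    show "range E \<subseteq> sets lborel" using E_borel by auto
    have "K m t \<Longrightarrow> m \<le> n \<Longrightarrow> K n t" for m n t
      unfolding K_def by (meson mult_right_mono norm_ge_zero of_nat_mono order_trans)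
    then show "decseq E" by (fastforce simp: decseq_def E_def)
    show "emeasure lborel (E i) \<noteq> \<infinity>" for i
    proof -
      have "emeasure lborel (E i) \<le> emeasure lborel {0<..<b}"
        by (rule emeasure_mono) (auto simp: E_def)
      then show ?thesis using ab by (auto simp: top_unique)
    qed
  qed
  moreover have "(\<Inter>n. E n) = {}"
  proof -
    have "\<exists>n. t \<notin> E n" for t
    proof (cases "0 \<le> t")
      case True
      then obtain M where M: "\<And>y. y \<in> Y \<Longrightarrow> norm (T t y) \<le> M * norm y" using T_bounded by blast
      obtain n where "M \<le> real n" using real_arch_simple by blast
      then have "K n t" unfolding K_def using M by (meson mult_right_mono norm_ge_zero order_trans)
      then show ?thesis by (auto simp: E_def)
    qed (auto simp: E_def)
    then show ?thesis by blast
  qed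
  ultimately have "(\<lambda>n. measure lborel (E n)) \<longlonglongrightarrow> 0" by simp
  then have "a / 2 \<le> 0" by (rule LIMSEQ_le_const) (use low in auto)
  then show False using ab by simp
qed

text \<open>In T s y - T t y = - T s (T (t - s) y - y) the operator in front varies with s, so a
  bound uniform near t is required; on the right side of t the fixed operator T t stands in
  front.\<close>

lemma T_left_cont:
  assumes t: "0 < t" and y: "y \<in> Y" shows "((\<lambda>s. T s y) \<longlongrightarrow> T t y) (at_left t)"
proof -
  have "0 < t/2" "t/2 \<le> t" using t by auto
  from T_locally_bounded[OF this] obtain M
    where M: "\<forall>s\<in>{t/2..t}. \<forall>y\<in>Y. norm (T s y) \<le> M * norm y" by blast
  have "((\<lambda>s. T (t - s) y) \<longlongrightarrow> y) (at_left t)"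
    by (rule filterlim_compose[OF T_cont[OF y]])
      (auto simp: filterlim_at eventually_at_filter intro!: tendsto_eq_intros)
  then have "((\<lambda>s. M * norm (T (t - s) y - y)) \<longlongrightarrow> M * norm (y - y)) (at_left t)"
    by (intro tendsto_mult tendsto_norm tendsto_diff tendsto_const)
  then have "((\<lambda>s. M * norm (T (t - s) y - y)) \<longlongrightarrow> 0) (at_left t)" by simp
  then have "((\<lambda>s. T s y - T t y) \<longlongrightarrow> 0) (at_left t)"
  proof (rule Lim_null_comparison[rotated])
    show "\<forall>\<^sub>F s in at_left t. norm (T s y - T t y) \<le> M * norm (T (t - s) y - y)"
    proof (rule eventually_at_leftI[of "t/2"])
      fix s assume s: "s \<in> {t/2<..<t}"
      have "T t y = T s (T (t - s) y)" using T_add[of s "t - s" y] s y t by simp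
      then have "T s y - T t y = - T s (T (t - s) y - y)"
        using s y t by (simp add: T_diff T_in)
      then show "norm (T s y - T t y) \<le> M * norm (T (t - s) y - y)"
        using M[rule_format, of s "T (t - s) y - y"] s y by (simp add: diff_in T_in)
    qed (use t in simp)
  qed
  then show ?thesis using LIM_zero_iff by blast
qed

lemma T_continuous_on: "y \<in> Y \<Longrightarrow> continuous_on {0..} (\<lambda>t. T t y)"
  unfolding continuous_on_def
proof
  fix t :: real assume y: "y \<in> Y" and t: "t \<in> {0..}"
  show "((\<lambda>t. T t y) \<longlongrightarrow> T t y) (at t within {0..})"
  proof (cases "t = 0")
    case True then show ?thesis using T_right_cont[of 0 y] y by (simp add: at_within_Ici_at_right)
  next
    case False
    then have "((\<lambda>t. T t y) \<longlongrightarrow> T t y) (at t)"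
      using t y by (intro filterlim_split_at T_left_cont T_right_cont) auto
    then show ?thesis by (rule filterlim_mono) (auto simp: at_le)
  qed
qed

lemma T_commute: "\<lbrakk>0 \<le> s; 0 \<le> t; y \<in> Y\<rbrakk> \<Longrightarrow> T s (T t y) = T t (T s y)"
  by (metis T_add add.commute)

lemma gen_T: "\<lbrakk>gen y f; 0 \<le> t\<rbrakk> \<Longrightarrow> gen (T t y) (T t f)"
  unfolding gen_def
proof (intro conjI)
  assume *: "y \<in> Y \<and> f \<in> Y \<and> ((\<lambda>h. (1 / h) *\<^sub>R (T h y - y)) \<longlongrightarrow> f) (at_right 0)" and t: "0 \<le> t"
  show "T t y \<in> Y" "T t f \<in> Y" using * t by (auto intro: T_in)
  have "((\<lambda>h. T t ((1 / h) *\<^sub>R (T h y - y))) \<longlongrightarrow> T t f) (at_right 0)"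
    using * t by (intro T_tendsto) (auto simp: eventually_at_filter intro!: scale_in diff_in T_in always_eventually)
  then show "((\<lambda>h. (1 / h) *\<^sub>R (T h (T t y) - T t y)) \<longlongrightarrow> T t f) (at_right 0)"
    by (rule Lim_transform_eventually)
      (use * t in \<open>auto simp: eventually_at_filter T_scale T_diff T_in diff_in T_commute[of _ t]\<close>)
qed

lemma gen_deriv:
  assumes "gen y f" "0 \<le> t" shows "((\<lambda>s. T s y) has_vector_derivative T t f) (at_right t)"
proof -
  have *: "((\<lambda>h. (1 / h) *\<^sub>R (T h (T t y) - T t y)) \<longlongrightarrow> T t f) (at_right 0)"
    using gen_T[OF assms] by (simp add: gen_def)
  have y: "y \<in> Y" using assms by (simp add: gen_def)
  have "((\<lambda>h. (1 / (t + h - t)) *\<^sub>R (T (t + h) y - T t y)) \<longlongrightarrow> T t f) (at_right 0)"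
    by (rule Lim_transform_eventually[OF *])
      (use y assms in \<open>auto simp: eventually_at_filter T_add T_commute[of _ t]\<close>)
  then have "((\<lambda>s. (1 / (s - t)) *\<^sub>R (T s y - T t y)) \<longlongrightarrow> T t f) (at_right t)"
    unfolding at_right_shift[of _ _ t] .
  then have "((\<lambda>s. norm ((1 / (s - t)) *\<^sub>R (T s y - T t y) - T t f)) \<longlongrightarrow> 0) (at_right t)"
    by (intro tendsto_norm_zero) (simp add: LIM_zero)
  then have "((\<lambda>s. norm (T s y - T t y - (s - t) *\<^sub>R T t f) / norm (s - t)) \<longlongrightarrow> 0) (at_right t)"
  proof (rule Lim_transform_eventually)
    have "norm ((1 / (s - t)) *\<^sub>R (T s y - T t y) - T t f)
        = norm (T s y - T t y - (s - t) *\<^sub>R T t f) / norm (s - t)" if "s > t" for s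
    proof -
      have "T t f = (1 / (s - t)) *\<^sub>R ((s - t) *\<^sub>R T t f)" using that by simp
      then have "(1 / (s - t)) *\<^sub>R (T s y - T t y) - T t f
          = (1 / (s - t)) *\<^sub>R (T s y - T t y - (s - t) *\<^sub>R T t f)"
        by (simp only: scaleR_diff_right)
      then show ?thesis using that by simp
    qed
    then show "\<forall>\<^sub>F s in at_right t. norm ((1 / (s - t)) *\<^sub>R (T s y - T t y) - T t f)
        = norm (T s y - T t y - (s - t) *\<^sub>R T t f) / norm (s - t)"
      by (auto simp: eventually_at_filter)
  qed
  then show ?thesis
    by (simp add: has_vector_derivative_def has_derivative_iff_norm bounded_linear_scaleR_left)
qed

lemma gen_lin:
  assumes "gen x f" "gen y g" shows "gen (c *\<^sub>R x + d *\<^sub>R y) (c *\<^sub>R f + d *\<^sub>R g)"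
  unfolding gen_def
proof (intro conjI)
  have xy: "x \<in> Y" "f \<in> Y" "y \<in> Y" "g \<in> Y" using assms by (auto simp: gen_def)
  then show "c *\<^sub>R x + d *\<^sub>R y \<in> Y" "c *\<^sub>R f + d *\<^sub>R g \<in> Y"
    using subspace_Y by (auto intro: subspace_add subspace_scale)
  have "((\<lambda>h. c *\<^sub>R ((1 / h) *\<^sub>R (T h x - x)) + d *\<^sub>R ((1 / h) *\<^sub>R (T h y - y)))
      \<longlongrightarrow> c *\<^sub>R f + d *\<^sub>R g) (at_right 0)"
    using assms by (intro tendsto_intros) (auto simp: gen_def)
  then show "((\<lambda>h. (1 / h) *\<^sub>R (T h (c *\<^sub>R x + d *\<^sub>R y) - (c *\<^sub>R x + d *\<^sub>R y)))
      \<longlongrightarrow> c *\<^sub>R f + d *\<^sub>R g) (at_right 0)"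
  proof (rule Lim_transform_eventually)
    have "c *\<^sub>R ((1 / h) *\<^sub>R (T h x - x)) + d *\<^sub>R ((1 / h) *\<^sub>R (T h y - y))
        = (1 / h) *\<^sub>R (T h (c *\<^sub>R x + d *\<^sub>R y) - (c *\<^sub>R x + d *\<^sub>R y))" if "h > 0" for h
    proof -
      have "T h (c *\<^sub>R x + d *\<^sub>R y) - (c *\<^sub>R x + d *\<^sub>R y) = c *\<^sub>R (T h x - x) + d *\<^sub>R (T h y - y)"
        using that xy by (simp add: T_lin scaleR_diff_right)
      then show ?thesis by (simp add: scaleR_add_right scaleR_left_commute[of "1 / h"] del: scaleR_scaleR)
    qed
    then show "\<forall>\<^sub>F h in at_right 0. c *\<^sub>R ((1 / h) *\<^sub>R (T h x - x)) + d *\<^sub>R ((1 / h) *\<^sub>R (T h y - y))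
        = (1 / h) *\<^sub>R (T h (c *\<^sub>R x + d *\<^sub>R y) - (c *\<^sub>R x + d *\<^sub>R y))"
      by (auto simp: eventually_at_filter)
  qed
qed

text \<open>The image \<open>f\<close> of \<open>y\<close> may lie outside the domain, but the
  difference quotients that converge to it lie inside and can be differentiated along the
  semigroup.\<close>

lemma gen_quotient:
  assumes "gen y f" "0 < h"
  shows "gen ((1 / h) *\<^sub>R (T h y - y)) ((1 / h) *\<^sub>R (T h f - f))"
proof -
  have eq: "(1 / h) *\<^sub>R a + (- (1 / h)) *\<^sub>R b = (1 / h) *\<^sub>R (a - b)" for a b :: 'b
    by (simp add: scaleR_diff_right)
  show ?thesis
    using gen_lin[OF gen_T[OF assms(1) less_imp_le[OF assms(2)]] assms(1), of "1 / h" "- (1 / h)"]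
    unfolding eq .
qed

end

section \<open>Decay from dissipation and a multiplier inequality\<close>

text \<open>\<open>en\<close> is the energy inner product and \<open>B\<close> extracts the damped
  components. Energy is lost only through \<open>B\<close>, so the remaining components have to be
  controlled by a multiplier inequality.\<close>

locale dissipative_semigroup = semigroup_on Y T
  for Y :: "'b::real_normed_vector set" and T +
  fixes en :: "'b \<Rightarrow> 'b \<Rightarrow> real" and e\<^sub>0 \<delta> :: real
    and B :: "'b \<Rightarrow> 'c::real_normed_vector"
  assumes bilin_en: "bounded_bilinear en" and en_sym: "en x y = en y x"
    and e\<^sub>0: "e\<^sub>0 > 0" and en_coercive: "e\<^sub>0 * (norm y)\<^sup>2 \<le> en y y"
    and lin_B: "bounded_linear B" and \<delta>: "\<delta> > 0"
    and dissipation: "gen y f \<Longrightarrow> en f y \<le> - \<delta> * (norm (B y))\<^sup>2"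
begin

lemma en_deriv:
  assumes "gen y f" "0 \<le> t"
  shows "((\<lambda>s. en (T s y) (T s y)) has_vector_derivative 2 * en (T t f) (T t y)) (at_right t)"
  using bounded_bilinear.has_vector_derivative[OF bilin_en gen_deriv[OF assms] gen_deriv[OF assms]]
  unfolding en_sym[of "T t y" "T t f"] by simp

lemma T_continuous_Icc: "y \<in> Y \<Longrightarrow> continuous_on {0..t} (\<lambda>s. T s y)"
  by (rule continuous_on_subset[OF T_continuous_on]) auto

lemma en_T_le_dom:
  assumes "gen y f" "0 \<le> t" shows "en (T t y) (T t y) \<le> en y y"
proof -
  have y: "y \<in> Y" using assms by (simp add: gen_def)
  have "en (T t y) (T t y) \<le> en (T 0 y) (T 0 y)"
  proof (rule right_deriv_nonpos_imp_le[OF assms(2)])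
    show "continuous_on {0..t} (\<lambda>t. en (T t y) (T t y))"
      by (intro bounded_bilinear.continuous_on[OF bilin_en] T_continuous_Icc y)
    fix s assume s: "0 \<le> s" "s < t"
    have "en (T s f) (T s y) \<le> 0"
      by (rule order_trans[OF dissipation[OF gen_T[OF assms(1) s(1)]]]) (use \<delta> in simp)
    then show "\<exists>D\<le>0. ((\<lambda>t. en (T t y) (T t y)) has_vector_derivative D) (at_right s)"
      using en_deriv[OF assms(1) s(1)] by (intro exI[of _ "2 * en (T s f) (T s y)"]) auto
  qed
  then show ?thesis using y by (simp add: T_zero)
qed

text \<open>Both sides of the energy bound are continuous in the initial value for fixed t, so it
  passes from the domain to limits of domain elements.\<close>

lemma en_T_le:
  assumes "(g \<longlongrightarrow> x) F" "\<forall>\<^sub>F h in F. \<exists>f. gen (g h) f" "F \<noteq> bot" "x \<in> Y" "0 \<le> t"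
  shows "en (T t x) (T t x) \<le> en x x"
proof (rule tendsto_le[OF assms(3)])
  show "((\<lambda>h. en (g h) (g h)) \<longlongrightarrow> en x x) F"
    by (intro bounded_bilinear.tendsto[OF bilin_en] assms)
  have "((\<lambda>h. T t (g h)) \<longlongrightarrow> T t x) F"
    by (rule T_tendsto[OF assms(5,1) _ assms(4)]) (use assms(2) in eventually_elim, auto simp: gen_def)
  then show "((\<lambda>h. en (T t (g h)) (T t (g h))) \<longlongrightarrow> en (T t x) (T t x)) F"
    by (intro bounded_bilinear.tendsto[OF bilin_en])
  show "\<forall>\<^sub>F h in F. en (T t (g h)) (T t (g h)) \<le> en (g h) (g h)"
    using assms(2) by eventually_elim (auto intro: en_T_le_dom assms)
qed

text \<open>The difference is the limit, as k tends to 0, of the domain elements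
  \<open>?q k - ?q h\<close>. Thus the error made by replacing the derivative by a quotient never
  exceeds its initial size, uniformly in time.\<close>

lemma en_T_quotient_diff_le:
  assumes "gen y f" "0 < h" "0 \<le> t"
  defines "w \<equiv> f - (1 / h) *\<^sub>R (T h y - y)"
  shows "en (T t w) (T t w) \<le> en w w"
proof (rule en_T_le)
  let ?q = "\<lambda>h. (1 / h) *\<^sub>R (T h y - y)"
  have q: "(?q \<longlongrightarrow> f) (at_right 0)" and Y: "y \<in> Y" "f \<in> Y" using assms by (auto simp: gen_def)
  show "((\<lambda>k. ?q k - ?q h) \<longlongrightarrow> w) (at_right 0)" unfolding w_def by (intro tendsto_intros q)
  have "\<exists>g. gen (?q k - ?q h) g" if "k > 0" for k
    using gen_lin[OF gen_quotient[OF assms(1) that] gen_quotient[OF assms(1,2)], of 1 "-1"] by auto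
  then show "\<forall>\<^sub>F k in at_right 0. \<exists>g. gen (?q k - ?q h) g"
    by (auto simp: eventually_at_filter)
  show "w \<in> Y" unfolding w_def using Y assms by (auto intro!: diff_in scale_in T_in)
qed (use assms in auto)

text \<open>The pairings are bounded by a multiple of |y| |f|, and dissipation bounds |B y|^2 by the
  same product. Young's inequality then absorbs |y|. This bounds the inverse of the generator, and
  it lets the final estimate depend on the image \<open>f\<close> alone.\<close>

lemma mult_growth_bound:
  assumes bg: "bounded_bilinear g" and c: "c > 0" and C: "C \<ge> 0"
    and mult: "\<And>y f. gen y f \<Longrightarrow>
      c * (norm y)\<^sup>2 \<le> g f y + g y f + C * ((norm (B y))\<^sup>2 + (norm (B f))\<^sup>2)"
  shows "\<exists>K. \<forall>y f. gen y f \<longrightarrow> (norm y)\<^sup>2 \<le> K * (norm f)\<^sup>2"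
proof -
  obtain G where G: "\<And>x y. norm (g x y) \<le> norm x * norm y * G"
    using bounded_bilinear.pos_bounded[OF bg] by blast
  obtain e1 where e1: "\<And>x y. norm (en x y) \<le> norm x * norm y * e1"
    using bounded_bilinear.pos_bounded[OF bilin_en] by blast
  obtain b where b: "\<And>x. norm (B x) \<le> norm x * b"
    using bounded_linear.bounded[OF lin_B] by blast
  define A D where "A = 2 * G + C * e1 / \<delta>" and "D = C * b\<^sup>2"
  have "(norm y)\<^sup>2 \<le> (A\<^sup>2 / c\<^sup>2 + 2 * D / c) * (norm f)\<^sup>2" if yf: "gen y f" for y f
  proof -
    define p q where "p = norm y" and "q = norm f"
    have 1: "g f y \<le> G * p * q" "g y f \<le> G * p * q"
      using G[of f y] G[of y f] by (auto simp: p_def q_def algebra_simps)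
    have "\<delta> * (norm (B y))\<^sup>2 \<le> e1 * p * q"
      using dissipation[OF yf] e1[of f y] by (auto simp: p_def q_def algebra_simps)
    then have 2: "(norm (B y))\<^sup>2 \<le> e1 * p * q / \<delta>" using \<delta> by (simp add: field_simps)
    have 3: "(norm (B f))\<^sup>2 \<le> (q * b)\<^sup>2" using b[of f] by (intro power_mono) (auto simp: q_def)
    have "c * p\<^sup>2 \<le> 2 * (G * p * q) + C * (e1 * p * q / \<delta> + (q * b)\<^sup>2)"
      using mult[OF yf] 1 mult_left_mono[OF add_mono[OF 2 3] C] by (simp add: p_def)
    also have "\<dots> = A * p * q + D * q\<^sup>2" by (simp add: A_def D_def field_simps power2_eq_square)
    also have "A * p * q \<le> c * p\<^sup>2 / 2 + A\<^sup>2 * q\<^sup>2 / (2 * c)"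
    proof -
      have "0 \<le> (c * p - A * q)\<^sup>2" by simp
      then show ?thesis using c by (simp add: field_simps power2_eq_square)
    qed
    finally have "c * p\<^sup>2 / 2 \<le> A\<^sup>2 * q\<^sup>2 / (2 * c) + D * q\<^sup>2" by simp
    then have "p\<^sup>2 \<le> (A\<^sup>2 * q\<^sup>2 / (2 * c) + D * q\<^sup>2) * 2 / c" using c by (simp add: field_simps)
    also have "\<dots> = (A\<^sup>2 / c\<^sup>2 + 2 * D / c) * q\<^sup>2" using c by (simp add: field_simps power2_eq_square)
    finally show ?thesis by (simp add: p_def q_def)
  qed
  then show ?thesis by blast
qed

text \<open>The energy of the difference quotient of an orbit stands in for the energy of its time
  derivative, which need not be differentiable in time.\<close>

lemma lyapunov_estimate:
  assumes bg: "bounded_bilinear g" and c: "c > 0" and C: "C > 0"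
    and mult: "\<And>y f. gen y f \<Longrightarrow>
      c * en y y \<le> g f y + g y f + C * ((norm (B y))\<^sup>2 + (norm (B f))\<^sup>2)"
    and yf: "gen y f" and t: "0 \<le> t"
  shows "c * t * en (T t y) (T t y) \<le>
    C / (2 * \<delta>) * en y y + C / \<delta> * en f f - g y y + g (T t y) (T t y)"
proof -
  let ?q = "\<lambda>h. (1 / h) *\<^sub>R (T h y - y)"
  have q: "(?q \<longlongrightarrow> f) (at_right 0)" and Y: "y \<in> Y" "f \<in> Y" using yf by (auto simp: gen_def)
  obtain b where b: "\<And>x. norm (B x) \<le> norm x * b" "b > 0"
    using bounded_linear.pos_bounded[OF lin_B] by blast
  \<comment> \<open>The price for replacing B f by B z: a factor 2 from squaring a sum, the squared
    bound of \<open>B\<close>, and coercivity. It multiplies the energy of f - z, which tends to 0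
    with h.\<close>
  define \<mu> where "\<mu> = 2 * C * b\<^sup>2 / e\<^sub>0"
  have est: "c * t * en (T t y) (T t y) \<le> C / (2 * \<delta>) * en y y + C / \<delta> * en (?q h) (?q h)
      - g y y + g (T t y) (T t y) + \<mu> * en (f - ?q h) (f - ?q h) * t" if h: "h > 0" for h
  proof -
    define z fz where "z = ?q h" and "fz = (1 / h) *\<^sub>R (T h f - f)"
    have z: "gen z fz" unfolding z_def fz_def by (rule gen_quotient[OF yf h])
    have zY: "z \<in> Y" using z by (simp add: gen_def)
    define \<kappa> where "\<kappa> = \<mu> * en (f - z) (f - z)"
    \<comment> \<open>The weights make the derivative nonpositive. The energy of y with weight C /
      (2 \<delta>) pays for C |B y|^2, that of z with weight C / \<delta> pays for the 2 C |B z|^2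
      that bounds C |B f|^2 up to \<kappa>, and the term - \<kappa> s pays for this remainder. The
      product of s with the energy produces the factor t of the claim.\<close>
    define F where "F s = C / (2 * \<delta>) * en (T s y) (T s y) + C / \<delta> * en (T s z) (T s z)
      - g (T s y) (T s y) + c * (s * en (T s y) (T s y)) - \<kappa> * s" for s
    have "F t \<le> F 0"
    proof (rule right_deriv_nonpos_imp_le[OF t])
      show "continuous_on {0..t} F" unfolding F_def
        by (intro continuous_intros bounded_bilinear.continuous_on[OF bilin_en]
            bounded_bilinear.continuous_on[OF bg] T_continuous_Icc Y zY)
      fix s assume s: "0 \<le> s" "s < t"
      note dy = gen_deriv[OF yf s(1)]
      let ?y = "T s y" and ?f = "T s f" and ?z = "T s z"
      define D where "D = C / (2 * \<delta>) * (2 * en ?f ?y) + C / \<delta> * (2 * en (T s fz) ?z)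
        - (g ?y ?f + g ?f ?y) + c * (s * (2 * en ?f ?y) + 1 * en ?y ?y) - \<kappa> * 1"
      have "(F has_vector_derivative D) (at_right s)"
        unfolding F_def D_def
        by (intro has_vector_derivative_add has_vector_derivative_diff has_vector_derivative_mult
            bounded_linear.has_vector_derivative[OF bounded_linear_mult_right]
            en_deriv[OF yf s(1)] en_deriv[OF z s(1)] bounded_bilinear.has_vector_derivative[OF bg]
            dy has_vector_derivative_id)
      moreover have "D \<le> 0"
      proof -
        have gy: "gen ?y ?f" and gz: "gen ?z (T s fz)" using gen_T yf z s by auto
        have dB: "(norm (B ?f))\<^sup>2 \<le> 2 * (norm (B ?z))\<^sup>2 + 2 * (b\<^sup>2 / e\<^sub>0 * en (f - z) (f - z))"
        proof -
          have "B ?f = B ?z + B (?f - ?z)" by (simp add: linear_simps(2)[OF lin_B])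
          then have "norm (B ?f) \<le> norm (B ?z) + norm (B (?f - ?z))" by (metis norm_triangle_ineq)
          then have "(norm (B ?f))\<^sup>2 \<le> (norm (B ?z) + norm (B (?f - ?z)))\<^sup>2" by (intro power_mono) auto
          also have "\<dots> \<le> 2 * (norm (B ?z))\<^sup>2 + 2 * (norm (B (?f - ?z)))\<^sup>2"
            using sum_squares_bound[of "norm (B ?z)" "norm (B (?f - ?z))"]
            by (simp add: power2_sum)
          also have "(norm (B (?f - ?z)))\<^sup>2 \<le> (norm (?f - ?z) * b)\<^sup>2" by (intro power_mono b) auto
          also have "\<dots> = b\<^sup>2 * (norm (?f - ?z))\<^sup>2" by (simp add: power_mult_distrib mult.commute)
          also have "(norm (?f - ?z))\<^sup>2 \<le> en (?f - ?z) (?f - ?z) / e\<^sub>0"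
            using en_coercive[of "?f - ?z"] e\<^sub>0 by (simp add: field_simps)
          also have "en (?f - ?z) (?f - ?z) \<le> en (f - z) (f - z)"
            using en_T_quotient_diff_le[OF yf h s(1)] s Y zY by (simp add: z_def[symmetric] T_diff)
          finally show ?thesis using e\<^sub>0 by (simp add: divide_right_mono mult_left_mono)
        qed
        have "C / (2 * \<delta>) * (2 * en ?f ?y) \<le> C / (2 * \<delta>) * (2 * (- \<delta> * (norm (B ?y))\<^sup>2))"
          using C \<delta> dissipation[OF gy] by (intro mult_left_mono) auto
        moreover have "C / \<delta> * (2 * en (T s fz) ?z) \<le> C / \<delta> * (2 * (- \<delta> * (norm (B ?z))\<^sup>2))"
          using C \<delta> dissipation[OF gz] by (intro mult_left_mono) auto
        moreover have "c * (s * (2 * en ?f ?y)) \<le> 0"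
        proof -
          have "en ?f ?y \<le> 0" by (rule order_trans[OF dissipation[OF gy]]) (use \<delta> in simp)
          then show ?thesis using c s by (simp add: mult_nonneg_nonpos)
        qed
        moreover have "C * (norm (B ?f))\<^sup>2 \<le> C * (2 * (norm (B ?z))\<^sup>2) + \<kappa>"
          using mult_left_mono[OF dB, of C] C by (simp add: \<kappa>_def \<mu>_def algebra_simps)
        ultimately show ?thesis
          using mult[OF gy] C \<delta> by (simp add: D_def algebra_simps)
      qed
      ultimately show "\<exists>D\<le>0. (F has_vector_derivative D) (at_right s)" by blast
    qed
    then have "c * (t * en (T t y) (T t y)) \<le> C / (2 * \<delta>) * en y y + C / \<delta> * en z z
        - g y y + g (T t y) (T t y) + \<kappa> * t
        - (C / (2 * \<delta>) * en (T t y) (T t y) + C / \<delta> * en (T t z) (T t z))"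
      using Y zY by (simp add: F_def T_zero)
    moreover have "0 \<le> en x x" for x
      using en_coercive[of x] e\<^sub>0 by (meson less_imp_le mult_nonneg_nonneg order_trans zero_le_power2)
    then have "0 \<le> C / (2 * \<delta>) * en (T t y) (T t y) + C / \<delta> * en (T t z) (T t z)"
      using C \<delta> by simp
    ultimately show ?thesis unfolding z_def[symmetric] \<kappa>_def[symmetric] by (simp add: mult.assoc)
  qed
  have "((\<lambda>h. C / (2 * \<delta>) * en y y + C / \<delta> * en (?q h) (?q h)
      - g y y + g (T t y) (T t y) + \<mu> * en (f - ?q h) (f - ?q h) * t) \<longlongrightarrow>
      C / (2 * \<delta>) * en y y + C / \<delta> * en f f - g y y + g (T t y) (T t y) + \<mu> * en (f - f) (f - f) * t)
      (at_right 0)"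
    by (intro tendsto_intros bounded_bilinear.tendsto[OF bilin_en] q)
  then have "c * t * en (T t y) (T t y) \<le>
      C / (2 * \<delta>) * en y y + C / \<delta> * en f f - g y y + g (T t y) (T t y) + \<mu> * en (f - f) (f - f) * t"
    by (rule tendsto_lowerbound) (use est in \<open>simp_all add: eventually_at_filter\<close>)
  then show ?thesis by (simp add: bounded_bilinear.zero_left[OF bilin_en])
qed

text \<open>The Lyapunov estimate bounds t |T t y|^2 by the sizes of y and f, and the growth bound
  eliminates y. The summand without the factor t follows from the energy bound together with the
  growth bound.\<close>

theorem polynomial_decay:
  assumes bg: "bounded_bilinear g" and c: "c > 0" and C: "C > 0"
    and mult: "\<And>y f. gen y f \<Longrightarrow>
      c * (norm y)\<^sup>2 \<le> g f y + g y f + C * ((norm (B y))\<^sup>2 + (norm (B f))\<^sup>2)"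
  shows "\<exists>K>0. \<forall>y f t. gen y f \<longrightarrow> 0 \<le> t \<longrightarrow> (1 + t) * (norm (T t y))\<^sup>2 \<le> K * (norm f)\<^sup>2"
proof -
  obtain K1 where K1: "\<And>y f. gen y f \<Longrightarrow> (norm y)\<^sup>2 \<le> K1 * (norm f)\<^sup>2"
    using mult_growth_bound[OF bg c less_imp_le[OF C] mult] by blast
  obtain G where G: "\<And>x y. norm (g x y) \<le> norm x * norm y * G" "G > 0"
    using bounded_bilinear.pos_bounded[OF bg] by blast
  obtain e1 where e1: "\<And>x y. norm (en x y) \<le> norm x * norm y * e1" "e1 > 0"
    using bounded_bilinear.pos_bounded[OF bilin_en] by blast
  have en1: "en x x \<le> e1 * (norm x)\<^sup>2" for x
    using e1(1)[of x x] by (simp add: power2_eq_square algebra_simps)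
  have gg: "\<bar>g x x\<bar> \<le> G * (norm x)\<^sup>2" for x
    using G(1)[of x x] by (simp add: power2_eq_square algebra_simps)
  \<comment> \<open>The multiplier inequality is given for the norm; dividing by the upper energy
    constant restates it for the energy.\<close>
  define c' where "c' = c / e1"
  have c': "c' > 0" using c e1 by (simp add: c'_def)
  have mult': "c' * en y y \<le> g f y + g y f + C * ((norm (B y))\<^sup>2 + (norm (B f))\<^sup>2)" if "gen y f" for y f
  proof -
    have "c' * en y y \<le> c' * (e1 * (norm y)\<^sup>2)" using en1 c' by (intro mult_left_mono) auto
    then show ?thesis using mult[OF that] e1 by (simp add: c'_def)
  qed
  define K2 where "K2 = e1 / e\<^sub>0"
  have K2: "K2 \<ge> 0" using e1 e\<^sub>0 by (simp add: K2_def)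
  have contr: "(norm (T t y))\<^sup>2 \<le> K2 * (norm y)\<^sup>2" if "gen y f" "0 \<le> t" for y f t
  proof -
    have "e\<^sub>0 * (norm (T t y))\<^sup>2 \<le> e1 * (norm y)\<^sup>2"
      using en_coercive[of "T t y"] en_T_le_dom[OF that] en1[of y] by linarith
    then show ?thesis using e\<^sub>0 by (simp add: K2_def field_simps)
  qed
  define A where "A = (C / (2 * \<delta>) * e1 + G + G * K2) * \<bar>K1\<bar> + C / \<delta> * e1"
  \<comment> \<open>The middle summand bounds |T t y|^2, the last one t |T t y|^2; the 1 secures
    positivity. The absolute value of \<open>K1\<close> appears because its sign is unknown.\<close>
  define K where "K = 1 + K2 * \<bar>K1\<bar> + A / (c' * e\<^sub>0)"
  have A: "A \<ge> 0" using C \<delta> e1 G K2 by (simp add: A_def)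
  have "(1 + t) * (norm (T t y))\<^sup>2 \<le> K * (norm f)\<^sup>2" if yf: "gen y f" and t: "0 \<le> t" for y f t
  proof -
    have y: "(norm y)\<^sup>2 \<le> \<bar>K1\<bar> * (norm f)\<^sup>2"
      using K1[OF yf] by (meson abs_ge_self mult_right_mono order_trans zero_le_power2)
    have "c' * t * (e\<^sub>0 * (norm (T t y))\<^sup>2) \<le> c' * t * en (T t y) (T t y)"
      using c' t en_coercive by (intro mult_left_mono) auto
    also have "\<dots> \<le> C / (2 * \<delta>) * en y y + C / \<delta> * en f f - g y y + g (T t y) (T t y)"
      by (rule lyapunov_estimate[OF bg c' C mult' yf t])
    also have "\<dots> \<le> C / (2 * \<delta>) * (e1 * (norm y)\<^sup>2) + C / \<delta> * (e1 * (norm f)\<^sup>2)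
        + G * (norm y)\<^sup>2 + G * (K2 * (norm y)\<^sup>2)"
    proof -
      have "C / (2 * \<delta>) * en y y \<le> C / (2 * \<delta>) * (e1 * (norm y)\<^sup>2)"
        "C / \<delta> * en f f \<le> C / \<delta> * (e1 * (norm f)\<^sup>2)"
        using C \<delta> by (intro mult_left_mono en1; simp)+
      moreover have "G * (norm (T t y))\<^sup>2 \<le> G * (K2 * (norm y)\<^sup>2)"
        using contr[OF yf t] G by (intro mult_left_mono) auto
      ultimately show ?thesis using gg[of y] gg[of "T t y"] by linarith
    qed
    also have "\<dots> = (C / (2 * \<delta>) * e1 + G + G * K2) * (norm y)\<^sup>2 + C / \<delta> * (e1 * (norm f)\<^sup>2)"
      by (simp add: algebra_simps)
    also have "\<dots> \<le> (C / (2 * \<delta>) * e1 + G + G * K2) * (\<bar>K1\<bar> * (norm f)\<^sup>2) + C / \<delta> * (e1 * (norm f)\<^sup>2)"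
      using C \<delta> e1 G K2 by (intro add_mono mult_left_mono y) auto
    also have "\<dots> = A * (norm f)\<^sup>2" by (simp add: A_def algebra_simps)
    finally have "t * (norm (T t y))\<^sup>2 \<le> A / (c' * e\<^sub>0) * (norm f)\<^sup>2"
      using c' e\<^sub>0 by (simp add: field_simps)
    moreover have "(norm (T t y))\<^sup>2 \<le> K2 * (\<bar>K1\<bar> * (norm f)\<^sup>2)"
      using contr[OF yf t] mult_left_mono[OF y K2] by linarith
    moreover have "0 \<le> (norm f)\<^sup>2" by simp
    moreover have "K * (norm f)\<^sup>2 = (norm f)\<^sup>2 + K2 * (\<bar>K1\<bar> * (norm f)\<^sup>2) + A / (c' * e\<^sub>0) * (norm f)\<^sup>2"
      by (simp add: K_def algebra_simps)
    ultimately show ?thesis by (simp only: distrib_right)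
  qed
  moreover have "K > 0" using K2 A c' e\<^sub>0 by (simp add: K_def add_pos_nonneg)
  ultimately show ?thesis by blast
qed

end

section \<open>The multiplier estimate\<close>

lemma bounded_bilinear_inner_comp:
  assumes "bounded_linear L" "bounded_linear M"
  shows "bounded_bilinear (\<lambda>x y. inner (L x) (M y))"
  using bounded_bilinear.comp[OF bounded_bilinear_inner assms] .

lemma bounded_bilinear_plus:
  assumes f: "bounded_bilinear f" and g: "bounded_bilinear g"
  shows "bounded_bilinear (\<lambda>x y. f x y + g x y)"
proof -
  interpret f: bounded_bilinear f by (rule f)
  interpret g: bounded_bilinear g by (rule g)
  obtain K where K: "\<And>a b. norm (f a b) \<le> norm a * norm b * K" using f.bounded by blast
  obtain L where L: "\<And>a b. norm (g a b) \<le> norm a * norm b * L" using g.bounded by blast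
  show ?thesis
  proof
    show "\<exists>K. \<forall>a b. norm (f a b + g a b) \<le> norm a * norm b * K"
      by (rule exI[of _ "K + L"]) (use norm_triangle_mono[OF K L] in \<open>simp add: algebra_simps\<close>)
  qed (simp_all add: f.add_left f.add_right g.add_left g.add_right f.scaleR_left f.scaleR_right
      g.scaleR_left g.scaleR_right scaleR_add_right)
qed

lemma bounded_bilinear_cmult:
  fixes f :: "'a::real_normed_vector \<Rightarrow> 'b::real_normed_vector \<Rightarrow> real"
  assumes f: "bounded_bilinear f" shows "bounded_bilinear (\<lambda>x y. c * f x y)"
proof -
  interpret f: bounded_bilinear f by (rule f)
  obtain K where K: "\<And>a b. norm (f a b) \<le> norm a * norm b * K" using f.bounded by blast
  show ?thesis
  proof
    show "\<exists>K. \<forall>a b. norm (c * f a b) \<le> norm a * norm b * K"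
      by (rule exI[of _ "\<bar>c\<bar> * K"]) (use mult_left_mono[OF K abs_ge_zero[of c]] in \<open>simp add: abs_mult ac_simps\<close>)
  qed (simp_all add: f.add_left f.add_right f.scaleR_left f.scaleR_right algebra_simps)
qed

lemma norm_prod_power2: "(norm x)\<^sup>2 = (norm (fst x))\<^sup>2 + (norm (snd x))\<^sup>2"
  by (simp add: norm_prod_def)

lemma norm_Pair_power2: "(norm (x, y))\<^sup>2 = (norm x)\<^sup>2 + (norm y)\<^sup>2"
  by (simp add: norm_Pair)

lemma bounded_linear_fst_comp: "bounded_linear f \<Longrightarrow> bounded_linear (\<lambda>x. fst (f x))"
  by (rule bounded_linear_compose[OF bounded_linear_fst])

lemma bounded_linear_snd_comp: "bounded_linear f \<Longrightarrow> bounded_linear (\<lambda>x. snd (f x))"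
  by (rule bounded_linear_compose[OF bounded_linear_snd])

lemma bounded_linear_scaleR_comp: "bounded_linear f \<Longrightarrow> bounded_linear (\<lambda>x. c *\<^sub>R f x)"
  by (rule bounded_linear_compose[OF bounded_linear_scaleR_right])

lemmas bounded_bilinear_rules =
  bounded_bilinear_plus bounded_bilinear_cmult bounded_bilinear_inner_comp
  bounded_linear_add bounded_linear_sub bounded_linear_minus bounded_linear_scaleR_comp
  bounded_linear_fst_comp bounded_linear_snd_comp bounded_linear_ident

type_synonym 'a vec9 = "'a \<times> 'a \<times> 'a \<times> 'a \<times> 'a \<times> 'a \<times> 'a \<times> 'a \<times> 'a"

abbreviation "v\<^sub>c x \<equiv> fst x"
abbreviation "a\<^sub>c x \<equiv> fst (snd x)"
abbreviation "\<Phi>\<^sub>c x \<equiv> fst (snd (snd x))"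
abbreviation "\<Psi>\<^sub>c x \<equiv> fst (snd (snd (snd x)))"
abbreviation "p\<^sub>c x \<equiv> fst (snd (snd (snd (snd x))))"
abbreviation "z\<^sub>c x \<equiv> fst (snd (snd (snd (snd (snd x)))))"
abbreviation "s\<^sub>c x \<equiv> fst (snd (snd (snd (snd (snd (snd x))))))"
abbreviation "\<theta>\<^sub>c x \<equiv> fst (snd (snd (snd (snd (snd (snd (snd x)))))))"
abbreviation "q\<^sub>c x \<equiv> snd (snd (snd (snd (snd (snd (snd (snd x)))))))"

lemma norm_vec9:
  fixes y :: "'a::real_normed_vector vec9"
  shows "(norm y)\<^sup>2 = (norm (v\<^sub>c y))\<^sup>2 + (norm (a\<^sub>c y))\<^sup>2 + (norm (\<Phi>\<^sub>c y))\<^sup>2 + (norm (\<Psi>\<^sub>c y))\<^sup>2 + (norm (p\<^sub>c y))\<^sup>2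
    + (norm (z\<^sub>c y))\<^sup>2 + (norm (s\<^sub>c y))\<^sup>2 + (norm (\<theta>\<^sub>c y))\<^sup>2 + (norm (q\<^sub>c y))\<^sup>2"
  unfolding norm_prod_power2[of y] norm_prod_power2[of "snd y"] norm_prod_power2[of "snd (snd y)"]
   norm_prod_power2[of "snd (snd (snd y))"] norm_prod_power2[of "snd (snd (snd (snd y)))"]
   norm_prod_power2[of "snd (snd (snd (snd (snd y))))"] norm_prod_power2[of "snd (snd (snd (snd (snd (snd y)))))"]
   norm_prod_power2[of "snd (snd (snd (snd (snd (snd (snd y))))))"] add.assoc ..

section \<open>The beam equations in a real inner product space\<close>

locale coupled_beam =
  fixes \<rho> \<rho>\<^sub>1 \<rho>\<^sub>2 \<rho>\<^sub>3 \<alpha> \<kappa> b \<tau> \<sigma> \<beta> \<gamma> m :: real and P :: "'a::real_inner \<Rightarrow> 'a"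
  assumes pos: "\<rho> > 0" "\<rho>\<^sub>1 > 0" "\<rho>\<^sub>2 > 0" "\<rho>\<^sub>3 > 0" "\<alpha> > 0" "\<kappa> > 0" "b > 0"
    "\<tau> > 0" "\<sigma> > 0" "\<beta> > 0" "\<gamma> > 0" and m: "m \<noteq> 0"
    and P: "bounded_linear P"
begin

lemma P_simps: "P (x + y) = P x + P y" "P (x - y) = P x - P y" "P (- x) = - P x"
  "P (c *\<^sub>R x) = c *\<^sub>R P x"
  using linear_simps[OF P] by auto

definition en :: "'a vec9 \<Rightarrow> 'a vec9 \<Rightarrow> real" where
  "en x y = \<rho> * inner (v\<^sub>c x) (v\<^sub>c y) + \<alpha> * inner (a\<^sub>c x) (a\<^sub>c y) + \<rho>\<^sub>1 * inner (\<Phi>\<^sub>c x) (\<Phi>\<^sub>c y)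
     + \<rho>\<^sub>2 * inner (\<Psi>\<^sub>c x) (\<Psi>\<^sub>c y) + b * inner (p\<^sub>c x) (p\<^sub>c y) + \<beta> * inner (z\<^sub>c x) (z\<^sub>c y)
     + \<kappa> * inner (s\<^sub>c x) (s\<^sub>c y) + \<rho>\<^sub>3 * inner (\<theta>\<^sub>c x) (\<theta>\<^sub>c y) + \<tau> * inner (q\<^sub>c x) (q\<^sub>c y)"

text \<open>The arguments stand for \<open>(v, u\<^sub>x, \<Phi>, \<Psi>, \<psi>\<^sub>x, \<phi> - u, \<phi>\<^sub>x + \<psi>, \<theta>, q)\<close>, taken at a state in the domain
  of the generator and at its image; \<open>ax\<close>, \<open>sx\<close>, \<open>\<theta>x\<close>, \<open>qx\<close>, \<open>px\<close> stand for \<open>u\<^sub>x\<^sub>x\<close>,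
  \<open>(\<phi>\<^sub>x + \<psi>)\<^sub>x\<close>, \<open>\<theta>\<^sub>x\<close>, \<open>q\<^sub>x\<close>, \<open>\<psi>\<^sub>x\<^sub>x\<close>, and \<open>P\<close> for integration from \<open>0\<close>.\<close>

definition config :: "'a vec9 \<Rightarrow> 'a vec9 \<Rightarrow> bool" where
  "config = (\<lambda>(v, a, \<Phi>, \<Psi>, p, z, s, \<theta>, q) (v', a', \<Phi>', \<Psi>', p', z', s', \<theta>', q').
     \<exists>ax sx \<theta>x qx px.
       \<rho> *\<^sub>R v' = \<alpha> *\<^sub>R ax + \<beta> *\<^sub>R z - \<gamma> *\<^sub>R v \<and>
       \<rho>\<^sub>1 *\<^sub>R \<Phi>' = \<kappa> *\<^sub>R sx - \<beta> *\<^sub>R z - m *\<^sub>R \<theta>x \<and>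
       \<rho>\<^sub>2 *\<^sub>R \<Psi>' = b *\<^sub>R px - \<kappa> *\<^sub>R s + m *\<^sub>R \<theta> \<and>
       \<rho>\<^sub>3 *\<^sub>R \<theta>' = - qx - m *\<^sub>R s' \<and>
       \<tau> *\<^sub>R q' = - \<sigma> *\<^sub>R q - \<theta>x \<and>
       z' = \<Phi> - v \<and>
       P ax = a \<and> P sx = s \<and> P \<theta>x = \<theta> \<and> P p' = \<Psi> \<and>
       inner qx (P \<Phi>) = - inner q \<Phi> \<and> inner a' (P \<Phi>) = - inner v \<Phi> \<and>
       inner \<theta>x p = - inner \<theta> px \<and> inner sx p = - inner s px \<and> inner ax p = - inner a px \<and>
       inner p p = - inner (P p) px \<and> inner p' p = - inner \<Psi> px \<and>
       inner p' q = - inner \<Psi> qx \<and> inner p' \<Phi> = - inner \<Psi> (s' - \<Psi>) \<and> inner p' v = - inner \<Psi> a' \<and>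
       inner sx z = - inner s (s - P p - a) \<and> inner ax z = - inner a (s - P p - a) \<and>
       inner ax v = - inner a a' \<and> inner sx \<Phi> = - inner s (s' - \<Psi>) \<and>
       inner \<theta>x \<Phi> = - inner \<theta> (s' - \<Psi>) \<and> inner \<theta>x q = - inner \<theta> qx)"

text \<open>The factors \<kappa> / m and \<alpha> are those that turn the pairings of m s and u_x
  with e into the square of e; \<open>\<rho>\<^sub>1\<close> is the inertia in the equation for
  \<Phi>.\<close>

definition g\<^sub>1 :: "'a vec9 \<Rightarrow> 'a vec9 \<Rightarrow> real" where
  "g\<^sub>1 x y = (\<kappa> * \<rho>\<^sub>1 / m) * inner (m *\<^sub>R s\<^sub>c x + \<rho>\<^sub>3 *\<^sub>R \<theta>\<^sub>c x) (P (\<Phi>\<^sub>c y))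
     + (\<alpha> * \<rho>\<^sub>1) * inner (a\<^sub>c x) (P (\<Phi>\<^sub>c y))"

text \<open>The first pairing yields the square of \<Phi>, the second that of the bending
  \<open>p\<close>. The bracket holds the Timoshenko pairings, corrections for the coupling to u,
  and a correction for unequal wave speeds. The factor in front of it turns an identity for
  \<open>b * \<rho>\<^sub>1\<close> times the square of \<Psi> into one for
  \<open>2 * \<rho>\<^sub>2\<close> times it: one half stays in \<open>elastic\<close>, the other
  pays for the bending energy.\<close>

definition g\<^sub>2 :: "'a vec9 \<Rightarrow> 'a vec9 \<Rightarrow> real" where
  "g\<^sub>2 x y = \<rho>\<^sub>1 * inner (z\<^sub>c x) (\<Phi>\<^sub>c y) + (- \<rho>\<^sub>2) * inner (\<Psi>\<^sub>c x) (P (p\<^sub>c y))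
     + (2 * \<rho>\<^sub>2 / (b * \<rho>\<^sub>1)) *
       ((\<kappa> * \<rho>\<^sub>2) * inner (\<Psi>\<^sub>c x) (s\<^sub>c y) + (b * \<rho>\<^sub>1) * inner (p\<^sub>c x) (\<Phi>\<^sub>c y)
        + (\<alpha> * \<rho>\<^sub>2) * inner (\<Psi>\<^sub>c x) (a\<^sub>c y) + (\<alpha> * \<rho>\<^sub>2) * inner (p\<^sub>c x) (v\<^sub>c y)
        + ((b * \<rho>\<^sub>1 - \<kappa> * \<rho>\<^sub>2) / m) * (inner (p\<^sub>c x) (q\<^sub>c y) + (- \<rho>\<^sub>3) * inner (\<Psi>\<^sub>c x) (\<theta>\<^sub>c y)))"

definition e\<^sub>c :: "'a vec9 \<Rightarrow> 'a" where
  "e\<^sub>c y = \<kappa> *\<^sub>R s\<^sub>c y + \<alpha> *\<^sub>R a\<^sub>c y"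

text \<open>By the equation for v this equals \<alpha> u_xx + \<beta> (\<phi> - u), so the spring
  force is - \<alpha> u_xx up to dissipated quantities, with the sign in which it enters
  here.\<close>

definition r\<^sub>d :: "'a \<times> 'a \<times> 'a \<times> 'a \<Rightarrow> 'a" where
  "r\<^sub>d d = \<gamma> *\<^sub>R fst d + \<rho> *\<^sub>R fst (snd d)"

text \<open>The heat flux law solved for the temperature gradient; with P this expresses \<theta> by
  q and q'.\<close>

definition t\<^sub>d :: "'a \<times> 'a \<times> 'a \<times> 'a \<Rightarrow> 'a" where
  "t\<^sub>d d = - \<sigma> *\<^sub>R fst (snd (snd d)) - \<tau> *\<^sub>R snd (snd (snd d))"

text \<open>The remainder in the identity for e. It is written as a form in the state and d = (v,
  v', q, q') so that boundedness alone makes it a product of the state norm with a dissipated norm;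
  \<open>h\<^sub>2\<close> is the analogue for \<open>elastic\<close>.\<close>

definition h\<^sub>1 :: "'a vec9 \<Rightarrow> 'a \<times> 'a \<times> 'a \<times> 'a \<Rightarrow> real" where
  "h\<^sub>1 y d = (\<kappa> / m) * ((- \<rho>\<^sub>1) * inner (\<Phi>\<^sub>c y) (fst (snd (snd d)))
       + (- \<rho>\<^sub>3) * inner (e\<^sub>c y) (P (t\<^sub>d d))
       + inner (m *\<^sub>R s\<^sub>c y + \<rho>\<^sub>3 *\<^sub>R \<theta>\<^sub>c y) (m *\<^sub>R P (t\<^sub>d d) + P (r\<^sub>d d)))
     + \<alpha> * (\<rho>\<^sub>1 * inner (\<Phi>\<^sub>c y) (fst d) + inner (a\<^sub>c y) (m *\<^sub>R P (t\<^sub>d d) + P (r\<^sub>d d)))"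

definition h\<^sub>2 :: "'a vec9 \<Rightarrow> 'a \<times> 'a \<times> 'a \<times> 'a \<Rightarrow> real" where
  "h\<^sub>2 y d = \<rho>\<^sub>1 * inner (\<Phi>\<^sub>c y) (fst d) + 2 * inner (z\<^sub>c y) (r\<^sub>d d) + m * inner (z\<^sub>c y) (t\<^sub>d d)
     + m * inner (P (p\<^sub>c y)) (P (t\<^sub>d d))
     + (2 * \<rho>\<^sub>2 / (b * \<rho>\<^sub>1)) *
       (b * inner (p\<^sub>c y) (r\<^sub>d d) + (- \<alpha> * \<rho>\<^sub>2) * inner (p\<^sub>c y) (fst (snd d))
        + (- \<alpha> * m) * inner (a\<^sub>c y) (P (t\<^sub>d d)) + (b * m) * inner (p\<^sub>c y) (t\<^sub>d d)
        + (- \<kappa> * m) * inner (s\<^sub>c y) (P (t\<^sub>d d))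
        + ((b * \<rho>\<^sub>1 - \<kappa> * \<rho>\<^sub>2) / m) * ((- 1) * inner (p\<^sub>c y) (snd (snd (snd d)))
           + (\<rho>\<^sub>3 / \<rho>\<^sub>2) * ((- b) * inner (p\<^sub>c y) (t\<^sub>d d) + (- \<kappa>) * inner (s\<^sub>c y) (P (t\<^sub>d d))
              + m * inner (\<theta>\<^sub>c y) (P (t\<^sub>d d)))))"

text \<open>The factor of e in the identity for \<open>elastic\<close>. In order, its summands stem
  from the pairing of \<phi> - u with \<Phi>, from the Timoshenko pairings, from the pairing of
  \<psi> with \<Psi>, and from eliminating (s, u_x).\<close>

definition X\<^sub>c :: "'a vec9 \<Rightarrow> 'a" where
  "X\<^sub>c y = (s\<^sub>c y - P (p\<^sub>c y) - a\<^sub>c y) + (2 * \<rho>\<^sub>2 / (b * \<rho>\<^sub>1) * \<kappa>) *\<^sub>R s\<^sub>c y - P (p\<^sub>c y) + (\<alpha> / \<kappa>) *\<^sub>R a\<^sub>c y"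

text \<open>The weight of u_x has two sources: \<alpha> from the spring energy, where the derivative
  of \<phi> - u contributes - u_x, and \<alpha>^2 / \<kappa> from replacing \<kappa> s by e -
  \<alpha> u_x in \<alpha> (s, u_x).\<close>

definition elastic :: "'a vec9 \<Rightarrow> real" where
  "elastic y = \<rho>\<^sub>1 * (norm (\<Phi>\<^sub>c y))\<^sup>2 + \<rho>\<^sub>2 * (norm (\<Psi>\<^sub>c y))\<^sup>2 + b * (norm (p\<^sub>c y))\<^sup>2
     + \<beta> * (norm (z\<^sub>c y))\<^sup>2 + \<alpha> * (\<alpha> / \<kappa> + 1) * (norm (a\<^sub>c y))\<^sup>2"

lemma P_comp: "bounded_linear f \<Longrightarrow> bounded_linear (\<lambda>x. P (f x))"
  by (rule bounded_linear_compose[OF P])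

lemma bounded_bilinear_forms:
  "bounded_bilinear en" "bounded_bilinear g\<^sub>1" "bounded_bilinear g\<^sub>2" "bounded_bilinear h\<^sub>1"
  "bounded_bilinear h\<^sub>2" "bounded_linear X\<^sub>c"
  unfolding en_def[abs_def] g\<^sub>1_def[abs_def] g\<^sub>2_def[abs_def] h\<^sub>1_def[abs_def] h\<^sub>2_def[abs_def]
    X\<^sub>c_def[abs_def] e\<^sub>c_def r\<^sub>d_def t\<^sub>d_def
  by (intro bounded_bilinear_rules P_comp)+

text \<open>After integration by parts the elastic, spring and thermal couplings cancel in pairs;
  the friction in v and the relaxation of q remain.\<close>

lemma dissipation:
  assumes "config y y'"
  shows "en y' y = - \<gamma> * (norm (v\<^sub>c y))\<^sup>2 - \<sigma> * (norm (q\<^sub>c y))\<^sup>2"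
proof -
  obtain v a \<Phi> \<Psi> p z s \<theta> q where y: "y = (v, a, \<Phi>, \<Psi>, p, z, s, \<theta>, q)" by (metis prod.collapse)
  obtain v' a' \<Phi>' \<Psi>' p' z' s' \<theta>' q' where y': "y' = (v', a', \<Phi>', \<Psi>', p', z', s', \<theta>', q')"
    by (metis prod.collapse)
  obtain ax sx \<theta>x qx px where
       eqs: "\<rho> *\<^sub>R v' = \<alpha> *\<^sub>R ax + \<beta> *\<^sub>R z - \<gamma> *\<^sub>R v"
       "\<rho>\<^sub>1 *\<^sub>R \<Phi>' = \<kappa> *\<^sub>R sx - \<beta> *\<^sub>R z - m *\<^sub>R \<theta>x"
       "\<rho>\<^sub>2 *\<^sub>R \<Psi>' = b *\<^sub>R px - \<kappa> *\<^sub>R s + m *\<^sub>R \<theta>"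
       "\<rho>\<^sub>3 *\<^sub>R \<theta>' = - qx - m *\<^sub>R s'"
       "\<tau> *\<^sub>R q' = - \<sigma> *\<^sub>R q - \<theta>x"
       "z' = \<Phi> - v"
    and ibp: "inner p' p = - inner \<Psi> px"
       "inner ax v = - inner a a'" "inner sx \<Phi> = - inner s (s' - \<Psi>)"
       "inner \<theta>x \<Phi> = - inner \<theta> (s' - \<Psi>)" "inner \<theta>x q = - inner \<theta> qx"
    using assms unfolding config_def y y' prod.case by (elim exE conjE) (rule that; assumption)
  have "en y' y = inner (\<rho> *\<^sub>R v') v + \<alpha> * inner a' a + inner (\<rho>\<^sub>1 *\<^sub>R \<Phi>') \<Phi> + inner (\<rho>\<^sub>2 *\<^sub>R \<Psi>') \<Psi>
     + b * inner p' p + \<beta> * inner z' z + \<kappa> * inner s' s + inner (\<rho>\<^sub>3 *\<^sub>R \<theta>') \<theta> + inner (\<tau> *\<^sub>R q') q"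
    by (simp add: en_def y y')
  also have "\<dots> = - \<gamma> * inner v v - \<sigma> * inner q q"
    unfolding eqs using ibp(1,2,5) arg_cong[OF ibp(3), of "\<lambda>x. \<kappa> * x"] arg_cong[OF ibp(4), of "\<lambda>x. m * x"]
    by (simp add: inner_simps algebra_simps inner_commute)
  finally show ?thesis by (simp add: y power2_norm_eq_inner)
qed

text \<open>The sum \<open>g y' y + g y y'\<close> is the time derivative of the quadratic form of
  \<open>g\<close> along an orbit. The identities are exact; estimates enter only
  afterwards.\<close>

lemma elastic_identities:
  assumes "config y y'"
  defines "d \<equiv> (v\<^sub>c y, v\<^sub>c y', q\<^sub>c y, q\<^sub>c y')"
  shows "(norm (e\<^sub>c y))\<^sup>2 = g\<^sub>1 y' y + g\<^sub>1 y y' + h\<^sub>1 y d"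
    and "elastic y = g\<^sub>2 y' y + g\<^sub>2 y y' + inner (X\<^sub>c y) (e\<^sub>c y) + h\<^sub>2 y d"
    and "\<theta>\<^sub>c y = P (t\<^sub>d d)"
proof -
  obtain v a \<Phi> \<Psi> p z s \<theta> q where y: "y = (v, a, \<Phi>, \<Psi>, p, z, s, \<theta>, q)" by (metis prod.collapse)
  obtain v' a' \<Phi>' \<Psi>' p' z' s' \<theta>' q' where y': "y' = (v', a', \<Phi>', \<Psi>', p', z', s', \<theta>', q')"
    by (metis prod.collapse)
  obtain ax sx \<theta>x qx px where
       eqs: "\<rho> *\<^sub>R v' = \<alpha> *\<^sub>R ax + \<beta> *\<^sub>R z - \<gamma> *\<^sub>R v"
       "\<rho>\<^sub>1 *\<^sub>R \<Phi>' = \<kappa> *\<^sub>R sx - \<beta> *\<^sub>R z - m *\<^sub>R \<theta>x"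
       "\<rho>\<^sub>2 *\<^sub>R \<Psi>' = b *\<^sub>R px - \<kappa> *\<^sub>R s + m *\<^sub>R \<theta>"
       "\<rho>\<^sub>3 *\<^sub>R \<theta>' = - qx - m *\<^sub>R s'"
       "\<tau> *\<^sub>R q' = - \<sigma> *\<^sub>R q - \<theta>x"
       "z' = \<Phi> - v"
    and prim: "P ax = a" "P sx = s" "P \<theta>x = \<theta>" "P p' = \<Psi>"
       "inner qx (P \<Phi>) = - inner q \<Phi>" "inner a' (P \<Phi>) = - inner v \<Phi>"
    and ibp: "inner \<theta>x p = - inner \<theta> px" "inner sx p = - inner s px" "inner ax p = - inner a px"
       "inner p p = - inner (P p) px"
       "inner p' q = - inner \<Psi> qx" "inner p' \<Phi> = - inner \<Psi> (s' - \<Psi>)" "inner p' v = - inner \<Psi> a'"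
       "inner sx z = - inner s (s - P p - a)" "inner ax z = - inner a (s - P p - a)"
    using assms(1) unfolding config_def y y' prod.case by (elim exE conjE) (rule that; assumption)
  define r e w where "r = \<gamma> *\<^sub>R v + \<rho> *\<^sub>R v'" and "e = \<kappa> *\<^sub>R s + \<alpha> *\<^sub>R a" and "w = m *\<^sub>R s + \<rho>\<^sub>3 *\<^sub>R \<theta>"
  have \<theta>x: "\<theta>x = t\<^sub>d d" using eqs(5) by (simp add: t\<^sub>d_def d_def y y' algebra_simps)
  have r: "r = r\<^sub>d d" by (simp add: r_def r\<^sub>d_def d_def y y')
  have \<theta>: "\<theta> = P (t\<^sub>d d)" using prim(3) \<theta>x by simp
  then show "\<theta>\<^sub>c y = P (t\<^sub>d d)" by (simp add: y)
  have rz: "\<beta> *\<^sub>R z = r - \<alpha> *\<^sub>R ax" using eqs(1) by (simp add: r_def algebra_simps)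
  have "P (\<rho>\<^sub>1 *\<^sub>R \<Phi>') = P (\<kappa> *\<^sub>R sx - (r - \<alpha> *\<^sub>R ax) - m *\<^sub>R \<theta>x)" unfolding eqs(2) rz ..
  then have P\<Phi>': "\<rho>\<^sub>1 *\<^sub>R P \<Phi>' = e - m *\<^sub>R \<theta> - P r"
    by (simp add: P_simps prim e_def algebra_simps)
  have in1: "\<rho>\<^sub>1 * inner x (P \<Phi>') = inner x (e - m *\<^sub>R \<theta> - P r)" for x
    by (metis P\<Phi>' inner_scaleR_right)
  have ae: "inner a e = \<rho>\<^sub>1 * (inner a' (P \<Phi>) + inner a (P \<Phi>')) + \<rho>\<^sub>1 * inner v \<Phi> + inner a (m *\<^sub>R \<theta> + P r)"
    using prim(6) in1[of a] by (simp add: algebra_simps inner_simps)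
  have w': "m *\<^sub>R s' + \<rho>\<^sub>3 *\<^sub>R \<theta>' = - qx" using eqs(4) by simp
  have se: "m * inner s e = \<rho>\<^sub>1 * (inner (m *\<^sub>R s' + \<rho>\<^sub>3 *\<^sub>R \<theta>') (P \<Phi>) + inner w (P \<Phi>'))
      - \<rho>\<^sub>1 * inner q \<Phi> - \<rho>\<^sub>3 * inner \<theta> e + inner w (m *\<^sub>R \<theta> + P r)"
    unfolding w' using prim(5) in1[of w] by (simp add: algebra_simps inner_simps w_def)
  have "inner e e = \<kappa> / m * (m * inner s e) + \<alpha> * inner a e"
    using m by (simp add: e_def inner_simps inner_commute algebra_simps)
  then show "(norm (e\<^sub>c y))\<^sup>2 = g\<^sub>1 y' y + g\<^sub>1 y y' + h\<^sub>1 y d"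
    unfolding power2_norm_eq_inner ae se
    by (simp add: g\<^sub>1_def h\<^sub>1_def e\<^sub>c_def y y' d_def flip: e_def w_def \<theta> r[unfolded d_def y y', simplified] \<theta>[unfolded d_def y y', simplified])
      (simp add: algebra_simps divide_inverse inner_commute)
  have \<psi>'': "\<rho>\<^sub>2 * inner \<Psi>' x = b * inner px x - \<kappa> * inner s x + m * inner \<theta> x" for x
    using arg_cong[OF eqs(3), of "\<lambda>u. inner u x"] by (simp add: inner_simps)
  have \<phi>'': "\<rho>\<^sub>1 * inner \<Phi>' x = \<kappa> * inner sx x - \<beta> * inner z x - m * inner \<theta>x x" for x
    using arg_cong[OF eqs(2), of "\<lambda>u. inner u x"] by (simp add: inner_simps)
  have rz': "\<beta> * inner z x = inner r x - \<alpha> * inner ax x" for x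
    using arg_cong[OF rz, of "\<lambda>u. inner u x"] by (simp add: inner_simps)
  have \<theta>'': "m * inner s' x = - inner qx x - \<rho>\<^sub>3 * inner \<theta>' x" for x
    using arg_cong[OF w', of "\<lambda>u. inner u x"] by (simp add: inner_simps algebra_simps)
  define zx where "zx = s - P p - a"
  have zz: "\<beta> * inner z z = inner z r + \<alpha> * inner zx a"
    using rz'[of z] ibp(9) by (simp add: zx_def inner_commute)
  \<comment> \<open>Pairing the equation for \<Phi> with z leaves the spring energy. By
    \<open>zz\<close> it becomes \<alpha> (zx, a) up to a dissipated term, and this joins \<kappa>
    (s, zx) to form (zx, e).\<close>
  have I4: "\<rho>\<^sub>1 * inner \<Phi> \<Phi> = \<rho>\<^sub>1 * (inner z' \<Phi> + inner z \<Phi>') + \<rho>\<^sub>1 * inner v \<Phi> + inner zx e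
      + inner z r + m * inner z \<theta>x"
  proof -
    have "inner sx z = - inner s zx" using ibp(8) by (simp add: zx_def)
    then show ?thesis
      using \<phi>''[of z] zz by (simp add: eqs(6) e_def inner_simps inner_commute algebra_simps)
  qed
  have I5: "m * inner \<Psi> s' = (inner p' q + inner p q') - inner p q'
      - \<rho>\<^sub>3 * (inner \<Psi>' \<theta> + inner \<Psi> \<theta>')
      + \<rho>\<^sub>3 / \<rho>\<^sub>2 * (- b * inner p \<theta>x - \<kappa> * inner s \<theta> + m * inner \<theta> \<theta>)"
  proof -
    have *: "\<rho>\<^sub>2 * inner \<Psi>' \<theta> = - b * inner p \<theta>x - \<kappa> * inner s \<theta> + m * inner \<theta> \<theta>"
      using \<psi>''[of \<theta>] ibp(1) by (simp add: inner_commute)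
    have "\<rho>\<^sub>3 / \<rho>\<^sub>2 * (- b * inner p \<theta>x - \<kappa> * inner s \<theta> + m * inner \<theta> \<theta>) = \<rho>\<^sub>3 * inner \<Psi>' \<theta>"
      unfolding *[symmetric] using pos by simp
    then show ?thesis using \<theta>''[of \<Psi>] ibp(5) by (simp add: inner_commute algebra_simps)
  qed
  \<comment> \<open>The spring term in the Timoshenko identity is not small by itself. The equations
    for v and \<Psi> convert it into \<alpha> \<kappa> (s, a), which completes \<kappa>^2 |s|^2 to
    \<kappa> (s, e).\<close>
  have I6a: "b * \<beta> * inner p z = b * inner p r + \<alpha> * (\<rho>\<^sub>2 * ((inner \<Psi>' a + inner \<Psi> a')
      + (inner p' v + inner p v') - inner p v') + \<kappa> * inner s a - m * inner a \<theta>)"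
  proof -
    have "b * \<beta> * inner p z = b * inner p r + \<alpha> * (b * inner px a)"
      using arg_cong[OF rz'[of p], of "\<lambda>x. b * x"] ibp(3) by (simp add: inner_commute algebra_simps)
    also have "b * inner px a = \<rho>\<^sub>2 * inner \<Psi>' a + \<kappa> * inner s a - m * inner a \<theta>"
      using \<psi>''[of a] by (simp add: inner_commute)
    finally show ?thesis using ibp(7) by simp
  qed
  have I6b: "b * \<kappa> * inner p sx = b * \<rho>\<^sub>1 * ((inner p' \<Phi> + inner p \<Phi>') + inner \<Psi> s' - inner \<Psi> \<Psi>)
      + b * \<beta> * inner p z + b * m * inner p \<theta>x"
    using arg_cong[OF \<phi>''[of p], of "\<lambda>x. b * x"] ibp(6)
    by (simp add: inner_commute inner_simps algebra_simps)
  have I6c: "\<kappa> * \<rho>\<^sub>2 * inner \<Psi>' s = - b * \<kappa> * inner p sx - \<kappa> * \<kappa> * inner s s + \<kappa> * m * inner s \<theta>"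
    using arg_cong[OF \<psi>''[of s], of "\<lambda>x. \<kappa> * x"] ibp(2) by (simp add: inner_commute algebra_simps)
  \<comment> \<open>Adding \<open>I6b\<close> and \<open>I6c\<close> cancels (p, sx). What is left
    of (\<Psi>, s') has the factor \<open>b * \<rho>\<^sub>1 - \<kappa> * \<rho>\<^sub>2\<close>,
    which vanishes exactly for equal wave speeds; \<open>I5\<close> treats it in every case.\<close>
  have I6: "b * \<rho>\<^sub>1 * inner \<Psi> \<Psi> = \<kappa> * \<rho>\<^sub>2 * (inner \<Psi>' s + inner \<Psi> s') + b * \<rho>\<^sub>1 * (inner p' \<Phi> + inner p \<Phi>')
      + \<alpha> * \<rho>\<^sub>2 * (inner \<Psi>' a + inner \<Psi> a') + \<alpha> * \<rho>\<^sub>2 * (inner p' v + inner p v')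
      + (b * \<rho>\<^sub>1 - \<kappa> * \<rho>\<^sub>2) / m * (m * inner \<Psi> s') + \<kappa> * inner s e + b * inner p r
      - \<alpha> * \<rho>\<^sub>2 * inner p v' - \<alpha> * m * inner a \<theta> + b * m * inner p \<theta>x - \<kappa> * m * inner s \<theta>"
  proof -
    have "(b * \<rho>\<^sub>1 - \<kappa> * \<rho>\<^sub>2) / m * (m * inner \<Psi> s') = b * \<rho>\<^sub>1 * inner \<Psi> s' - \<kappa> * \<rho>\<^sub>2 * inner \<Psi> s'"
      using m by (simp add: field_simps)
    moreover have "\<kappa> * inner s e = \<kappa> * \<kappa> * inner s s + \<alpha> * (\<kappa> * inner s a)"
      by (simp add: e_def inner_simps algebra_simps)
    ultimately show ?thesis using I6a I6b I6c by (simp add: algebra_simps)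
  qed
  have I7: "b * inner p p = \<rho>\<^sub>2 * inner \<Psi> \<Psi> - \<rho>\<^sub>2 * (inner \<Psi>' (P p) + inner \<Psi> (P p'))
      - \<kappa> * inner s (P p) + m * inner (P p) \<theta>"
    using \<psi>''[of "P p"] ibp(4) prim(4) by (simp add: inner_commute algebra_simps)
  \<comment> \<open>Named constants stay atomic, so the concluding step is linear in the products
    that occur.\<close>
  define A k j c\<^sub>0 where "A = 2 * \<rho>\<^sub>2 / (b * \<rho>\<^sub>1)" and "k = (b * \<rho>\<^sub>1 - \<kappa> * \<rho>\<^sub>2) / m"
    and "j = \<rho>\<^sub>3 / \<rho>\<^sub>2" and "c\<^sub>0 = \<alpha> / \<kappa>"
  note cfold = A_def[symmetric] k_def[symmetric] j_def[symmetric] c\<^sub>0_def[symmetric]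
  have A: "A * (b * \<rho>\<^sub>1 * x) = 2 * \<rho>\<^sub>2 * x" for x using pos by (simp add: A_def)
  have ea: "c\<^sub>0 * inner a e = \<alpha> * inner s a + \<alpha> * c\<^sub>0 * inner a a"
    using pos by (simp add: e_def c\<^sub>0_def inner_simps inner_commute field_simps)
  have eP: "inner (P p) e = \<kappa> * inner s (P p) + \<alpha> * inner (P p) a"
    by (simp add: e_def inner_simps inner_commute)
  have zxa: "\<alpha> * inner zx a = \<alpha> * inner s a - \<alpha> * inner (P p) a - \<alpha> * inner a a"
    by (simp add: zx_def inner_simps algebra_simps)
  have d: "d = (v, v', q, q')" by (simp add: d_def y y')
  define G where "G = \<kappa> * \<rho>\<^sub>2 * (inner \<Psi>' s + inner \<Psi> s') + b * \<rho>\<^sub>1 * (inner p' \<Phi> + inner p \<Phi>')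
        + \<alpha> * \<rho>\<^sub>2 * (inner \<Psi>' a + inner \<Psi> a') + \<alpha> * \<rho>\<^sub>2 * (inner p' v + inner p v')
        + k * ((inner p' q + inner p q') - \<rho>\<^sub>3 * (inner \<Psi>' \<theta> + inner \<Psi> \<theta>'))"
  define H where "H = b * inner p r + (- \<alpha> * \<rho>\<^sub>2) * inner p v' + (- \<alpha> * m) * inner a \<theta> + (b * m) * inner p \<theta>x
        + (- \<kappa> * m) * inner s \<theta>
        + k * ((- 1) * inner p q' + j * ((- b) * inner p \<theta>x + (- \<kappa>) * inner s \<theta> + m * inner \<theta> \<theta>))"
  have h: "h\<^sub>2 y d = \<rho>\<^sub>1 * inner v \<Phi> + 2 * inner z r + m * inner z \<theta>x + m * inner (P p) \<theta> + A * H"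
    unfolding h\<^sub>2_def y fst_conv snd_conv r[symmetric] \<theta>x[symmetric] prim(3) cfold H_def
    by (simp add: d inner_commute[of \<Phi> v])
  have g: "g\<^sub>2 y' y + g\<^sub>2 y y' = \<rho>\<^sub>1 * (inner z' \<Phi> + inner z \<Phi>') - \<rho>\<^sub>2 * (inner \<Psi>' (P p) + inner \<Psi> (P p'))
     + A * G"
    unfolding g\<^sub>2_def y y' fst_conv snd_conv cfold G_def by (simp add: algebra_simps)
  have X: "inner (X\<^sub>c y) (e\<^sub>c y) = inner zx e + A * (\<kappa> * inner s e) - inner (P p) e + c\<^sub>0 * inner a e"
    unfolding X\<^sub>c_def e\<^sub>c_def y fst_conv snd_conv zx_def[symmetric] cfold e_def[symmetric]
    by (simp add: inner_add_left inner_diff_left)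
  have "b * \<rho>\<^sub>1 * inner \<Psi> \<Psi> = G + \<kappa> * inner s e + H"
    unfolding I6 I5 cfold G_def H_def by (simp add: right_diff_distrib distrib_left)
  then have "2 * \<rho>\<^sub>2 * inner \<Psi> \<Psi> = A * (G + \<kappa> * inner s e + H)" using A by metis
  then have I6': "2 * (\<rho>\<^sub>2 * inner \<Psi> \<Psi>) = A * G + A * (\<kappa> * inner s e) + A * H"
    by (simp only: distrib_left mult.assoc)
  have aa: "\<alpha> * (c\<^sub>0 + 1) * inner a a = \<alpha> * c\<^sub>0 * inner a a + \<alpha> * inner a a"
    by (simp only: distrib_left distrib_right mult_1_right)
  \<comment> \<open>The terms \<alpha> (P p, a) from \<open>eP\<close> and \<open>zxa\<close>
    cancel, and \<alpha> (s, a) together with the square of a is absorbed by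
    \<open>ea\<close>.\<close>
  have "\<rho>\<^sub>1 * inner \<Phi> \<Phi> + \<rho>\<^sub>2 * inner \<Psi> \<Psi> + b * inner p p + \<beta> * inner z z + \<alpha> * (c\<^sub>0 + 1) * inner a a
      = g\<^sub>2 y' y + g\<^sub>2 y y' + inner (X\<^sub>c y) (e\<^sub>c y) + h\<^sub>2 y d"
    unfolding g h X aa using I4 I6' I7 zz ea eP zxa by linarith
  then show "elastic y = g\<^sub>2 y' y + g\<^sub>2 y y' + inner (X\<^sub>c y) (e\<^sub>c y) + h\<^sub>2 y d"
    by (simp add: elastic_def y power2_norm_eq_inner c\<^sub>0_def)
qed

section \<open>From the identities to the multiplier inequality\<close>

lemma en_coercive: "\<exists>e\<^sub>0>0. \<forall>y. e\<^sub>0 * (norm y)\<^sup>2 \<le> en y y"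
proof -
  define e\<^sub>0 where "e\<^sub>0 = Min {\<rho>, \<alpha>, \<rho>\<^sub>1, \<rho>\<^sub>2, b, \<beta>, \<kappa>, \<rho>\<^sub>3, \<tau>}"
  have le: "e\<^sub>0 \<le> \<rho>" "e\<^sub>0 \<le> \<alpha>" "e\<^sub>0 \<le> \<rho>\<^sub>1" "e\<^sub>0 \<le> \<rho>\<^sub>2" "e\<^sub>0 \<le> b" "e\<^sub>0 \<le> \<beta>" "e\<^sub>0 \<le> \<kappa>" "e\<^sub>0 \<le> \<rho>\<^sub>3" "e\<^sub>0 \<le> \<tau>"
    unfolding e\<^sub>0_def by (rule Min_le; simp)+
  have "e\<^sub>0 * (norm y)\<^sup>2 \<le> en y y" for y
    unfolding norm_vec9[of y] unfolding en_def distrib_left power2_norm_eq_inner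
    by (intro add_mono mult_right_mono le inner_ge_zero)
  moreover have "e\<^sub>0 > 0" unfolding e\<^sub>0_def using pos by (subst Min_gr_iff) auto
  ultimately show ?thesis by blast
qed

lemma dissipation_le:
  assumes "config y y'"
  shows "en y' y \<le> - min \<gamma> \<sigma> * (norm (v\<^sub>c y, q\<^sub>c y))\<^sup>2"
proof -
  have "min \<gamma> \<sigma> * (norm (v\<^sub>c y))\<^sup>2 \<le> \<gamma> * (norm (v\<^sub>c y))\<^sup>2" "min \<gamma> \<sigma> * (norm (q\<^sub>c y))\<^sup>2 \<le> \<sigma> * (norm (q\<^sub>c y))\<^sup>2"
    by (intro mult_right_mono; simp)+
  then show ?thesis unfolding dissipation[OF assms] by (simp add: norm_Pair_power2 distrib_left)
qed

text \<open>Components missing from \<open>elastic\<close> are recovered: s from \<kappa> s = e -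
  \<alpha> a, \<theta> as the primitive of a combination of q and q', while v and q belong to the
  dissipated quadruple.\<close>

lemma norm_le_elastic:
  "\<exists>C>0. \<forall>y y'. config y y' \<longrightarrow> (norm y)\<^sup>2 \<le> C * (elastic y + (norm (e\<^sub>c y))\<^sup>2 + (norm (v\<^sub>c y, v\<^sub>c y', q\<^sub>c y, q\<^sub>c y'))\<^sup>2)"
proof -
  obtain B where B: "\<And>x. norm (P x) \<le> norm x * B" "B > 0" using bounded_linear.pos_bounded[OF P] by blast
  define T where "T = (\<sigma> + \<tau>) * B"
  define \<mu> where "\<mu> = Min {\<rho>\<^sub>1, \<rho>\<^sub>2, b, \<beta>, \<alpha> * (\<alpha> / \<kappa> + 1)}"
  have \<mu>: "\<mu> > 0" using pos by (simp add: \<mu>_def add_pos_pos)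
  have le: "\<mu> \<le> \<rho>\<^sub>1" "\<mu> \<le> \<rho>\<^sub>2" "\<mu> \<le> b" "\<mu> \<le> \<beta>" "\<mu> \<le> \<alpha> * (\<alpha> / \<kappa> + 1)" by (simp_all add: \<mu>_def)
  define k where "k = 2 * \<alpha>\<^sup>2 / \<kappa>\<^sup>2"
  define C where "C = (1 + k) / \<mu> + 2 / \<kappa>\<^sup>2 + (1 + T\<^sup>2)"
  have k: "k \<ge> 0" by (simp add: k_def)
  have main: "(norm y)\<^sup>2 \<le> C * (elastic y + (norm (e\<^sub>c y))\<^sup>2 + (norm (v\<^sub>c y, v\<^sub>c y', q\<^sub>c y, q\<^sub>c y'))\<^sup>2)"
    (is "_ \<le> C * (?S + _ + (norm ?d)\<^sup>2)") if conf: "config y y'" for y y'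
  proof -
    let ?n = "(norm (\<Phi>\<^sub>c y))\<^sup>2 + (norm (\<Psi>\<^sub>c y))\<^sup>2 + (norm (p\<^sub>c y))\<^sup>2 + (norm (z\<^sub>c y))\<^sup>2 + (norm (a\<^sub>c y))\<^sup>2"
    have "\<mu> * ?n = \<mu> * (norm (\<Phi>\<^sub>c y))\<^sup>2 + \<mu> * (norm (\<Psi>\<^sub>c y))\<^sup>2 + \<mu> * (norm (p\<^sub>c y))\<^sup>2
        + \<mu> * (norm (z\<^sub>c y))\<^sup>2 + \<mu> * (norm (a\<^sub>c y))\<^sup>2" by (simp only: distrib_left)
    also have "\<dots> \<le> ?S" unfolding elastic_def by (intro add_mono mult_right_mono le zero_le_power2)
    finally have "\<mu> * ?n \<le> ?S" .
    then have S: "?n \<le> ?S / \<mu>" using \<mu> by (simp add: field_simps)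
    have d2: "(norm ?d)\<^sup>2 = (norm (v\<^sub>c y))\<^sup>2 + ((norm (v\<^sub>c y'))\<^sup>2 + ((norm (q\<^sub>c y))\<^sup>2 + (norm (q\<^sub>c y'))\<^sup>2))"
      by (simp add: norm_Pair_power2)
    have vq: "(norm (v\<^sub>c y))\<^sup>2 + (norm (q\<^sub>c y))\<^sup>2 \<le> (norm ?d)\<^sup>2" unfolding d2 by simp
    have "norm (q\<^sub>c y) \<le> norm ?d" "norm (q\<^sub>c y') \<le> norm ?d"
      by (rule power2_le_imp_le; simp add: d2)+
    then have "norm (t\<^sub>d ?d) \<le> \<sigma> * norm ?d + \<tau> * norm ?d"
      unfolding t\<^sub>d_def using pos
      by (intro order_trans[OF norm_triangle_ineq4] add_mono) (auto intro: mult_left_mono)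
    then have "norm (\<theta>\<^sub>c y) \<le> T * norm ?d"
      using B(1)[of "t\<^sub>d ?d"] mult_right_mono[of "norm (t\<^sub>d ?d)" "(\<sigma> + \<tau>) * norm ?d" B] B(2)
      unfolding elastic_identities(3)[OF conf] T_def by (simp add: algebra_simps)
    then have \<theta>: "(norm (\<theta>\<^sub>c y))\<^sup>2 \<le> T\<^sup>2 * (norm ?d)\<^sup>2"
      unfolding power_mult_distrib[symmetric] by (intro power_mono) auto
    have "\<kappa> *\<^sub>R s\<^sub>c y = e\<^sub>c y - \<alpha> *\<^sub>R a\<^sub>c y" by (simp add: e\<^sub>c_def)
    then have "norm (\<kappa> *\<^sub>R s\<^sub>c y) \<le> norm (e\<^sub>c y) + norm (\<alpha> *\<^sub>R a\<^sub>c y)" by (metis norm_triangle_ineq4)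
    then have "\<kappa> * norm (s\<^sub>c y) \<le> norm (e\<^sub>c y) + \<alpha> * norm (a\<^sub>c y)" using pos by simp
    then have "(\<kappa> * norm (s\<^sub>c y))\<^sup>2 \<le> (norm (e\<^sub>c y) + \<alpha> * norm (a\<^sub>c y))\<^sup>2"
      using pos by (intro power_mono) auto
    also have "\<dots> \<le> 2 * (norm (e\<^sub>c y))\<^sup>2 + 2 * (\<alpha> * norm (a\<^sub>c y))\<^sup>2"
      using sum_squares_bound[of "norm (e\<^sub>c y)" "\<alpha> * norm (a\<^sub>c y)"] unfolding power2_sum by simp
    finally have "(norm (s\<^sub>c y))\<^sup>2 \<le> 2 / \<kappa>\<^sup>2 * (norm (e\<^sub>c y))\<^sup>2 + k * (norm (a\<^sub>c y))\<^sup>2"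
      using pos by (simp add: k_def power_mult_distrib field_simps)
    moreover have "k * (norm (a\<^sub>c y))\<^sup>2 \<le> k * ?n" using k by (intro mult_left_mono) auto
    moreover have "(1 + k) * ?n = ?n + k * ?n" by (simp only: distrib_right mult_1)
    ultimately have "(norm y)\<^sup>2 \<le> (1 + k) * ?n + 2 / \<kappa>\<^sup>2 * (norm (e\<^sub>c y))\<^sup>2 + (1 + T\<^sup>2) * (norm ?d)\<^sup>2"
      using vq \<theta> norm_vec9[of y] distrib_right[of 1 "T\<^sup>2" "(norm ?d)\<^sup>2"] by linarith
    also have "(1 + k) * ?n \<le> (1 + k) * (?S / \<mu>)" using S k by (intro mult_left_mono) auto
    also have "(1 + k) * (?S / \<mu>) = (1 + k) / \<mu> * ?S" by simp
    finally have "(norm y)\<^sup>2 \<le> (1 + k) / \<mu> * ?S + 2 / \<kappa>\<^sup>2 * (norm (e\<^sub>c y))\<^sup>2 + (1 + T\<^sup>2) * (norm ?d)\<^sup>2" by simp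
    also have "\<dots> \<le> C * ?S + C * (norm (e\<^sub>c y))\<^sup>2 + C * (norm ?d)\<^sup>2"
    proof -
      have "0 \<le> ?S" unfolding elastic_def using pos by (intro add_nonneg_nonneg mult_nonneg_nonneg) auto
      moreover have "(1 + k) / \<mu> \<le> C" "2 / \<kappa>\<^sup>2 \<le> C" "1 + T\<^sup>2 \<le> C" using k \<mu> by (simp_all add: C_def)
      ultimately show ?thesis by (intro add_mono mult_right_mono) auto
    qed
    finally show ?thesis by (simp only: distrib_left)
  qed
  show ?thesis
  proof (intro exI conjI allI impI)
    show "C > 0" using k \<mu> by (simp add: C_def add_nonneg_pos add_pos_nonneg)
  qed (rule main)
qed

text \<open>Young's inequality is applied to three products with N, each costing a quarter of the
  square of N. In \<open>K\<close> the part C^2 X^2 pays for the product of N with \<epsilon>, and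
  the part C for the square of \<epsilon> in the first premise.\<close>

lemma absorb_errors:
  fixes N :: real
  assumes "N\<^sup>2 \<le> C * (S + \<epsilon>\<^sup>2 + D\<^sup>2)" "S \<le> G2 + X * N * \<epsilon> + M2 * N * D" "\<epsilon>\<^sup>2 \<le> G1 + M1 * N * D" "C > 0"
  defines "K \<equiv> C\<^sup>2 * X\<^sup>2 + C"
  shows "N\<^sup>2 / 4 \<le> C * G2 + K * G1 + (C\<^sup>2 * M2\<^sup>2 + C + K\<^sup>2 * M1\<^sup>2) * D\<^sup>2"
proof -
  have young: "x * y \<le> x\<^sup>2 / 4 + y\<^sup>2" for x y :: real
    using zero_le_power2[of "x / 2 - y"] by (simp add: power2_diff power_divide)
  have "C * S \<le> C * G2 + N * (C * X * \<epsilon>) + N * (C * M2 * D)"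
    using mult_left_mono[OF assms(2), of C] assms(4) by (simp add: algebra_simps)
  moreover have "K * \<epsilon>\<^sup>2 \<le> K * G1 + N * (K * M1 * D)"
    using mult_left_mono[OF assms(3), of K] assms(4) by (simp add: K_def algebra_simps)
  moreover have "K * \<epsilon>\<^sup>2 = (C * X * \<epsilon>)\<^sup>2 + C * \<epsilon>\<^sup>2"
    by (simp add: K_def power_mult_distrib algebra_simps)
  moreover have "(C\<^sup>2 * M2\<^sup>2 + C + K\<^sup>2 * M1\<^sup>2) * D\<^sup>2 = (C * M2 * D)\<^sup>2 + C * D\<^sup>2 + (K * M1 * D)\<^sup>2"
    by (simp add: power_mult_distrib algebra_simps)
  moreover have "N\<^sup>2 \<le> C * S + C * \<epsilon>\<^sup>2 + C * D\<^sup>2" using assms(1) by (simp add: algebra_simps)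
  ultimately show ?thesis
    using young[of N "C * X * \<epsilon>"] young[of N "C * M2 * D"] young[of N "K * M1 * D"] by linarith
qed

text \<open>The identity for \<open>elastic\<close> contains products with e that only the identity
  for e can pay for, so \<open>g\<close> combines the two forms with the weights from
  \<open>absorb_errors\<close>.\<close>

lemma multiplier_estimate:
  "\<exists>g c C. bounded_bilinear g \<and> c > 0 \<and> C > 0 \<and> (\<forall>y y'. config y y' \<longrightarrow>
     c * (norm y)\<^sup>2 \<le> g y' y + g y y' + C * ((norm (v\<^sub>c y, q\<^sub>c y))\<^sup>2 + (norm (v\<^sub>c y', q\<^sub>c y'))\<^sup>2))"
proof -
  obtain M1 where M1: "\<And>x y. norm (h\<^sub>1 x y) \<le> norm x * norm y * M1"
    using bounded_bilinear.bounded[OF bounded_bilinear_forms(4)] by blast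
  obtain M2 where M2: "\<And>x y. norm (h\<^sub>2 x y) \<le> norm x * norm y * M2"
    using bounded_bilinear.bounded[OF bounded_bilinear_forms(5)] by blast
  obtain X where X: "\<And>x. norm (X\<^sub>c x) \<le> norm x * X"
    using bounded_linear.bounded[OF bounded_bilinear_forms(6)] by blast
  obtain C where C: "C > 0" and norm_le: "\<And>y y'. config y y' \<Longrightarrow> (norm y)\<^sup>2 \<le> C * (elastic y + (norm (e\<^sub>c y))\<^sup>2 + (norm (v\<^sub>c y, v\<^sub>c y', q\<^sub>c y, q\<^sub>c y'))\<^sup>2)"
    using norm_le_elastic by blast
  define K where "K = C\<^sup>2 * X\<^sup>2 + C"
  define K' where "K' = C\<^sup>2 * M2\<^sup>2 + C + K\<^sup>2 * M1\<^sup>2"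
  have main: "(1 / 4) * (norm y)\<^sup>2 \<le> (C * g\<^sub>2 y' y + K * g\<^sub>1 y' y) + (C * g\<^sub>2 y y' + K * g\<^sub>1 y y')
      + K' * ((norm (v\<^sub>c y, q\<^sub>c y))\<^sup>2 + (norm (v\<^sub>c y', q\<^sub>c y'))\<^sup>2)" if conf: "config y y'" for y y'
  proof -
    let ?d = "(v\<^sub>c y, v\<^sub>c y', q\<^sub>c y, q\<^sub>c y')"
    have "inner (X\<^sub>c y) (e\<^sub>c y) \<le> norm (X\<^sub>c y) * norm (e\<^sub>c y)" by (rule norm_cauchy_schwarz)
    also have "\<dots> \<le> X * norm y * norm (e\<^sub>c y)" using X[of y] by (intro mult_right_mono) (auto simp: mult.commute)
    finally have "inner (X\<^sub>c y) (e\<^sub>c y) \<le> X * norm y * norm (e\<^sub>c y)" .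
    moreover have "h\<^sub>2 y ?d \<le> M2 * norm y * norm ?d" "h\<^sub>1 y ?d \<le> M1 * norm y * norm ?d"
      using M2[of y ?d] M1[of y ?d] by (simp_all add: ac_simps)
    ultimately have "(norm y)\<^sup>2 / 4 \<le> C * (g\<^sub>2 y' y + g\<^sub>2 y y') + K * (g\<^sub>1 y' y + g\<^sub>1 y y') + K' * (norm ?d)\<^sup>2"
      unfolding K_def K'_def
      using elastic_identities(1,2)[OF conf] norm_le[OF conf] C
      by (intro absorb_errors[where \<epsilon> = "norm (e\<^sub>c y)"]) auto
    moreover have "(norm ?d)\<^sup>2 = (norm (v\<^sub>c y, q\<^sub>c y))\<^sup>2 + (norm (v\<^sub>c y', q\<^sub>c y'))\<^sup>2"
      by (simp add: norm_Pair_power2)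
    ultimately show ?thesis by (simp add: algebra_simps)
  qed
  show ?thesis
  proof (intro exI conjI allI impI)
    show "bounded_bilinear (\<lambda>x y. C * g\<^sub>2 x y + K * g\<^sub>1 x y)"
      by (intro bounded_bilinear_rules bounded_bilinear_forms)
    show "(1/4::real) > 0" by simp
    show "K' > 0" using C by (simp add: K'_def add_nonneg_pos add_pos_nonneg)
  qed (rule main)
qed

end

section \<open>The space of square integrable functions\<close>

definition square_integrable :: "(real \<Rightarrow> complex) set" where
  "square_integrable = {f \<in> borel_measurable lebesgue. integrable lebesgue (\<lambda>x. (cmod (f x))\<^sup>2)}"

lemma square_integrable_zero: "(\<lambda>x. 0) \<in> square_integrable"
  by (simp add: square_integrable_def)

lemma square_integrable_add:
  assumes "f \<in> square_integrable" "g \<in> square_integrable"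
  shows "(\<lambda>x. f x + g x) \<in> square_integrable"
proof -
  have m: "f \<in> borel_measurable lebesgue" "g \<in> borel_measurable lebesgue"
    using assms by (auto simp: square_integrable_def)
  have "integrable lebesgue (\<lambda>x. 2 * (cmod (f x))\<^sup>2 + 2 * (cmod (g x))\<^sup>2)"
    using assms by (auto simp: square_integrable_def)
  then have "integrable lebesgue (\<lambda>x. (cmod (f x + g x))\<^sup>2)"
  proof (rule Bochner_Integration.integrable_bound)
    show "AE x in lebesgue. norm ((cmod (f x + g x))\<^sup>2) \<le> norm (2 * (cmod (f x))\<^sup>2 + 2 * (cmod (g x))\<^sup>2)"
    proof (intro AE_I2)
      fix x
      have "(cmod (f x + g x))\<^sup>2 \<le> (cmod (f x) + cmod (g x))\<^sup>2"
        by (intro power_mono norm_triangle_ineq) auto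
      also have "\<dots> \<le> 2 * (cmod (f x))\<^sup>2 + 2 * (cmod (g x))\<^sup>2"
        using sum_squares_bound[of "cmod (f x)" "cmod (g x)"] by (simp add: power2_sum)
      finally show "norm ((cmod (f x + g x))\<^sup>2) \<le> norm (2 * (cmod (f x))\<^sup>2 + 2 * (cmod (g x))\<^sup>2)" by simp
    qed
  qed (use m in measurable)
  then show ?thesis using m by (auto simp: square_integrable_def)
qed

lemma square_integrable_cmult: "f \<in> square_integrable \<Longrightarrow> (\<lambda>x. c * f x) \<in> square_integrable"
  by (auto simp: square_integrable_def norm_mult power_mult_distrib)

lemma square_integrable_uminus: "f \<in> square_integrable \<Longrightarrow> (\<lambda>x. - f x) \<in> square_integrable"
  using square_integrable_cmult[of f "-1"] by simp

lemma square_integrable_diff: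
  "\<lbrakk>f \<in> square_integrable; g \<in> square_integrable\<rbrakk> \<Longrightarrow> (\<lambda>x. f x - g x) \<in> square_integrable"
  using square_integrable_add[OF _ square_integrable_uminus[of g], of f] by simp

lemma square_integrable_mult:
  assumes "f \<in> square_integrable" "g \<in> square_integrable"
  shows "integrable lebesgue (\<lambda>x. f x * cnj (g x))"
proof -
  have m[measurable]: "f \<in> borel_measurable lebesgue" "g \<in> borel_measurable lebesgue"
    using assms by (auto simp: square_integrable_def)
  have [measurable]: "(\<lambda>x. cnj (g x)) \<in> borel_measurable lebesgue"
    by (rule borel_measurable_continuous_on[OF _ m(2)]) (intro continuous_intros)
  have "integrable lebesgue (\<lambda>x. (cmod (f x))\<^sup>2 + (cmod (g x))\<^sup>2)"
    using assms by (auto simp: square_integrable_def)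
  then show ?thesis
  proof (rule Bochner_Integration.integrable_bound)
    show "AE x in lebesgue. norm (f x * cnj (g x)) \<le> norm ((cmod (f x))\<^sup>2 + (cmod (g x))\<^sup>2)"
    proof (intro AE_I2)
      fix x
      have "2 * (cmod (f x) * cmod (g x)) \<le> (cmod (f x))\<^sup>2 + (cmod (g x))\<^sup>2"
        using sum_squares_bound[of "cmod (f x)" "cmod (g x)"] by simp
      moreover have "0 \<le> cmod (f x) * cmod (g x)" by simp
      ultimately have "cmod (f x) * cmod (g x) \<le> (cmod (f x))\<^sup>2 + (cmod (g x))\<^sup>2" by linarith
      then show "norm (f x * cnj (g x)) \<le> norm ((cmod (f x))\<^sup>2 + (cmod (g x))\<^sup>2)"
        by (simp add: norm_mult)
    qed
  qed measurable
qed

definition l2rel :: "(real \<Rightarrow> complex) \<Rightarrow> (real \<Rightarrow> complex) \<Rightarrow> bool" where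
  "l2rel f g \<longleftrightarrow> f \<in> square_integrable \<and> g \<in> square_integrable \<and> (AE x in lebesgue. f x = g x)"

\<comment> \<open>Functions on the whole line are used, with (0,L) entering through extension by
  zero, so that one type serves every L.\<close>
quotient_type l2 = "real \<Rightarrow> complex" / partial: l2rel
proof (rule part_equivpI)
  show "\<exists>f. l2rel f f" using square_integrable_zero by (auto simp: l2rel_def)
  show "symp l2rel" by (auto simp: symp_def l2rel_def elim: AE_mp)
  show "transp l2rel" unfolding transp_def l2rel_def
  proof (intro allI impI conjI; elim conjE)
    fix f g h :: "real \<Rightarrow> complex" assume "AE x in lebesgue. f x = g x" "AE x in lebesgue. g x = h x"
    then show "AE x in lebesgue. f x = h x" by eventually_elim simp
  qed auto
qed

lemma l2rel_self: "l2rel f f \<longleftrightarrow> f \<in> square_integrable"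
  by (simp add: l2rel_def)

lemma integral_mult_cnj_self:
  "(LINT x|M. f x * cnj (f x)) = of_real (LINT x|M. (cmod (f x))\<^sup>2)"
  unfolding integral_complex_of_real[symmetric]
  by (rule Bochner_Integration.integral_cong[OF refl]) (rule complex_norm_square[symmetric])

instantiation l2 :: real_inner
begin

lift_definition zero_l2 :: l2 is "\<lambda>x. 0"
  by (simp add: l2rel_self square_integrable_zero)

lift_definition plus_l2 :: "l2 \<Rightarrow> l2 \<Rightarrow> l2" is "\<lambda>f g x. f x + g x"
  unfolding l2rel_def
proof (intro conjI; elim conjE)
  fix f g f' g' :: "real \<Rightarrow> complex"
  assume "AE x in lebesgue. f x = g x" "AE x in lebesgue. f' x = g' x"
  then show "AE x in lebesgue. f x + f' x = g x + g' x" by eventually_elim simp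
qed (auto intro: square_integrable_add)

lift_definition minus_l2 :: "l2 \<Rightarrow> l2 \<Rightarrow> l2" is "\<lambda>f g x. f x - g x"
  unfolding l2rel_def
proof (intro conjI; elim conjE)
  fix f g f' g' :: "real \<Rightarrow> complex"
  assume "AE x in lebesgue. f x = g x" "AE x in lebesgue. f' x = g' x"
  then show "AE x in lebesgue. f x - f' x = g x - g' x" by eventually_elim simp
qed (auto intro: square_integrable_diff)

lift_definition uminus_l2 :: "l2 \<Rightarrow> l2" is "\<lambda>f x. - f x"
  by (auto simp: l2rel_def intro: square_integrable_uminus)

lift_definition scaleR_l2 :: "real \<Rightarrow> l2 \<Rightarrow> l2" is "\<lambda>r f x. of_real r * f x"
  by (auto simp: l2rel_def intro: square_integrable_cmult)

text \<open>The real part of the complex inner product induces the same norm and turns the space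
  into a real one, as the abstract part requires.\<close>

lift_definition inner_l2 :: "l2 \<Rightarrow> l2 \<Rightarrow> real" is "\<lambda>f g. Re (LINT x|lebesgue. f x * cnj (g x))"
  unfolding l2rel_def
proof (elim conjE, rule arg_cong[of _ _ Re])
  fix f g f' g' :: "real \<Rightarrow> complex"
  assume si: "f \<in> square_integrable" "g \<in> square_integrable" "f' \<in> square_integrable" "g' \<in> square_integrable"
  assume "AE x in lebesgue. f x = g x" "AE x in lebesgue. f' x = g' x"
  then have "AE x in lebesgue. f x * cnj (f' x) = g x * cnj (g' x)" by eventually_elim simp
  then show "(LINT x|lebesgue. f x * cnj (f' x)) = (LINT x|lebesgue. g x * cnj (g' x))"
    using si by (intro integral_cong_AE borel_measurable_integrable square_integrable_mult)
qed

definition norm_l2 :: "l2 \<Rightarrow> real" where "norm_l2 x = sqrt (inner x x)"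
definition sgn_l2 :: "l2 \<Rightarrow> l2" where "sgn_l2 x = scaleR (inverse (norm x)) x"
definition dist_l2 :: "l2 \<Rightarrow> l2 \<Rightarrow> real" where "dist_l2 x y = norm (x - y)"
definition uniformity_l2 :: "(l2 \<times> l2) filter" where
  "uniformity_l2 = (INF e\<in>{0 <..}. principal {(x, y). dist x y < e})"
definition open_l2 :: "l2 set \<Rightarrow> bool" where
  "open_l2 U \<longleftrightarrow> (\<forall>x\<in>U. eventually (\<lambda>(x', y). x' = x \<longrightarrow> y \<in> U) uniformity)"

lemma integrable_cmod_sq: "f \<in> square_integrable \<Longrightarrow> integrable lebesgue (\<lambda>x. (cmod (f x))\<^sup>2)"
  by (simp add: square_integrable_def)

instance
proof
  fix x y z :: l2 and r s :: real
  show "dist x y = norm (x - y)" by (simp add: dist_l2_def)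
  show "sgn x = scaleR (inverse (norm x)) x" by (simp add: sgn_l2_def)
  show "uniformity = (INF e\<in>{0 <..}. principal {(x, y). dist x (y::l2) < e})" by (simp add: uniformity_l2_def)
  show "open U \<longleftrightarrow> (\<forall>x\<in>U. eventually (\<lambda>(x', y). x' = x \<longrightarrow> y \<in> U) uniformity)" for U :: "l2 set"
    by (simp add: open_l2_def)
  show "norm x = sqrt (inner x x)" by (simp add: norm_l2_def)
  show "x + y + z = x + (y + z)" by transfer (auto simp: l2rel_def add.assoc intro!: square_integrable_add)
  show "x + y = y + x" by transfer (auto simp: l2rel_def add.commute intro!: square_integrable_add)
  show "0 + x = x" by transfer (auto simp: l2rel_def)
  show "- x + x = 0" by transfer (auto simp: l2rel_def square_integrable_zero)
  show "x - y = x + - y" by transfer (auto simp: l2rel_def intro!: square_integrable_diff)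
  show "r *\<^sub>R (x + y) = r *\<^sub>R x + r *\<^sub>R y"
    by transfer (auto simp: l2rel_def distrib_left intro!: square_integrable_add square_integrable_cmult)
  show "(r + s) *\<^sub>R x = r *\<^sub>R x + s *\<^sub>R x"
    by transfer (auto simp: l2rel_def distrib_right intro!: square_integrable_add square_integrable_cmult)
  show "r *\<^sub>R s *\<^sub>R x = (r * s) *\<^sub>R x"
    by transfer (auto simp: l2rel_def mult.assoc intro!: square_integrable_cmult)
  show "1 *\<^sub>R x = x" by transfer (auto simp: l2rel_def)
  show "inner x y = inner y x"
  proof transfer
    fix f g :: "real \<Rightarrow> complex"
    have "(LINT x|lebesgue. f x * cnj (g x)) = (LINT x|lebesgue. cnj (g x * cnj (f x)))" by (simp add: mult.commute)
    also have "\<dots> = cnj (LINT x|lebesgue. g x * cnj (f x))" by (rule Bochner_Integration.integral_cnj)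
    finally show "Re (LINT x|lebesgue. f x * cnj (g x)) = Re (LINT x|lebesgue. g x * cnj (f x))" by simp
  qed
  show "inner (x + y) z = inner x z + inner y z"
    by transfer (simp add: l2rel_self distrib_right square_integrable_mult)
  show "inner (r *\<^sub>R x) y = r * inner x y"
    by transfer (simp add: l2rel_self mult.assoc square_integrable_mult)
  show "0 \<le> inner x x"
    by transfer (simp add: integral_mult_cnj_self)
  show "inner x x = 0 \<longleftrightarrow> x = 0"
  proof transfer
    fix f :: "real \<Rightarrow> complex" assume "l2rel f f"
    then have f: "f \<in> square_integrable" by (simp add: l2rel_self)
    have "Re (LINT x|lebesgue. f x * cnj (f x)) = 0 \<longleftrightarrow> (AE x in lebesgue. (cmod (f x))\<^sup>2 = 0)"
      unfolding integral_mult_cnj_self using integral_nonneg_eq_0_iff_AE[OF integrable_cmod_sq[OF f]] by simp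
    then show "Re (LINT x|lebesgue. f x * cnj (f x)) = 0 \<longleftrightarrow> l2rel f (\<lambda>x. 0)"
      using f by (simp add: l2rel_def square_integrable_zero)
  qed
qed

end

section \<open>Functions on (0,L) as classes\<close>

definition ext :: "real \<Rightarrow> (real \<Rightarrow> complex) \<Rightarrow> real \<Rightarrow> complex" where
  "ext L f = (\<lambda>x. if x \<in> {0<..<L} then f x else 0)"

definition cls :: "real \<Rightarrow> (real \<Rightarrow> complex) \<Rightarrow> l2" where
  "cls L f = abs_l2 (ext L f)"

lemma ext_square_integrable: "f \<in> L2 L \<Longrightarrow> ext L f \<in> square_integrable"
proof -
  assume f: "f \<in> L2 L"
  have "ext L f \<in> borel_measurable lebesgue"
    unfolding ext_def using f by (intro borel_measurable_if_I) (auto simp: L2_def)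
  moreover have "integrable lebesgue (\<lambda>x. indicator {0<..<L} x *\<^sub>R (cmod (f x))\<^sup>2)"
    using f by (simp add: L2_def integrable_restrict_space)
  then have "integrable lebesgue (\<lambda>x. (cmod (ext L f x))\<^sup>2)"
    by (rule Bochner_Integration.integrable_cong[THEN iffD1, rotated -1]) (auto simp: ext_def)
  ultimately show ?thesis by (simp add: square_integrable_def)
qed

lemma inner_cls:
  assumes "f \<in> L2 L" "g \<in> L2 L"
  shows "inner (cls L f) (cls L g) = Re (LINT x|lebesgue_on {0<..<L}. f x * cnj (g x))"
proof -
  have "inner (cls L f) (cls L g) = Re (LINT x|lebesgue. ext L f x * cnj (ext L g x))"
    unfolding cls_def using assms
    by (subst inner_l2.abs_eq) (auto simp: l2rel_self ext_square_integrable)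
  also have "(LINT x|lebesgue. ext L f x * cnj (ext L g x))
      = (LINT x|lebesgue. indicator {0<..<L} x *\<^sub>R (f x * cnj (g x)))"
    by (intro Bochner_Integration.integral_cong) (auto simp: ext_def)
  also have "\<dots> = (LINT x|lebesgue_on {0<..<L}. f x * cnj (g x))"
    by (subst integral_restrict_space) auto
  finally show ?thesis .
qed

lemma norm_cls: "f \<in> L2 L \<Longrightarrow> norm (cls L f) = L2_norm L f"
  unfolding norm_eq_sqrt_inner[of "cls L f"] by (simp only: inner_cls L2_norm_def integral_mult_cnj_self Re_complex_of_real)

lemma L2_measurable: "f \<in> L2 L \<Longrightarrow> f \<in> borel_measurable (lebesgue_on {0<..<L})"
  by (simp add: L2_def)

lemma L2_add: "f \<in> L2 L \<Longrightarrow> g \<in> L2 L \<Longrightarrow> (\<lambda>x. f x + g x) \<in> L2 L"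
proof -
  assume fg: "f \<in> L2 L" "g \<in> L2 L"
  have "integrable lebesgue (\<lambda>x. (cmod (ext L f x + ext L g x))\<^sup>2)"
    using square_integrable_add[OF ext_square_integrable[OF fg(1)] ext_square_integrable[OF fg(2)]]
    by (simp add: square_integrable_def)
  then have "integrable lebesgue (\<lambda>x. indicator {0<..<L} x *\<^sub>R (cmod (f x + g x))\<^sup>2)"
    by (rule Bochner_Integration.integrable_cong[THEN iffD1, rotated -1]) (auto simp: ext_def)
  then have "integrable (lebesgue_on {0<..<L}) (\<lambda>x. (cmod (f x + g x))\<^sup>2)"
    by (simp add: integrable_restrict_space)
  moreover have "(\<lambda>x. f x + g x) \<in> borel_measurable (lebesgue_on {0<..<L})"
    using fg by (intro borel_measurable_add L2_measurable)
  ultimately show ?thesis by (simp add: L2_def)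
qed

lemma L2_cmult: "f \<in> L2 L \<Longrightarrow> (\<lambda>x. c * f x) \<in> L2 L"
  by (auto simp: L2_def norm_mult power_mult_distrib)

lemma L2_diff: "f \<in> L2 L \<Longrightarrow> g \<in> L2 L \<Longrightarrow> (\<lambda>x. f x - g x) \<in> L2 L"
  using L2_add[of f L "\<lambda>x. - 1 * g x"] L2_cmult[of g L "-1"] by simp

lemma cls_cong: 
  assumes "f \<in> L2 L" "g \<in> L2 L" "AE x in lebesgue_on {0<..<L}. f x = g x" shows "cls L f = cls L g"
proof -
  have "AE x in lebesgue. ext L f x = ext L g x"
    using assms(3) by (subst (asm) AE_restrict_space_iff) (auto simp: ext_def elim: AE_mp)
  then show ?thesis unfolding cls_def using assms
    by (intro Quotient3_rel_abs[OF Quotient3_l2]) (simp add: l2rel_def ext_square_integrable)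
qed

lemma ext_simps:
  "ext L (\<lambda>x. f x + g x) = (\<lambda>x. ext L f x + ext L g x)"
  "ext L (\<lambda>x. f x - g x) = (\<lambda>x. ext L f x - ext L g x)"
  "ext L (\<lambda>x. c * f x) = (\<lambda>x. c * ext L f x)"
  by (auto simp: ext_def)

lemma cls_add: "\<lbrakk>f \<in> L2 L; g \<in> L2 L\<rbrakk> \<Longrightarrow> cls L (\<lambda>x. f x + g x) = cls L f + cls L g"
  by (simp add: cls_def ext_simps plus_l2.abs_eq l2rel_self ext_square_integrable)

lemma cls_diff: "\<lbrakk>f \<in> L2 L; g \<in> L2 L\<rbrakk> \<Longrightarrow> cls L (\<lambda>x. f x - g x) = cls L f - cls L g"
  by (simp add: cls_def ext_simps minus_l2.abs_eq l2rel_self ext_square_integrable)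

lemma cls_scaleR: "f \<in> L2 L \<Longrightarrow> cls L (\<lambda>x. of_real r * f x) = r *\<^sub>R cls L f"
  by (simp add: cls_def ext_simps scaleR_l2.abs_eq l2rel_self ext_square_integrable)

section \<open>Integration from 0 as a bounded operator\<close>

definition prim_fun :: "real \<Rightarrow> (real \<Rightarrow> complex) \<Rightarrow> real \<Rightarrow> complex" where
  "prim_fun L f = ext L (\<lambda>x. LINT t|lebesgue. indicator {0<..x} t *\<^sub>R f t)"

lemma lmeasurable_Ioc: "{a<..b::real} \<in> lmeasurable"
  by (rule bounded_set_imp_lmeasurable) auto

lemma lmeasurable_Ioo: "{a<..<b::real} \<in> lmeasurable"
  by (rule bounded_set_imp_lmeasurable) auto

lemma integrable_indicator_lmeasurable: "A \<in> lmeasurable \<Longrightarrow> integrable lebesgue (indicator A :: real \<Rightarrow> real)"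
  by (rule integrable_real_indicator) (auto simp: fmeasurable_def)

lemma square_integrable_indicator:
  "A \<in> lmeasurable \<Longrightarrow> (\<lambda>x. complex_of_real (indicator A x)) \<in> square_integrable"
proof -
  assume A: "A \<in> lmeasurable"
  have "(\<lambda>x. (cmod (complex_of_real (indicator A x)))\<^sup>2) = indicator A"
    by (auto simp: indicator_def)
  moreover have "integrable lebesgue (indicator A :: real \<Rightarrow> real)"
    using A by (rule integrable_indicator_lmeasurable)
  ultimately show ?thesis
    using A by (auto simp: square_integrable_def)
qed

lemma integrable_indicator_mult:
  assumes "A \<in> lmeasurable" "f \<in> square_integrable"
  shows "integrable lebesgue (\<lambda>t. indicator A t *\<^sub>R f t)"
  using square_integrable_mult[OF assms(2) square_integrable_indicator[OF assms(1)]]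
  by (simp add: scaleR_conv_of_real mult.commute)

text \<open>The Cauchy-Schwarz inequality for |f| and the indicator. The absolute value is taken
  first because the inner product of \<open>l2\<close> sees real parts only.\<close>

lemma norm_integral_indicator_le:
  assumes A: "A \<in> lmeasurable" and f: "f \<in> square_integrable"
  shows "norm (LINT t|lebesgue. indicator A t *\<^sub>R f t) \<le> sqrt (measure lebesgue A) * norm (abs_l2 f)"
proof -
  define g where "g t = complex_of_real (cmod (f t))" for t
  define i where "i t = complex_of_real (indicator A t)" for t
  have i: "i \<in> square_integrable" unfolding i_def[abs_def] using square_integrable_indicator[OF A] .
  have g: "g \<in> square_integrable" using f by (auto simp: g_def[abs_def] square_integrable_def)
  have ng: "norm (abs_l2 g) = norm (abs_l2 f)"
    by (simp only: norm_eq_sqrt_inner[of "abs_l2 g"] norm_eq_sqrt_inner[of "abs_l2 f"] inner_l2.abs_eq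
        l2rel_self f g integral_mult_cnj_self)
      (simp add: g_def)
  have "(LINT t|lebesgue. (cmod (i t))\<^sup>2) = measure lebesgue A"
  proof -
    have "(LINT t|lebesgue. (cmod (i t))\<^sup>2) = (LINT t|lebesgue. indicator A t)"
      by (intro Bochner_Integration.integral_cong) (auto simp: i_def indicator_def)
    then show ?thesis by simp
  qed
  then have ni: "norm (abs_l2 i) = sqrt (measure lebesgue A)"
    by (simp add: norm_eq_sqrt_inner[of "abs_l2 i"] inner_l2.abs_eq l2rel_self i integral_mult_cnj_self)
  have "norm (LINT t|lebesgue. indicator A t *\<^sub>R f t) \<le> (LINT t|lebesgue. norm (indicator A t *\<^sub>R f t))"
    by (rule integral_norm_bound)
  also have "\<dots> = Re (LINT t|lebesgue. complex_of_real (norm (indicator A t *\<^sub>R f t)))"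
    by (simp only: integral_complex_of_real Re_complex_of_real)
  also have "(\<lambda>t. complex_of_real (norm (indicator A t *\<^sub>R f t))) = (\<lambda>t. g t * cnj (i t))"
    by (auto simp: g_def i_def)
  also have "Re (LINT t|lebesgue. g t * cnj (i t)) = inner (abs_l2 g) (abs_l2 i)"
    by (simp add: inner_l2.abs_eq l2rel_self i g)
  also have "\<dots> \<le> norm (abs_l2 g) * norm (abs_l2 i)" by (rule norm_cauchy_schwarz)
  finally show ?thesis by (simp add: ng ni mult.commute)
qed

text \<open>The increments are at most sqrt (y - x) times the norm of f. Continuity is what provides
  measurability of the primitive.\<close>

lemma prim_fun_continuous:
  assumes f: "f \<in> square_integrable"
  shows "continuous_on UNIV (\<lambda>x. LINT t|lebesgue. indicator {0<..x} t *\<^sub>R f t)" (is "continuous_on _ ?F")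
proof -
  have le: "norm (?F y - ?F x) \<le> sqrt (y - x) * norm (abs_l2 f)" if "x \<le> y" for x y
  proof -
    have "?F y - ?F x = (LINT t|lebesgue. indicator {0<..y} t *\<^sub>R f t - indicator {0<..x} t *\<^sub>R f t)"
      using f by (intro Bochner_Integration.integral_diff[symmetric] integrable_indicator_mult lmeasurable_Ioc)
    also have "\<dots> = (LINT t|lebesgue. indicator {max 0 x<..y} t *\<^sub>R f t)"
      using that by (intro Bochner_Integration.integral_cong) (auto simp: indicator_def)
    finally have "norm (?F y - ?F x) \<le> sqrt (measure lebesgue {max 0 x<..y}) * norm (abs_l2 f)"
      using norm_integral_indicator_le[OF lmeasurable_Ioc f, of "max 0 x" y] by simp
    also have "measure lebesgue {max 0 x<..y} \<le> y - x"
      using that by (cases "max 0 x \<le> y") (auto simp: max_def)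
    then have "sqrt (measure lebesgue {max 0 x<..y}) * norm (abs_l2 f) \<le> sqrt (y - x) * norm (abs_l2 f)"
      by (intro mult_right_mono real_sqrt_le_mono) auto
    finally show ?thesis .
  qed
  have bd: "norm (?F y - ?F x) \<le> sqrt \<bar>y - x\<bar> * norm (abs_l2 f)" for x y
    using le[of x y] le[of y x] by (cases "x \<le> y") (auto simp: norm_minus_commute)
  show ?thesis unfolding continuous_on_def
  proof
    fix x :: real
    have "((\<lambda>y. sqrt \<bar>y - x\<bar> * norm (abs_l2 f)) \<longlongrightarrow> sqrt \<bar>x - x\<bar> * norm (abs_l2 f)) (at x)"
      by (intro tendsto_intros)
    then have "((\<lambda>y. sqrt \<bar>y - x\<bar> * norm (abs_l2 f)) \<longlongrightarrow> 0) (at x)" by simp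
    then have "((\<lambda>y. ?F y - ?F x) \<longlongrightarrow> 0) (at x)"
      by (rule Lim_null_comparison[rotated]) (simp add: bd)
    then show "(?F \<longlongrightarrow> ?F x) (at x within UNIV)" using LIM_zero_iff by blast
  qed
qed

lemma prim_fun_le:
  assumes f: "f \<in> square_integrable"
  shows "cmod (prim_fun L f x) \<le> indicator {0<..<L} x * (sqrt L * norm (abs_l2 f))"
proof (cases "x \<in> {0<..<L}")
  case True
  have "cmod (prim_fun L f x) \<le> sqrt (measure lebesgue {0<..x}) * norm (abs_l2 f)"
    using True norm_integral_indicator_le[OF lmeasurable_Ioc f, of 0 x] by (simp add: prim_fun_def ext_def)
  also have "\<dots> \<le> sqrt L * norm (abs_l2 f)"
    using True by (intro mult_right_mono real_sqrt_le_mono) auto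
  finally show ?thesis using True by simp
qed (auto simp: prim_fun_def ext_def)

lemma prim_fun_square_integrable:
  assumes f: "f \<in> square_integrable" shows "prim_fun L f \<in> square_integrable"
proof -
  have c: "(\<lambda>x. LINT t|lebesgue. indicator {0<..x} t *\<^sub>R f t) \<in> borel_measurable lebesgue"
    using borel_measurable_continuous_onI[OF prim_fun_continuous[OF f]] by (intro measurable_completion) simp
  have m: "prim_fun L f \<in> borel_measurable lebesgue"
    unfolding prim_fun_def ext_def using c by (intro measurable_If) auto
  have "integrable lebesgue (\<lambda>x. (sqrt L * norm (abs_l2 f))\<^sup>2 * indicator {0<..<L} x :: real)"
    by (intro integrable_mult_right integrable_indicator_lmeasurable lmeasurable_Ioo)
  then have "integrable lebesgue (\<lambda>x. (cmod (prim_fun L f x))\<^sup>2)"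
  proof (rule Bochner_Integration.integrable_bound)
    have "(cmod (prim_fun L f x))\<^sup>2 \<le> (sqrt L * norm (abs_l2 f))\<^sup>2 * indicator {0<..<L} x" for x
      using power_mono[OF prim_fun_le[OF f, of L x], of 2] by (auto simp: indicator_def split: if_splits)
    then show "AE x in lebesgue. norm ((cmod (prim_fun L f x))\<^sup>2)
        \<le> norm ((sqrt L * norm (abs_l2 f))\<^sup>2 * indicator {0<..<L} x :: real)" by simp
  qed (use m in measurable)
  then show ?thesis using m by (simp add: square_integrable_def)
qed

lift_definition prim :: "real \<Rightarrow> l2 \<Rightarrow> l2" is prim_fun
  unfolding l2rel_def
proof (intro conjI; elim conjE)
  fix L and f g :: "real \<Rightarrow> complex"
  assume fg: "f \<in> square_integrable" "g \<in> square_integrable" and AE: "AE x in lebesgue. f x = g x"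
  have "(LINT t|lebesgue. indicator {0<..x} t *\<^sub>R f t) = (LINT t|lebesgue. indicator {0<..x} t *\<^sub>R g t)" for x
    using fg AE by (intro integral_cong_AE borel_measurable_integrable integrable_indicator_mult lmeasurable_Ioc) (auto elim: AE_mp)
  then show "AE x in lebesgue. prim_fun L f x = prim_fun L g x" by (simp add: prim_fun_def ext_def)
qed (auto intro: prim_fun_square_integrable)

lemma prim_cls: "f \<in> L2 L \<Longrightarrow> prim L (cls L f) = cls L (\<lambda>x. LINT t|lebesgue_on {0<..<L}. indicator {..x} t *\<^sub>R f t)"
proof -
  assume f: "f \<in> L2 L"
  have "(LINT t|lebesgue. indicator {0<..x} t *\<^sub>R ext L f t) = (LINT t|lebesgue_on {0<..<L}. indicator {..x} t *\<^sub>R f t)"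
    if "x \<in> {0<..<L}" for x
    by (subst integral_restrict_space) 
      (use that in \<open>auto intro!: Bochner_Integration.integral_cong simp: ext_def indicator_def\<close>)
  then have "prim_fun L (ext L f) = ext L (\<lambda>x. LINT t|lebesgue_on {0<..<L}. indicator {..x} t *\<^sub>R f t)"
    by (auto simp: prim_fun_def ext_def fun_eq_iff)
  then show ?thesis using f by (simp add: cls_def prim.abs_eq l2rel_self ext_square_integrable)
qed

lemma bounded_linear_prim:
  assumes L: "L \<ge> 0" shows "bounded_linear (prim L)"
proof (rule bounded_linear_intro)
  fix x y :: l2 and r :: real
  show "prim L (x + y) = prim L x + prim L y"
  proof transfer
    fix L and f g :: "real \<Rightarrow> complex" assume "l2rel f f" "l2rel g g"
    then have fg: "f \<in> square_integrable" "g \<in> square_integrable" by (auto simp: l2rel_self)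
    have "prim_fun L (\<lambda>x. f x + g x) = (\<lambda>x. prim_fun L f x + prim_fun L g x)"
      using fg by (auto simp: prim_fun_def ext_def fun_eq_iff scaleR_add_right
          intro!: Bochner_Integration.integral_add integrable_indicator_mult lmeasurable_Ioc)
    then show "l2rel (prim_fun L (\<lambda>x. f x + g x)) (\<lambda>x. prim_fun L f x + prim_fun L g x)"
      using fg by (simp add: l2rel_self square_integrable_add prim_fun_square_integrable)
  qed
  show "prim L (r *\<^sub>R x) = r *\<^sub>R prim L x"
  proof transfer
    fix L r and f :: "real \<Rightarrow> complex" assume "l2rel f f"
    then have f: "f \<in> square_integrable" by (auto simp: l2rel_self)
    have "prim_fun L (\<lambda>x. of_real r * f x) = (\<lambda>x. of_real r * prim_fun L f x)"
      by (auto simp: prim_fun_def ext_def fun_eq_iff mult_scaleR_right[symmetric] simp del: mult_scaleR_right)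
    then show "l2rel (prim_fun L (\<lambda>x. of_real r * f x)) (\<lambda>x. of_real r * prim_fun L f x)"
      using f by (simp add: l2rel_self square_integrable_cmult prim_fun_square_integrable)
  qed
  show "norm (prim L x) \<le> norm x * L"
  proof (rule power2_le_imp_le)
    obtain f where f: "f \<in> square_integrable" "x = abs_l2 f"
      by (metis Quotient3_l2 Quotient3_abs_rep Quotient3_rep_reflp l2rel_self)
    have "(norm (prim L x))\<^sup>2 = (LINT t|lebesgue. (cmod (prim_fun L f t))\<^sup>2)"
      using f by (simp add: power2_norm_eq_inner prim.abs_eq inner_l2.abs_eq l2rel_self
          prim_fun_square_integrable integral_mult_cnj_self)
    also have "\<dots> \<le> (LINT t|lebesgue. (sqrt L * norm x)\<^sup>2 * indicator {0<..<L} t)"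
    proof (rule integral_mono)
      show "integrable lebesgue (\<lambda>t. (cmod (prim_fun L f t))\<^sup>2)"
        using prim_fun_square_integrable[OF f(1)] by (simp add: square_integrable_def)
      show "(cmod (prim_fun L f t))\<^sup>2 \<le> (sqrt L * norm x)\<^sup>2 * indicator {0<..<L} t" for t
        using power_mono[OF prim_fun_le[OF f(1), of L t], of 2] f by (auto simp: indicator_def split: if_splits)
    qed (intro integrable_mult_right integrable_indicator_lmeasurable lmeasurable_Ioo)
    also have "\<dots> = (norm x * L)\<^sup>2" using L by (simp add: power_mult_distrib power2_eq_square[of L])
    finally show "(norm (prim L x))\<^sup>2 \<le> (norm x * L)\<^sup>2" .
  qed (use L in simp)
qed

section \<open>Density of the test functions\<close>

text \<open>Iterating a choice of derivative within a family closed under differentiation gives the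
  whole sequence of derivatives that \<open>test_function\<close> asks for.\<close>

lemma smooth_family:
  fixes f :: "real \<Rightarrow> real"
  assumes "\<And>g. g \<in> F \<Longrightarrow> \<exists>g'\<in>F. \<forall>x. (g has_real_derivative g' x) (at x)" "f \<in> F"
  shows "\<exists>D. D 0 = f \<and> (\<forall>n x. (D n has_real_derivative D (Suc n) x) (at x))"
proof -
  obtain d where d: "\<And>g. g \<in> F \<Longrightarrow> d g \<in> F \<and> (\<forall>x. (g has_real_derivative d g x) (at x))"
    using assms(1) by metis
  have "(d ^^ n) f \<in> F" for n by (induction n) (use d assms(2) in auto)
  then show ?thesis using d by (intro exI[of _ "\<lambda>n. (d ^^ n) f"]) auto
qed

text \<open>For k = 0 this is the standard flat function exp (- c / (x - a)) switched on at a. The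
  powers are included because differentiation produces them.\<close>

definition cutoff :: "real \<Rightarrow> real \<Rightarrow> nat \<Rightarrow> real \<Rightarrow> real" where
  "cutoff a c k x = (if x \<le> a then 0 else (1 / (x - a)) ^ k * exp (- c / (x - a)))"

lemma power_exp_at_right_0:
  assumes c: "c > 0" shows "((\<lambda>h. (1 / h) ^ k * exp (- c / h)) \<longlongrightarrow> 0) (at_right (0::real))"
proof -
  have "filterlim (\<lambda>h::real. c * inverse h) at_top (at_right 0)"
    by (rule filterlim_tendsto_pos_mult_at_top[OF tendsto_const c filterlim_inverse_at_top_right])
  then have "((\<lambda>h. (c * inverse h) ^ k / exp (c * inverse h)) \<longlongrightarrow> 0) (at_right (0::real))"
    by (rule filterlim_compose[OF tendsto_power_div_exp_0])
  then have "((\<lambda>h. (1 / c) ^ k * ((c * inverse h) ^ k / exp (c * inverse h))) \<longlongrightarrow> (1 / c) ^ k * 0) (at_right (0::real))"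
    by (intro tendsto_intros)
  moreover have "(1 / c) ^ k * ((c * inverse h) ^ k / exp (c * inverse h)) = (1 / h) ^ k * exp (- c / h)" for h
    using c by (simp add: power_mult_distrib exp_minus field_simps)
  ultimately show ?thesis by simp
qed

lemma cutoff_deriv:
  assumes c: "c > 0"
  shows "(cutoff a c k has_real_derivative c * cutoff a c (k + 2) x + (- real k) * cutoff a c (k + 1) x) (at x)"
proof (cases x a rule: linorder_cases)
  case less
  have "((\<lambda>x. 0) has_real_derivative 0) (at x)" by simp
  then have "(cutoff a c k has_real_derivative 0) (at x)"
    by (rule has_field_derivative_transform_within_open[of _ _ _ "{..<a}"]) (use less in \<open>auto simp: cutoff_def\<close>)
  then show ?thesis using less by (simp add: cutoff_def)
next
  case greater
  have "((\<lambda>x. (1 / (x - a)) ^ k * exp (- c / (x - a))) has_real_derivative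
      c * cutoff a c (k + 2) x + (- real k) * cutoff a c (k + 1) x) (at x)"
  proof -
    have "((\<lambda>x. 1 / (x - a)) has_real_derivative - ((1 / (x - a)) ^ 2)) (at x)"
      using greater by (auto intro!: derivative_eq_intros simp: power2_eq_square)
    from DERIV_power[OF this, of k]
    have p: "((\<lambda>x. (1 / (x - a)) ^ k) has_real_derivative - real k * (1 / (x - a)) ^ (k + 1)) (at x)"
      by (rule DERIV_cong) (cases k; simp add: power2_eq_square algebra_simps add_divide_distrib diff_divide_distrib)
    have e: "((\<lambda>x. exp (- c / (x - a))) has_real_derivative c * (1 / (x - a))\<^sup>2 * exp (- c / (x - a))) (at x)"
      using greater by (auto intro!: derivative_eq_intros simp: power2_eq_square)
    have "- real k * z ^ (k + 1) * E + c * z\<^sup>2 * E * z ^ k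
        = c * (z ^ (k + 2) * E) + (- real k) * (z ^ (k + 1) * E)" for z E :: real
      by (simp add: power_add power2_eq_square algebra_simps)
    then show ?thesis
      using DERIV_mult[OF p e] greater by (simp only: cutoff_def not_le[symmetric] if_False)
  qed
  then show ?thesis
    by (rule has_field_derivative_transform_within_open[of _ _ _ "{a<..}"]) (use greater in \<open>auto simp: cutoff_def\<close>)
next
  case equal
  have "((\<lambda>h. (cutoff a c k (a + h) - cutoff a c k a) / h) \<longlongrightarrow> 0) (at 0)"
  proof (rule filterlim_split_at)
    show "((\<lambda>h. (cutoff a c k (a + h) - cutoff a c k a) / h) \<longlongrightarrow> 0) (at_left 0)"
      by (rule Lim_transform_eventually[OF tendsto_const[of 0]]) (auto simp: cutoff_def eventually_at_filter)
    \<comment> \<open>The difference quotient at a contributes one more negative power of h, hence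
      the exponent \<open>Suc k\<close>.\<close>
    show "((\<lambda>h. (cutoff a c k (a + h) - cutoff a c k a) / h) \<longlongrightarrow> 0) (at_right 0)"
      by (rule Lim_transform_eventually[OF power_exp_at_right_0[OF c, of "Suc k"]])
        (auto simp: cutoff_def eventually_at_filter)
  qed
  then show ?thesis using equal by (simp add: DERIV_def cutoff_def)
qed

text \<open>Reflected cutoffs supply right endpoints, and products of both kinds supply compact
  support.\<close>

inductive_set cutoff_algebra :: "(real \<Rightarrow> real) set" where
  const: "(\<lambda>x. r) \<in> cutoff_algebra"
| left: "c > 0 \<Longrightarrow> (\<lambda>x. cutoff a c k x) \<in> cutoff_algebra"
| right: "c > 0 \<Longrightarrow> (\<lambda>x. cutoff a c k (- x)) \<in> cutoff_algebra"
| add: "\<lbrakk>f \<in> cutoff_algebra; g \<in> cutoff_algebra\<rbrakk> \<Longrightarrow> (\<lambda>x. f x + g x) \<in> cutoff_algebra"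
| mult: "\<lbrakk>f \<in> cutoff_algebra; g \<in> cutoff_algebra\<rbrakk> \<Longrightarrow> (\<lambda>x. f x * g x) \<in> cutoff_algebra"

lemma cutoff_algebra_deriv:
  "g \<in> cutoff_algebra \<Longrightarrow> \<exists>g'\<in>cutoff_algebra. \<forall>x. (g has_real_derivative g' x) (at x)"
proof (induction rule: cutoff_algebra.induct)
  case (const r)
  then show ?case by (intro bexI[of _ "\<lambda>x. 0"]) (auto intro: cutoff_algebra.const)
next
  case (left c a k)
  then have "(\<lambda>x. c * cutoff a c (k + 2) x + (- real k) * cutoff a c (k + 1) x) \<in> cutoff_algebra"
    by (intro cutoff_algebra.intros)
  then show ?case by (rule bexI[rotated]) (intro allI cutoff_deriv left)
next
  case (right c a k)
  have d: "((\<lambda>x. cutoff a c k (- x)) has_real_derivative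
      ((c * cutoff a c (k + 2) (- x) + (- real k) * cutoff a c (k + 1) (- x)) * (- 1))) (at x)" for x
    by (rule DERIV_chain2[where f = "cutoff a c k" and g = uminus, OF cutoff_deriv[OF right]])
      (auto intro!: derivative_eq_intros)
  have mem: "(\<lambda>x. (c * cutoff a c (k + 2) (- x) + (- real k) * cutoff a c (k + 1) (- x)) * (- 1)) \<in> cutoff_algebra"
    using right by (intro cutoff_algebra.intros)
  show ?case by (rule bexI[OF _ mem]) (intro allI d)
next
  case (add f g)
  then obtain f' g' where "f' \<in> cutoff_algebra" "\<forall>x. (f has_real_derivative f' x) (at x)"
    "g' \<in> cutoff_algebra" "\<forall>x. (g has_real_derivative g' x) (at x)" by auto
  then show ?case
    by (intro bexI[of _ "\<lambda>x. f' x + g' x"]) (auto intro!: derivative_eq_intros cutoff_algebra.intros)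
next
  case (mult f g)
  then obtain f' g' where *: "f' \<in> cutoff_algebra" "\<forall>x. (f has_real_derivative f' x) (at x)"
    "g' \<in> cutoff_algebra" "\<forall>x. (g has_real_derivative g' x) (at x)" by auto
  then show ?case
    by (intro bexI[of _ "\<lambda>x. f' x * g x + f x * g' x"])
      (use * mult in \<open>auto intro!: derivative_eq_intros cutoff_algebra.intros simp: mult.commute\<close>)
qed

text \<open>The parameter c is kept because the bump tends to the indicator of the open interval
  (a,b) as c decreases to 0.\<close>

definition bump :: "real \<Rightarrow> real \<Rightarrow> real \<Rightarrow> real \<Rightarrow> real" where
  "bump a b c x = cutoff a c 0 x * cutoff (- b) c 0 (- x)"

lemma bump_eq: "bump a b c x = (if a < x \<and> x < b then exp (- c / (x - a)) * exp (- c / (b - x)) else 0)"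
  by (auto simp: bump_def cutoff_def)

lemma test_function_bump:
  assumes "c > 0" "0 < a" "b < L" shows "test_function L (\<lambda>x. of_real (bump a b c x))"
proof -
  have "bump a b c \<in> cutoff_algebra"
    unfolding bump_def[abs_def] using assms by (intro cutoff_algebra.intros)
  then obtain D where D: "D 0 = bump a b c" "\<And>n x. (D n has_real_derivative D (Suc n) x) (at x)"
    using smooth_family[of cutoff_algebra, OF cutoff_algebra_deriv] by blast
  show ?thesis unfolding test_function_def
  proof (intro conjI)
    show "\<exists>D. D 0 = (\<lambda>x. complex_of_real (bump a b c x)) \<and>
        (\<forall>n x. (D n has_vector_derivative D (Suc n) x) (at x))"
      by (intro exI[of _ "\<lambda>n x. of_real (D n x)"]) (auto simp: D intro!: has_vector_derivative_of_real)
    show "\<exists>K. compact K \<and> K \<subseteq> {0<..<L} \<and> (\<forall>x. x \<notin> K \<longrightarrow> complex_of_real (bump a b c x) = 0)"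
      using assms by (intro exI[of _ "{a..b}"]) (auto simp: bump_eq)
  qed
qed

section \<open>Calculus of test functions\<close>

lemma test_functionE:
  assumes "test_function L \<eta>"
  obtains \<zeta> where "test_function L \<zeta>" "\<And>x. (\<eta> has_vector_derivative \<zeta> x) (at x)"
    "\<And>x. vector_derivative \<eta> (at x) = \<zeta> x"
proof -
  obtain D K where D: "D 0 = \<eta>" "\<And>n x. (D n has_vector_derivative D (Suc n) x) (at x)"
    and K: "compact K" "K \<subseteq> {0<..<L}" "\<And>x. x \<notin> K \<Longrightarrow> \<eta> x = 0"
    using assms unfolding test_function_def by blast
  have d: "(\<eta> has_vector_derivative D 1 x) (at x)" for x using D(1) D(2)[of 0 x] by simp
  have zero: "D 1 x = 0" if "x \<notin> K" for x
  proof -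
    have "((\<lambda>x. 0) has_vector_derivative D 1 x) (at x)"
      by (rule has_vector_derivative_transform_within_open[OF d[of x], where S = "- K"])
        (use K that in \<open>auto simp: compact_imp_closed open_Compl\<close>)
    then show ?thesis
      using has_vector_derivative_const vector_derivative_unique_at by blast
  qed
  have "test_function L (D 1)" unfolding test_function_def
  proof (intro conjI)
    show "\<exists>Da. Da 0 = D 1 \<and> (\<forall>n x. (Da n has_vector_derivative Da (Suc n) x) (at x))"
      by (intro exI[of _ "\<lambda>n. D (Suc n)"]) (auto simp: D)
    show "\<exists>K. compact K \<and> K \<subseteq> {0<..<L} \<and> (\<forall>x. x \<notin> K \<longrightarrow> D 1 x = 0)" using K zero by blast
  qed
  then show ?thesis using that d vector_derivative_at by blast
qed

lemma test_function_lincomb: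
  assumes "test_function L \<eta>" "test_function L \<zeta>"
  shows "test_function L (\<lambda>x. c * \<eta> x + d * \<zeta> x)"
proof -
  obtain D K where D: "D 0 = \<eta>" "\<And>n x. (D n has_vector_derivative D (Suc n) x) (at x)"
    and K: "compact K" "K \<subseteq> {0<..<L}" "\<And>x. x \<notin> K \<Longrightarrow> \<eta> x = 0"
    using assms(1) unfolding test_function_def by blast
  obtain D' K' where D': "D' 0 = \<zeta>" "\<And>n x. (D' n has_vector_derivative D' (Suc n) x) (at x)"
    and K': "compact K'" "K' \<subseteq> {0<..<L}" "\<And>x. x \<notin> K' \<Longrightarrow> \<zeta> x = 0"
    using assms(2) unfolding test_function_def by blast
  show ?thesis unfolding test_function_def
  proof (intro conjI)
    show "\<exists>Da. Da 0 = (\<lambda>x. c * \<eta> x + d * \<zeta> x) \<and> (\<forall>n x. (Da n has_vector_derivative Da (Suc n) x) (at x))"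
      by (intro exI[of _ "\<lambda>n x. c * D n x + d * D' n x"])
        (auto simp: D D' intro!: has_vector_derivative_add has_vector_derivative_mult_right)
    show "\<exists>K. compact K \<and> K \<subseteq> {0<..<L} \<and> (\<forall>x. x \<notin> K \<longrightarrow> c * \<eta> x + d * \<zeta> x = 0)"
      using K K' by (intro exI[of _ "K \<union> K'"]) auto
  qed
qed

lemma test_function_cmult: "test_function L \<eta> \<Longrightarrow> test_function L (\<lambda>x. c * \<eta> x)"
  using test_function_lincomb[of L \<eta> \<eta> c 0] by simp

lemma test_function_cnj:
  assumes "test_function L \<eta>" shows "test_function L (\<lambda>x. cnj (\<eta> x))"
proof -
  obtain D K where D: "D 0 = \<eta>" "\<And>n x. (D n has_vector_derivative D (Suc n) x) (at x)"
    and K: "compact K" "K \<subseteq> {0<..<L}" "\<And>x. x \<notin> K \<Longrightarrow> \<eta> x = 0"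
    using assms(1) unfolding test_function_def by blast
  show ?thesis unfolding test_function_def
  proof (intro conjI)
    show "\<exists>Da. Da 0 = (\<lambda>x. cnj (\<eta> x)) \<and> (\<forall>n x. (Da n has_vector_derivative Da (Suc n) x) (at x))"
      by (intro exI[of _ "\<lambda>n x. cnj (D n x)"]) (auto simp: D intro!: has_vector_derivative_cnj)
    show "\<exists>K. compact K \<and> K \<subseteq> {0<..<L} \<and> (\<forall>x. x \<notin> K \<longrightarrow> cnj (\<eta> x) = 0)"
      using K by (intro exI[of _ K]) auto
  qed
qed

lemma test_function_outside: "test_function L \<eta> \<Longrightarrow> x \<le> 0 \<or> L \<le> x \<Longrightarrow> \<eta> x = 0"
  unfolding test_function_def by (metis greaterThanLessThan_iff not_less subsetD)

lemma test_function_continuous: "test_function L \<eta> \<Longrightarrow> continuous_on UNIV \<eta>"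
  by (metis test_functionE continuous_at_imp_continuous_on has_vector_derivative_continuous)

lemma L2_bounded:
  assumes "f \<in> borel_measurable (lebesgue_on {0<..<L})" "\<And>x. x \<in> {0<..<L} \<Longrightarrow> cmod (f x) \<le> B"
  shows "f \<in> L2 L"
proof -
  interpret finite_measure "lebesgue_on {0<..<L}" by (rule finite_measure_lebesgue_on[OF lmeasurable_Ioo])
  have "integrable (lebesgue_on {0<..<L}) (\<lambda>x. (cmod (f x))\<^sup>2)"
  proof (rule integrable_const_bound)
    show "AE x in lebesgue_on {0<..<L}. norm ((cmod (f x))\<^sup>2) \<le> B\<^sup>2"
      using assms(2) by (intro AE_I2) (auto intro!: power_mono)
  qed (use assms(1) in measurable)
  then show ?thesis using assms(1) by (simp add: L2_def)
qed

lemma continuous_borel_measurable_on: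
  "continuous_on UNIV f \<Longrightarrow> f \<in> borel_measurable (lebesgue_on {0<..<L::real})" for f :: "real \<Rightarrow> complex"
  by (rule continuous_imp_measurable_on_sets_lebesgue) (auto intro: continuous_on_subset)

lemma test_function_L2:
  assumes "test_function L \<eta>" shows "\<eta> \<in> L2 L"
proof -
  have c: "continuous_on UNIV \<eta>" using test_function_continuous[OF assms] .
  have "compact (\<eta> ` {0..L})" using c by (intro compact_continuous_image) (auto intro: continuous_on_subset)
  then obtain B where B: "\<And>x. x \<in> {0..L} \<Longrightarrow> cmod (\<eta> x) \<le> B"
    using compact_imp_bounded bounded_iff by (metis image_eqI)
  show ?thesis by (rule L2_bounded[OF continuous_borel_measurable_on[OF c], of _ B]) (use B in auto)
qed

text \<open>Only boundary values are prescribed, since the lemma is also applied to a primitive not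
  yet known to be a test function and to products. As \<zeta> vanishes at 0 and L, the integrand
  over the open interval agrees everywhere with the one over [0,x], and the fundamental theorem
  applies.\<close>

lemma integral_test_deriv:
  fixes \<eta> \<zeta> :: "real \<Rightarrow> complex"
  assumes \<eta>: "\<eta> 0 = 0" and c: "continuous_on UNIV \<zeta>" and z: "\<zeta> 0 = 0" "\<zeta> L = 0"
    and d: "\<And>x. (\<eta> has_vector_derivative \<zeta> x) (at x)" and x: "0 \<le> x" "x \<le> L"
  shows "(LINT t|lebesgue_on {0<..<L}. indicator {..x} t *\<^sub>R \<zeta> t) = \<eta> x"
proof -
  have ind: "indicator {0<..<L} t *\<^sub>R (indicator {..x} t *\<^sub>R \<zeta> t) = indicator {0..x} t *\<^sub>R \<zeta> t" for t
    by (cases "t = 0"; cases "t = L") (use x z in \<open>auto simp: indicator_def\<close>)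
  have "(LINT t|lebesgue_on {0<..<L}. indicator {..x} t *\<^sub>R \<zeta> t)
      = (LINT t|lebesgue. indicator {0<..<L} t *\<^sub>R (indicator {..x} t *\<^sub>R \<zeta> t))"
    by (subst integral_restrict_space) auto
  also have "\<dots> = (LINT t|lebesgue. indicator {0..x} t *\<^sub>R \<zeta> t)"
    unfolding ind ..
  also have "\<dots> = (LINT t|lborel. indicator {0..x} t *\<^sub>R \<zeta> t)"
    using borel_measurable_continuous_onI[OF c] by (intro integral_completion) measurable
  also have "\<dots> = \<eta> x - \<eta> 0"
    using x c d by (intro integral_FTC_Icc) (auto intro: has_vector_derivative_at_within continuous_on_subset)
  finally show ?thesis using \<eta> by simp
qed

lemma prim_test:
  assumes "test_function L \<eta>" "test_function L \<zeta>" "\<And>x. (\<eta> has_vector_derivative \<zeta> x) (at x)"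
  shows "prim L (cls L \<zeta>) = cls L \<eta>"
proof -
  have "ext L (\<lambda>x. LINT t|lebesgue_on {0<..<L}. indicator {..x} t *\<^sub>R \<zeta> t) = ext L \<eta>"
    using integral_test_deriv[of \<eta> \<zeta> L] test_function_outside[OF assms(1)] test_function_outside[OF assms(2)]
      test_function_continuous[OF assms(2)] assms(3) by (auto simp: ext_def)
  then show ?thesis using prim_cls[OF test_function_L2[OF assms(2)]] by (simp add: cls_def)
qed

lemma integral_test_deriv_0:
  assumes "test_function L \<eta>" "test_function L \<zeta>" "\<And>x. (\<eta> has_vector_derivative \<zeta> x) (at x)" "0 \<le> L"
  shows "(LINT t|lebesgue_on {0<..<L}. \<zeta> t) = 0"
proof -
  have "(LINT t|lebesgue_on {0<..<L}. \<zeta> t) = (LINT t|lebesgue_on {0<..<L}. indicator {..L} t *\<^sub>R \<zeta> t)"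
    by (intro Bochner_Integration.integral_cong) auto
  also have "\<dots> = \<eta> L"
    by (rule integral_test_deriv)
      (use assms(3,4) test_function_outside[OF assms(1)] test_function_outside[OF assms(2)]
        test_function_continuous[OF assms(2)] in auto)
  finally show ?thesis using test_function_outside[OF assms(1)] by simp
qed

text \<open>The zero mean makes the primitive vanish again to the right of the support of
  \<zeta>.\<close>

lemma test_function_primitive:
  assumes \<zeta>: "test_function L \<zeta>" and L: "0 < L" and mean: "(LINT t|lebesgue_on {0<..<L}. \<zeta> t) = 0"
  obtains \<eta> where "test_function L \<eta>" "\<And>x. (\<eta> has_vector_derivative \<zeta> x) (at x)"
proof -
  obtain D K where D: "D 0 = \<zeta>" "\<And>n x. (D n has_vector_derivative D (Suc n) x) (at x)"
    and K: "compact K" "K \<subseteq> {0<..<L}" "\<And>x. x \<notin> K \<Longrightarrow> \<zeta> x = 0"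
    using \<zeta> unfolding test_function_def by blast
  have c: "continuous_on UNIV \<zeta>" by (rule test_function_continuous[OF \<zeta>])
  have int: "\<zeta> integrable_on {a..b}" for a b
    by (rule integrable_continuous_interval[OF continuous_on_subset[OF c]]) auto
  obtain a b where ab: "0 < a" "b < L" "a < b" "K \<subseteq> {a..b}"
  proof (cases "K = {}")
    case True then show ?thesis using that[of "L/3" "L/2"] L by auto
  next
    case False
    then obtain p r where "p \<in> K" "\<forall>x\<in>K. p \<le> x" "r \<in> K" "\<forall>x\<in>K. x \<le> r"
      using compact_attains_inf[OF K(1)] compact_attains_sup[OF K(1)] by meson
    \<comment> \<open>Halving p keeps a < b even when the support is a single point.\<close>
    then show ?thesis using K(2) that[of "p/2" r] by force
  qed
  have z: "\<zeta> x = 0" if "x < a \<or> b < x" for x using K(3) ab(4) that by force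
  define \<eta> where "\<eta> x = integral {a..x} \<zeta>" for x
  \<comment> \<open>The lower limit can be moved left freely, which allows differentiation at points
    x below a as well.\<close>
  have \<eta>R: "\<eta> x = integral {c..x} \<zeta>" if "c \<le> a" for c x
  proof (cases "a \<le> x")
    case True
    have "integral {c..x} \<zeta> = integral {c..a} \<zeta> + integral {a..x} \<zeta>"
      using that True int by (simp add: Henstock_Kurzweil_Integration.integral_combine)
    also have "integral {c..a} \<zeta> = integral {c..a} (\<lambda>x. 0)"
      by (rule integral_spike[of "{a}"]) (use z in auto)
    finally show ?thesis by (simp add: \<eta>_def)
  next
    case False
    have "integral {c..x} \<zeta> = integral {c..x} (\<lambda>x. 0)"
      by (rule Henstock_Kurzweil_Integration.integral_cong) (use False z in auto)
    then show ?thesis using False by (simp add: \<eta>_def)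
  qed
  have d: "(\<eta> has_vector_derivative \<zeta> x) (at x)" for x
  proof -
    define c where "c = min a x - 1"
    have "((\<lambda>u. integral {c..u} \<zeta>) has_vector_derivative \<zeta> x) (at x within {c..x + 1})"
      by (rule integral_has_vector_derivative) (auto intro: continuous_on_subset[OF c] simp: c_def)
    then have "((\<lambda>u. integral {c..u} \<zeta>) has_vector_derivative \<zeta> x) (at x)"
      by (simp add: at_within_Icc_at c_def)
    moreover have "(\<lambda>u. integral {c..u} \<zeta>) = \<eta>"
      using \<eta>R[of c] by (simp add: c_def fun_eq_iff)
    ultimately show ?thesis by simp
  qed
  have outside: "\<eta> x = 0" if "x \<notin> {a..b}" for x
  proof (cases "x < a")
    case True then show ?thesis by (simp add: \<eta>_def)
  next
    case False
    then have x: "b \<le> x" using that by simp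
    have const: "\<eta> y = \<eta> b" if "b \<le> y" for y
    proof -
      have "\<eta> y = \<eta> b + integral {b..y} \<zeta>"
        unfolding \<eta>_def using that ab int by (simp add: Henstock_Kurzweil_Integration.integral_combine)
      also have "integral {b..y} \<zeta> = integral {b..y} (\<lambda>x. 0)"
        by (rule integral_spike[of "{b}"]) (use z in auto)
      finally show ?thesis by simp
    qed
    have "\<eta> 0 = 0" using ab by (simp add: \<eta>_def)
    then have "\<eta> L = (LINT t|lebesgue_on {0<..<L}. indicator {..L} t *\<^sub>R \<zeta> t)"
      by (intro integral_test_deriv[symmetric]) (use d c test_function_outside[OF \<zeta>] L in auto)
    also have "\<dots> = (LINT t|lebesgue_on {0<..<L}. \<zeta> t)"
      by (intro Bochner_Integration.integral_cong) auto
    finally show ?thesis using mean const[OF x] const[of L] ab by simp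
  qed
  have "test_function L \<eta>" unfolding test_function_def
  proof (intro conjI)
    show "\<exists>D. D 0 = \<eta> \<and> (\<forall>n x. (D n has_vector_derivative D (Suc n) x) (at x))"
    proof (intro exI[of _ "\<lambda>n. case n of 0 \<Rightarrow> \<eta> | Suc n \<Rightarrow> D n"] conjI allI)
      fix n x show "((case n of 0 \<Rightarrow> \<eta> | Suc n \<Rightarrow> D n) has_vector_derivative
          (case Suc n of 0 \<Rightarrow> \<eta> | Suc n \<Rightarrow> D n) x) (at x)"
        using d D by (cases n) auto
    qed simp
    show "\<exists>K. compact K \<and> K \<subseteq> {0<..<L} \<and> (\<forall>x. x \<notin> K \<longrightarrow> \<eta> x = 0)"
      using outside ab by (intro exI[of _ "{a..b}"]) auto
  qed
  then show ?thesis using d that by blast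
qed

section \<open>Approximation of indicators and simple functions\<close>

lemma cls_tendsto:
  assumes f: "\<And>n. f n \<in> L2 L" and g: "g \<in> L2 L"
    and w: "integrable (lebesgue_on {0<..<L}) (\<lambda>x. (w x)\<^sup>2)"
    and le: "\<And>n x. x \<in> {0<..<L} \<Longrightarrow> cmod (f n x - g x) \<le> w x"
    and lim: "\<And>x. x \<in> {0<..<L} \<Longrightarrow> (\<lambda>n. f n x) \<longlonglongrightarrow> g x"
  shows "(\<lambda>n. cls L (f n)) \<longlonglongrightarrow> cls L g"
proof -
  let ?M = "lebesgue_on {0<..<L}"
  have d: "(\<lambda>x. f n x - g x) \<in> L2 L" for n using f g by (intro L2_diff)
  have "(\<lambda>n. LINT x|?M. (cmod (f n x - g x))\<^sup>2) \<longlonglongrightarrow> (LINT x|?M. 0)"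
  proof (rule integral_dominated_convergence[OF _ _ w])
    show "AE x in ?M. (\<lambda>n. (cmod (f n x - g x))\<^sup>2) \<longlonglongrightarrow> 0"
    proof (rule AE_I2)
      fix x assume "x \<in> space ?M"
      then have "(\<lambda>n. (cmod (f n x - g x))\<^sup>2) \<longlonglongrightarrow> (cmod (g x - g x))\<^sup>2"
        by (intro tendsto_intros lim) simp
      then show "(\<lambda>n. (cmod (f n x - g x))\<^sup>2) \<longlonglongrightarrow> 0" by simp
    qed
    show "AE x in ?M. norm ((cmod (f n x - g x))\<^sup>2) \<le> (w x)\<^sup>2" for n
      by (rule AE_I2) (auto intro!: power_mono le)
    show "(\<lambda>x. (cmod (f n x - g x))\<^sup>2) \<in> borel_measurable ?M" for n
      using L2_measurable[OF d[of n]] by measurable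
  qed simp
  then have "(\<lambda>n. sqrt (LINT x|?M. (cmod (f n x - g x))\<^sup>2)) \<longlonglongrightarrow> sqrt 0"
    by (intro tendsto_intros) simp
  then have "(\<lambda>n. norm (cls L (f n) - cls L g)) \<longlonglongrightarrow> 0"
    by (simp add: norm_cls[OF d] L2_norm_def f g flip: cls_diff)
  then show ?thesis by (simp add: tendsto_norm_zero_iff LIM_zero_iff)
qed

text \<open>\<open>l2\<close> has real scalars only, so complex multiples are treated on the level
  of functions.\<close>

lemma cls_cmult_tendsto:
  assumes "(\<lambda>n. cls L (f n)) \<longlonglongrightarrow> cls L g" "\<And>n. f n \<in> L2 L" "g \<in> L2 L"
  shows "(\<lambda>n. cls L (\<lambda>x. c * f n x)) \<longlonglongrightarrow> cls L (\<lambda>x. c * g x)"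
proof -
  have "norm (cls L (\<lambda>x. c * f n x) - cls L (\<lambda>x. c * g x)) = cmod c * norm (cls L (f n) - cls L g)" for n
  proof -
    have "cls L (\<lambda>x. c * f n x) - cls L (\<lambda>x. c * g x) = cls L (\<lambda>x. c * (f n x - g x))"
      using assms by (simp add: right_diff_distrib L2_cmult cls_diff)
    then show ?thesis
      using assms(2,3) by (simp add: norm_cls L2_cmult L2_diff L2_norm_def norm_mult power_mult_distrib
          real_sqrt_mult flip: cls_diff)
  qed
  moreover have "(\<lambda>n. cmod c * norm (cls L (f n) - cls L g)) \<longlonglongrightarrow> cmod c * norm (cls L g - cls L g)"
    by (intro tendsto_intros assms)
  ultimately have "(\<lambda>n. norm (cls L (\<lambda>x. c * f n x) - cls L (\<lambda>x. c * g x))) \<longlonglongrightarrow> 0" by simp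
  then show ?thesis by (simp add: tendsto_norm_zero_iff LIM_zero_iff)
qed

definition tests :: "real \<Rightarrow> l2 set" where
  "tests L = cls L ` {\<eta>. test_function L \<eta>}"

lemma tests_cmult:
  assumes "cls L f \<in> closure (tests L)" "f \<in> L2 L"
  shows "cls L (\<lambda>x. c * f x) \<in> closure (tests L)"
proof -
  obtain z where z: "\<And>n. z n \<in> tests L" "z \<longlonglongrightarrow> cls L f" using assms(1) by (metis closure_sequential)
  have "\<forall>n. \<exists>\<eta>. test_function L \<eta> \<and> z n = cls L \<eta>" using z(1) by (auto simp: tests_def)
  then obtain \<eta> where \<eta>: "\<And>n. test_function L (\<eta> n)" "\<And>n. z n = cls L (\<eta> n)" by metis
  have "(\<lambda>n. cls L (\<eta> n)) \<longlonglongrightarrow> cls L f" using z(2) by (simp flip: \<eta>(2))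
  then have "(\<lambda>n. cls L (\<lambda>x. c * \<eta> n x)) \<longlonglongrightarrow> cls L (\<lambda>x. c * f x)"
    by (rule cls_cmult_tendsto) (use \<eta> assms(2) test_function_L2 in auto)
  moreover have "cls L (\<lambda>x. c * \<eta> n x) \<in> tests L" for n
    using test_function_cmult[OF \<eta>(1)] by (auto simp: tests_def)
  ultimately show ?thesis
    unfolding closure_sequential by (intro exI[of _ "\<lambda>n. cls L (\<lambda>x. c * \<eta> n x)"]) auto
qed

lemma tests_add:
  assumes "x \<in> closure (tests L)" "y \<in> closure (tests L)" shows "x + y \<in> closure (tests L)"
proof -
  obtain a b where ab: "\<And>n. a n \<in> tests L" "a \<longlonglongrightarrow> x" "\<And>n. b n \<in> tests L" "b \<longlonglongrightarrow> y"
    using assms by (metis closure_sequential)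
  have "a n + b n \<in> tests L" for n
  proof -
    obtain f g where *: "a n = cls L f" "test_function L f" "b n = cls L g" "test_function L g"
      using ab(1,3)[of n] unfolding tests_def by auto
    then have "a n + b n = cls L (\<lambda>x. 1 * f x + 1 * g x)" by (simp add: cls_add test_function_L2)
    then show ?thesis using test_function_lincomb[OF *(2,4), of 1 1] unfolding tests_def by blast
  qed
  moreover have "(\<lambda>n. a n + b n) \<longlonglongrightarrow> x + y" by (intro tendsto_intros ab)
  ultimately show ?thesis unfolding closure_sequential by (intro exI[of _ "\<lambda>n. a n + b n"]) auto
qed

lemma tests_closed: "\<lbrakk>\<And>n. z n \<in> closure (tests L); z \<longlonglongrightarrow> x\<rbrakk> \<Longrightarrow> x \<in> closure (tests L)"
  using closed_closure[of "tests L"] unfolding closed_sequential_limits by blast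

lemma indicator_L2:
  assumes "A \<in> sets lebesgue" shows "(\<lambda>x. complex_of_real (indicator A x)) \<in> L2 L"
  using assms by (intro L2_bounded[of _ _ 1])
    (auto simp: indicator_def intro!: measurable_restrict_space1 simp flip: indicator_def)

lemma integrable_const_on: "integrable (lebesgue_on {0<..<L::real}) (\<lambda>x. c :: real)"
proof -
  interpret finite_measure "lebesgue_on {0<..<L}" by (rule finite_measure_lebesgue_on[OF lmeasurable_Ioo])
  show ?thesis by simp
qed

lemma interval_in_tests:
  "cls L (\<lambda>x. complex_of_real (indicator {a<..<b} x)) \<in> closure (tests L)"
proof -
  define r where "r n = 1 / real (Suc n)" for n
  have r0: "r \<longlonglongrightarrow> 0" unfolding r_def by (rule LIMSEQ_inverse_real_of_nat[unfolded inverse_eq_divide])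
  have r: "r n > 0" for n by (simp add: r_def)
  define p s where "p = max a 0" and "s = min b L"
  \<comment> \<open>The same null sequence shrinks the support into the open interval (0,L) and
    flattens the bump towards 1.\<close>
  define \<eta> where "\<eta> n x = complex_of_real (bump (p + r n) (s - r n) (r n) x)" for n x
  have t: "test_function L (\<eta> n)" for n
    unfolding \<eta>_def by (rule test_function_bump) (use r[of n] in \<open>auto simp: p_def s_def min_def max_def\<close>)
  have "(\<lambda>n. cls L (\<eta> n)) \<longlonglongrightarrow> cls L (\<lambda>x. complex_of_real (indicator {a<..<b} x))"
  proof (rule cls_tendsto)
    show "integrable (lebesgue_on {0<..<L}) (\<lambda>x. (2::real)\<^sup>2)" by (rule integrable_const_on)
    fix x :: real assume x: "x \<in> {0<..<L}"
    show "cmod (\<eta> n x - complex_of_real (indicator {a<..<b} x)) \<le> 2" for n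
    proof -
      have "cmod (\<eta> n x) \<le> 1" 
        using r[of n] by (auto simp: \<eta>_def bump_eq norm_mult abs_mult intro!: mult_le_one)
      moreover have "cmod (complex_of_real (indicator {a<..<b} x)) \<le> 1" by (simp add: indicator_def)
      ultimately show ?thesis using norm_triangle_ineq4[of "\<eta> n x" "complex_of_real (indicator {a<..<b} x)"] by linarith
    qed
    show "(\<lambda>n. \<eta> n x) \<longlonglongrightarrow> complex_of_real (indicator {a<..<b} x)"
    proof (cases "x \<in> {a<..<b}")
      case False
      then have "\<eta> n x = 0" for n using r[of n] x by (auto simp: \<eta>_def bump_eq p_def s_def)
      then show ?thesis using False by simp
    next
      case True
      then have ps: "p < x" "x < s" using x by (auto simp: p_def s_def)
      have "(\<lambda>n. exp (- r n / (x - (p + r n))) * exp (- r n / (s - r n - x)))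
          \<longlonglongrightarrow> exp (- 0 / (x - (p + 0))) * exp (- 0 / (s - 0 - x))"
        using ps by (intro tendsto_intros r0) auto
      then have lim: "(\<lambda>n. exp (- r n / (x - (p + r n))) * exp (- r n / (s - r n - x))) \<longlonglongrightarrow> 1" by simp
      have "\<forall>\<^sub>F n in sequentially. r n < x - p" "\<forall>\<^sub>F n in sequentially. r n < s - x"
        using r0 ps by (auto intro: order_tendstoD)
      then have "\<forall>\<^sub>F n in sequentially. exp (- r n / (x - (p + r n))) * exp (- r n / (s - r n - x))
          = bump (p + r n) (s - r n) (r n) x"
        by eventually_elim (simp add: bump_eq)
      from Lim_transform_eventually[OF lim this]
      have "(\<lambda>n. bump (p + r n) (s - r n) (r n) x) \<longlonglongrightarrow> 1" .
      then have "(\<lambda>n. \<eta> n x) \<longlonglongrightarrow> of_real 1" unfolding \<eta>_def by (rule tendsto_of_real)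
      then show ?thesis using True by simp
    qed
  qed (auto intro: test_function_L2 t indicator_L2)
  moreover have "cls L (\<eta> n) \<in> tests L" for n using t by (auto simp: tests_def)
  ultimately show ?thesis unfolding closure_sequential by (intro exI[of _ "\<lambda>n. cls L (\<eta> n)"]) auto
qed

text \<open>Dynkin's theorem from the intersection-stable open intervals: sums treat disjoint finite
  unions, and dominated convergence treats countable ones.\<close>

lemma borel_in_tests:
  assumes "A \<in> sets borel" shows "cls L (\<lambda>x. complex_of_real (indicator A x)) \<in> closure (tests L)"
proof -
  have leb: "A \<in> sets borel \<Longrightarrow> A \<in> sets lebesgue" for A :: "real set" by auto
  let ?G = "range (\<lambda>(a, b). {a<..<b::real})"
  have borel: "sigma_sets UNIV ?G = sets borel" 
  proof -
    have e: "(\<lambda>(a, b). box a b) = (\<lambda>(a, b). {a<..<b::real})" by (auto simp: fun_eq_iff)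
    show ?thesis unfolding e[symmetric] by (subst borel_eq_box) (rule sets_measure_of[symmetric], simp)
  qed
  have zero: "cls L (\<lambda>x. 0) \<in> closure (tests L)"
    using interval_in_tests[of L 0 0] by simp
  show ?thesis
  proof (rule sigma_sets_induct_disjoint[of ?G UNIV A "\<lambda>A. cls L (\<lambda>x. complex_of_real (indicator A x)) \<in> closure (tests L)"])
    show "Int_stable ?G"
    proof (rule Int_stableI)
      fix A B :: "real set" assume "A \<in> ?G" "B \<in> ?G"
      then obtain a b c d where "A = {a<..<b}" "B = {c<..<d}" by auto
      then have "A \<inter> B = {max a c<..<min b d}" by auto
      then show "A \<inter> B \<in> ?G" by (auto intro!: image_eqI[of _ _ "(max a c, min b d)"])
    qed
    show "A \<in> sigma_sets UNIV ?G" using assms borel by simp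
    show "cls L (\<lambda>x. complex_of_real (indicator A x)) \<in> closure (tests L)" if "A \<in> ?G" for A
      using that interval_in_tests by auto
    show "cls L (\<lambda>x. complex_of_real (indicator {} x)) \<in> closure (tests L)" using zero by simp
  next
    fix A assume A: "A \<in> sigma_sets UNIV ?G" "cls L (\<lambda>x. complex_of_real (indicator A x)) \<in> closure (tests L)"
    then have m: "A \<in> sets lebesgue" using borel leb by simp
    have one: "cls L (\<lambda>x. complex_of_real (indicator {0<..<L} x)) \<in> closure (tests L)" by (rule interval_in_tests)
    \<comment> \<open>Classes only see (0,L), so the complement is taken relative to this
      interval.\<close>
    have "cls L (\<lambda>x. complex_of_real (indicator {0<..<L} x) + (- 1) * complex_of_real (indicator A x)) \<in> closure (tests L)"
    proof (subst cls_add)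
      show "(\<lambda>x. complex_of_real (indicator {0<..<L} x)) \<in> L2 L" by (rule indicator_L2) auto
    qed (intro tests_add one tests_cmult A indicator_L2 L2_cmult m)+
    moreover have "ext L (\<lambda>x. complex_of_real (indicator {0<..<L} x) + (- 1) * complex_of_real (indicator A x))
        = ext L (\<lambda>x. complex_of_real (indicator (UNIV - A) x))" by (auto simp: ext_def indicator_def)
    ultimately show "cls L (\<lambda>x. complex_of_real (indicator (UNIV - A) x)) \<in> closure (tests L)" by (simp add: cls_def)
  next
    fix A :: "nat \<Rightarrow> real set"
    assume A: "disjoint_family A" "range A \<subseteq> sigma_sets UNIV ?G"
      "\<And>i. cls L (\<lambda>x. complex_of_real (indicator (A i) x)) \<in> closure (tests L)"
    have m: "A i \<in> sets lebesgue" for i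
    proof -
      have "A i \<in> sigma_sets UNIV ?G" using A(2) by (rule range_subsetD)
      then show ?thesis unfolding borel by (rule leb)
    qed
    have U: "cls L (\<lambda>x. complex_of_real (indicator (\<Union>i<n. A i) x)) \<in> closure (tests L)" for n
    proof (induction n)
      case 0 show ?case using zero by simp
    next
      case (Suc n)
      have "A i \<inter> A n = {}" if "i < n" for i using A(1) that by (simp add: disjoint_family_on_def)
      then have disj: "(\<Union>i<n. A i) \<inter> A n = {}" by blast
      have un: "(\<Union>i<Suc n. A i) = (\<Union>i<n. A i) \<union> A n" by (simp add: lessThan_Suc Un_commute)
      have "(\<lambda>x. complex_of_real (indicator (\<Union>i<Suc n. A i) x))
          = (\<lambda>x. complex_of_real (indicator (\<Union>i<n. A i) x) + complex_of_real (indicator (A n) x))"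
        unfolding un indicator_add[OF disj, symmetric] of_real_add ..
      then show ?case using Suc A(3) m by (simp add: cls_add indicator_L2 tests_add)
    qed
    have "(\<lambda>n. cls L (\<lambda>x. complex_of_real (indicator (\<Union>i<n. A i) x))) \<longlonglongrightarrow>
        cls L (\<lambda>x. complex_of_real (indicator (\<Union>i. A i) x))"
    proof (rule cls_tendsto)
      show "integrable (lebesgue_on {0<..<L}) (\<lambda>x. (1::real)\<^sup>2)" by (rule integrable_const_on)
      show "cmod (complex_of_real (indicator (\<Union>i<n. A i) x) - complex_of_real (indicator (\<Union>i. A i) x)) \<le> 1" for n x
        by (auto simp: indicator_def)
      fix x show "(\<lambda>n. complex_of_real (indicator (\<Union>i<n. A i) x)) \<longlonglongrightarrow> complex_of_real (indicator (\<Union>i. A i) x)"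
        by (intro tendsto_of_real LIMSEQ_indicator_UN)
    qed (auto intro!: indicator_L2 m)
    then show "cls L (\<lambda>x. complex_of_real (indicator (\<Union>i. A i) x)) \<in> closure (tests L)"
      by (rule tests_closed[rotated]) (rule U)
  qed simp
qed

lemma lebesgue_in_tests:
  assumes "A \<in> sets lebesgue" shows "cls L (\<lambda>x. complex_of_real (indicator A x)) \<in> closure (tests L)"
proof -
  obtain C T where CT: "C \<in> sets borel" "negligible T" "C \<union> T = A"
    using sets_lebesgue_almost_borel[OF assms] by metis
  have "AE x in lebesgue. x \<notin> T" using CT(2) by (simp add: negligible_iff_null_sets AE_not_in)
  then have "AE x in lebesgue_on {0<..<L}. complex_of_real (indicator A x) = complex_of_real (indicator C x)"
    by (subst AE_restrict_space_iff) (use CT(3) in \<open>auto elim!: AE_mp simp: indicator_def\<close>)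
  then have "cls L (\<lambda>x. complex_of_real (indicator A x)) = cls L (\<lambda>x. complex_of_real (indicator C x))"
    using CT assms by (intro cls_cong indicator_L2) auto
  then show ?thesis using borel_in_tests[OF CT(1)] by simp
qed

lemma tests_sum:
  assumes "finite I" "\<And>i. i \<in> I \<Longrightarrow> f i \<in> L2 L" "\<And>i. i \<in> I \<Longrightarrow> cls L (f i) \<in> closure (tests L)"
  shows "(\<lambda>x. \<Sum>i\<in>I. f i x) \<in> L2 L \<and> cls L (\<lambda>x. \<Sum>i\<in>I. f i x) \<in> closure (tests L)"
  using assms
proof (induction I rule: finite_induct)
  case empty then show ?case
    using lebesgue_in_tests[of "{}" L] indicator_L2[of "{}" L] by simp
next
  case (insert i I)
  then show ?case by (simp add: L2_add cls_add tests_add)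
qed

theorem tests_dense:
  assumes f: "f \<in> L2 L" shows "cls L f \<in> closure (tests L)"
proof -
  let ?M = "lebesgue_on {0<..<L}"
  obtain s where s: "\<And>i. simple_function ?M (s i)"
    "\<And>x. x \<in> space ?M \<Longrightarrow> (\<lambda>i. s i x) \<longlonglongrightarrow> f x"
    "\<And>i x. x \<in> space ?M \<Longrightarrow> cmod (s i x) \<le> 2 * cmod (f x)"
    using borel_measurable_implies_sequence_metric[OF L2_measurable[OF f], of 0] by (metis dist_0_norm dist_commute)
  have sL: "s i \<in> L2 L \<and> cls L (s i) \<in> closure (tests L)" for i
  proof -
    let ?A = "\<lambda>y. s i -` {y} \<inter> {0<..<L}"
    have fin: "finite (s i ` {0<..<L})" using s(1)[of i] by (simp add: simple_function_def)
    have A: "?A y \<in> sets lebesgue" for y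
    proof -
      have "s i -` {y} \<inter> space ?M \<in> sets ?M"
        by (rule measurable_sets[OF borel_measurable_simple_function[OF s(1)]]) auto
      then obtain X where "X \<in> sets lebesgue" "?A y = {0<..<L} \<inter> X" by (auto simp: sets_restrict_space)
      then show ?thesis by (simp only: sets.Int) (auto intro: sets.Int)
    qed
    have eq: "ext L (\<lambda>x. \<Sum>y\<in>s i ` {0<..<L}. y * complex_of_real (indicator (?A y) x)) = ext L (s i)"
    proof
      fix x show "ext L (\<lambda>x. \<Sum>y\<in>s i ` {0<..<L}. y * complex_of_real (indicator (?A y) x)) x = ext L (s i) x"
      proof (cases "x \<in> {0<..<L}")
        case True
        have "(\<Sum>y\<in>s i ` {0<..<L}. y * complex_of_real (indicator (?A y) x)) = (\<Sum>y\<in>s i ` {0<..<L}. if y = s i x then y else 0)"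
          by (rule sum.cong) (use True in \<open>auto simp: indicator_def\<close>)
        also have "\<dots> = s i x" using fin True by simp
        finally show ?thesis using True by (simp add: ext_def)
      qed (auto simp: ext_def)
    qed
    have "cls L (\<lambda>x. \<Sum>y\<in>s i ` {0<..<L}. y * complex_of_real (indicator (?A y) x)) \<in> closure (tests L)"
      by (rule conjunct2[OF tests_sum[OF fin]]) (intro L2_cmult indicator_L2 tests_cmult lebesgue_in_tests A)+
    then have "cls L (s i) \<in> closure (tests L)" by (simp add: cls_def eq)
    moreover have "s i \<in> L2 L"
    proof -
      have "integrable ?M (\<lambda>x. 4 * (cmod (f x))\<^sup>2)" using f by (simp add: L2_def)
      then have "integrable ?M (\<lambda>x. (cmod (s i x))\<^sup>2)"
      proof (rule Bochner_Integration.integrable_bound)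
        show "AE x in ?M. norm ((cmod (s i x))\<^sup>2) \<le> norm (4 * (cmod (f x))\<^sup>2)"
          using s(3)[of _ i] power_mono[of "cmod (s i _)" "2 * cmod (f _)" 2]
          by (intro AE_I2) (auto simp: power_mult_distrib)
      qed (use borel_measurable_simple_function[OF s(1)] in measurable)
      then show ?thesis using borel_measurable_simple_function[OF s(1)] by (simp add: L2_def)
    qed
    ultimately show ?thesis by simp
  qed
  have "(\<lambda>i. cls L (s i)) \<longlonglongrightarrow> cls L f"
  proof (rule cls_tendsto)
    show "integrable ?M (\<lambda>x. (3 * cmod (f x))\<^sup>2)" using f by (simp add: L2_def power_mult_distrib)
    show "cmod (s n x - f x) \<le> 3 * cmod (f x)" if "x \<in> {0<..<L}" for n x
      using s(3)[of x n] norm_triangle_ineq4[of "s n x" "f x"] that by simp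
    show "(\<lambda>n. s n x) \<longlonglongrightarrow> f x" if "x \<in> {0<..<L}" for x using s(2) that by simp
  qed (use sL f in auto)
  then show ?thesis by (rule tests_closed[rotated]) (use sL in auto)
qed

lemma tests_denseE:
  assumes "f \<in> L2 L"
  obtains \<eta> where "\<And>n. test_function L (\<eta> n)" "(\<lambda>n. cls L (\<eta> n)) \<longlonglongrightarrow> cls L f"
proof -
  obtain z where z: "\<And>n. z n \<in> tests L" "z \<longlonglongrightarrow> cls L f"
    using tests_dense[OF assms] by (metis closure_sequential)
  have "\<forall>n. \<exists>\<eta>. test_function L \<eta> \<and> z n = cls L \<eta>" using z(1) by (auto simp: tests_def)
  then obtain \<eta> where \<eta>: "\<And>n. test_function L (\<eta> n)" "\<And>n. z n = cls L (\<eta> n)" by metis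
  have "z = (\<lambda>n. cls L (\<eta> n))" using \<eta>(2) by auto
  then have "(\<lambda>n. cls L (\<eta> n)) \<longlonglongrightarrow> cls L f" using z(2) by simp
  then show ?thesis by (rule that[OF \<eta>(1)])
qed

section \<open>Weak derivatives\<close>

lemma weak_deriv_L2: "has_weak_deriv L f g \<Longrightarrow> f \<in> L2 L" "has_weak_deriv L f g \<Longrightarrow> g \<in> L2 L"
  by (auto simp: has_weak_deriv_def)

lemma integrable_L2_mult:
  assumes "f \<in> L2 L" "g \<in> L2 L" shows "integrable (lebesgue_on {0<..<L}) (\<lambda>x. f x * g x)"
proof -
  have "(\<lambda>x. cnj (g x)) \<in> borel_measurable (lebesgue_on {0<..<L})"
    by (rule borel_measurable_continuous_on[OF _ L2_measurable[OF assms(2)]]) (intro continuous_intros)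
  then have "(\<lambda>x. cnj (g x)) \<in> L2 L" using assms(2) by (simp add: L2_def)
  from square_integrable_mult[OF ext_square_integrable[OF assms(1)] ext_square_integrable[OF this]]
  have "integrable lebesgue (\<lambda>x. indicator {0<..<L} x *\<^sub>R (f x * g x))"
    by (rule Bochner_Integration.integrable_cong[THEN iffD1, rotated -1]) (auto simp: ext_def)
  then show ?thesis by (simp add: integrable_restrict_space)
qed

lemma integrable_L2: "f \<in> L2 L \<Longrightarrow> integrable (lebesgue_on {0<..<L}) f"
  using integrable_L2_mult[of f L "\<lambda>x. 1"] L2_bounded[of "\<lambda>x. 1" L 1] by simp

lemma weak_derivD:
  assumes "has_weak_deriv L f g" "test_function L \<eta>" "\<And>x. vector_derivative \<eta> (at x) = \<zeta> x"
  shows "(LINT x|lebesgue_on {0<..<L}. f x * \<zeta> x) = - (LINT x|lebesgue_on {0<..<L}. g x * \<eta> x)"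
proof -
  have "(LINT x|lebesgue_on {0<..<L}. f x * vector_derivative \<eta> (at x))
      = - (LINT x|lebesgue_on {0<..<L}. g x * \<eta> x)"
    using assms(1,2) unfolding has_weak_deriv_def by blast
  then show ?thesis unfolding assms(3) .
qed

lemma weak_deriv_lincomb:
  assumes "has_weak_deriv L f g" "has_weak_deriv L f' g'"
  shows "has_weak_deriv L (\<lambda>x. c * f x + d * f' x) (\<lambda>x. c * g x + d * g' x)"
  unfolding has_weak_deriv_def
proof (intro conjI allI impI)
  have L2: "f \<in> L2 L" "g \<in> L2 L" "f' \<in> L2 L" "g' \<in> L2 L" using assms by (auto simp: has_weak_deriv_def)
  then show "(\<lambda>x. c * f x + d * f' x) \<in> L2 L" "(\<lambda>x. c * g x + d * g' x) \<in> L2 L"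
    by (auto intro: L2_add L2_cmult)
  fix \<eta> assume \<eta>: "test_function L \<eta>"
  obtain \<zeta> where \<zeta>: "test_function L \<zeta>" "\<And>x. vector_derivative \<eta> (at x) = \<zeta> x"
    using test_functionE[OF \<eta>] by metis
  have e: "(LINT x|lebesgue_on {0<..<L}. (c * u x + d * w x) * k x) =
      c * (LINT x|lebesgue_on {0<..<L}. u x * k x) + d * (LINT x|lebesgue_on {0<..<L}. w x * k x)"
    if "u \<in> L2 L" "w \<in> L2 L" "k \<in> L2 L" for u w k
  proof -
    have "(LINT x|lebesgue_on {0<..<L}. (c * u x + d * w x) * k x)
        = (LINT x|lebesgue_on {0<..<L}. c * (u x * k x) + d * (w x * k x))"
      by (simp add: algebra_simps)
    then show ?thesis using that by (simp add: integrable_L2_mult)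
  qed
  show "(LINT x|lebesgue_on {0<..<L}. (c * f x + d * f' x) * vector_derivative \<eta> (at x)) =
      - (LINT x|lebesgue_on {0<..<L}. (c * g x + d * g' x) * \<eta> x)"
    unfolding \<zeta>(2) e[OF L2(1,3) test_function_L2[OF \<zeta>(1)]] e[OF L2(2,4) test_function_L2[OF \<eta>]]
    by (simp add: weak_derivD[OF assms(1) \<eta> \<zeta>(2)] weak_derivD[OF assms(2) \<eta> \<zeta>(2)])
qed

text \<open>The defining identity is tested with the conjugate of \<eta>, since the inner product
  conjugates its second argument.\<close>

lemma weak_deriv_inner:
  assumes f: "has_weak_deriv L f g" and t: "test_function L \<eta>" "test_function L \<zeta>"
    "\<And>x. (\<eta> has_vector_derivative \<zeta> x) (at x)"
  shows "inner (cls L f) (cls L \<zeta>) = - inner (cls L g) (cls L \<eta>)"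
proof -
  have "vector_derivative (\<lambda>x. cnj (\<eta> x)) (at x) = cnj (\<zeta> x)" for x
    by (rule vector_derivative_at[OF has_vector_derivative_cnj[OF t(3)]])
  then have "(LINT x|lebesgue_on {0<..<L}. f x * cnj (\<zeta> x)) = - (LINT x|lebesgue_on {0<..<L}. g x * cnj (\<eta> x))"
    by (rule weak_derivD[OF f test_function_cnj[OF t(1)]])
  then show ?thesis using weak_deriv_L2[OF f] t by (simp add: inner_cls test_function_L2)
qed

text \<open>The difference is orthogonal to all test functions, and these are dense. This makes the
  class of the selected \<open>wderiv\<close> independent of the selection.\<close>

lemma weak_deriv_unique:
  assumes "has_weak_deriv L f g" "has_weak_deriv L f g'" shows "cls L g = cls L g'"
proof -
  define z where "z = cls L g - cls L g'"
  have L2: "g \<in> L2 L" "g' \<in> L2 L" using assms weak_deriv_L2 by auto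
  obtain \<eta> where \<eta>: "\<And>n. test_function L (\<eta> n)" "(\<lambda>n. cls L (\<eta> n)) \<longlonglongrightarrow> z"
    using tests_denseE[OF L2_diff[OF L2]] unfolding z_def cls_diff[OF L2] by metis
  have "inner z (cls L (\<eta> n)) = 0" for n
  proof -
    obtain \<zeta> where "test_function L \<zeta>" "\<And>x. (\<eta> n has_vector_derivative \<zeta> x) (at x)"
      using test_functionE[OF \<eta>(1)] by metis
    then show ?thesis
      using weak_deriv_inner[OF assms(1) \<eta>(1)] weak_deriv_inner[OF assms(2) \<eta>(1)]
      unfolding z_def by (simp add: inner_diff_left) (metis neg_equal_iff_equal)
  qed
  moreover have "(\<lambda>n. inner z (cls L (\<eta> n))) \<longlonglongrightarrow> inner z z" by (intro tendsto_intros \<eta>)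
  ultimately have "inner z z = 0" by (simp add: LIMSEQ_const_iff)
  then show ?thesis by (simp add: z_def)
qed

lemma H1_wderiv: "f \<in> H1 L \<Longrightarrow> has_weak_deriv L f (wderiv L f)"
  using someI_ex[of "has_weak_deriv L f"] by (simp add: H1_def wderiv_def)

lemma H1_I: "has_weak_deriv L f g \<Longrightarrow> f \<in> H1 L"
  unfolding H1_def by auto

lemma H1_L2: "f \<in> H1 L \<Longrightarrow> f \<in> L2 L"
  using H1_wderiv weak_deriv_L2 by blast

lemma wderiv_L2: "f \<in> H1 L \<Longrightarrow> wderiv L f \<in> L2 L"
  using H1_wderiv weak_deriv_L2 by blast

lemma cls_wderiv: "has_weak_deriv L f g \<Longrightarrow> cls L (wderiv L f) = cls L g"
  using weak_deriv_unique H1_wderiv H1_I by blast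

lemma H1_lincomb: "f \<in> H1 L \<Longrightarrow> g \<in> H1 L \<Longrightarrow> (\<lambda>x. c * f x + d * g x) \<in> H1 L"
  using weak_deriv_lincomb H1_wderiv H1_I by blast

lemma cls_wderiv_lincomb:
  assumes "f \<in> H1 L" "g \<in> H1 L"
  shows "cls L (wderiv L (\<lambda>x. c * f x + d * g x)) = cls L (\<lambda>x. c * wderiv L f x + d * wderiv L g x)"
  by (rule cls_wderiv[OF weak_deriv_lincomb[OF H1_wderiv H1_wderiv]]) fact+

lemma test_weak_deriv:
  assumes t: "test_function L \<eta>" "test_function L \<zeta>" "\<And>x. (\<eta> has_vector_derivative \<zeta> x) (at x)"
    and L: "0 < L"
  shows "has_weak_deriv L \<eta> \<zeta>"
  unfolding has_weak_deriv_def
proof (intro conjI allI impI)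
  show "\<eta> \<in> L2 L" "\<zeta> \<in> L2 L" using t test_function_L2 by auto
  fix \<omega> assume \<omega>: "test_function L \<omega>"
  obtain \<xi> where \<xi>: "test_function L \<xi>" "\<And>x. (\<omega> has_vector_derivative \<xi> x) (at x)"
    "\<And>x. vector_derivative \<omega> (at x) = \<xi> x" using test_functionE[OF \<omega>] by metis
  note out = test_function_outside[OF \<omega>] test_function_outside[OF t(1)]
  have i: "integrable (lebesgue_on {0<..<L}) (\<lambda>x. \<eta> x * \<xi> x)" "integrable (lebesgue_on {0<..<L}) (\<lambda>x. \<zeta> x * \<omega> x)"
    by (intro integrable_L2_mult test_function_L2 t \<xi> \<omega>)+
  have "(LINT x|lebesgue_on {0<..<L}. \<eta> x * \<xi> x + \<zeta> x * \<omega> x)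
      = (LINT x|lebesgue_on {0<..<L}. indicator {..L} x *\<^sub>R (\<eta> x * \<xi> x + \<zeta> x * \<omega> x))"
    by (intro Bochner_Integration.integral_cong) auto
  also have "\<dots> = \<eta> L * \<omega> L"
  proof (rule integral_test_deriv)
    show "continuous_on UNIV (\<lambda>x. \<eta> x * \<xi> x + \<zeta> x * \<omega> x)"
      by (intro continuous_intros test_function_continuous[OF t(1)] test_function_continuous[OF t(2)]
          test_function_continuous[OF \<xi>(1)] test_function_continuous[OF \<omega>])
    show "((\<lambda>x. \<eta> x * \<omega> x) has_vector_derivative \<eta> x * \<xi> x + \<zeta> x * \<omega> x) (at x)" for x
      by (rule has_vector_derivative_mult[OF t(3) \<xi>(2)])
  qed (use L out in auto)
  finally show "(LINT x|lebesgue_on {0<..<L}. \<eta> x * vector_derivative \<omega> (at x)) = - (LINT x|lebesgue_on {0<..<L}. \<zeta> x * \<omega> x)"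
    using i out(1)[of L] unfolding \<xi>(3) by (simp add: eq_neg_iff_add_eq_0)
qed

section \<open>The closure of the test functions\<close>

lemma H1_norm_eq: "f \<in> H1 L \<Longrightarrow> H1_norm L f = norm (cls L f, cls L (wderiv L f))"
  by (simp add: H1_norm_def norm_Pair norm_cls H1_L2 wderiv_L2)

lemma H1_norm_diff_test:
  assumes f: "f \<in> H1 L" and t: "test_function L \<eta>" "test_function L \<zeta>"
    "\<And>x. (\<eta> has_vector_derivative \<zeta> x) (at x)" and L: "0 < L"
  shows "H1_norm L (f - \<eta>) = norm ((cls L f, cls L (wderiv L f)) - (cls L \<eta>, cls L \<zeta>))"
proof -
  have "has_weak_deriv L (\<lambda>x. 1 * f x + (- 1) * \<eta> x) (\<lambda>x. 1 * wderiv L f x + (- 1) * \<zeta> x)"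
    by (intro weak_deriv_lincomb H1_wderiv f test_weak_deriv t L)
  then have w: "has_weak_deriv L (f - \<eta>) (\<lambda>x. wderiv L f x - \<zeta> x)" by (simp add: fun_diff_def)
  have L2: "f \<in> L2 L" "wderiv L f \<in> L2 L" "\<eta> \<in> L2 L" "\<zeta> \<in> L2 L"
    using f t by (auto intro: H1_L2 wderiv_L2 test_function_L2)
  show ?thesis
    using L2 by (simp add: H1_norm_eq[OF H1_I[OF w]] cls_wderiv[OF w] cls_diff)
      (simp add: fun_diff_def cls_diff)
qed

text \<open>The form in which the closure is used: identities for a test function and its derivative
  pass to the limit along pairs of classes.\<close>

lemma H1_0_iff:
  assumes L: "0 < L"
  shows "f \<in> H1_0 L \<longleftrightarrow> f \<in> H1 L \<and> (\<exists>\<eta> \<zeta>. (\<forall>n. test_function L (\<eta> n) \<and> test_function L (\<zeta> n) \<and>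
      (\<forall>x. (\<eta> n has_vector_derivative \<zeta> n x) (at x))) \<and>
      (\<lambda>n. (cls L (\<eta> n), cls L (\<zeta> n))) \<longlonglongrightarrow> (cls L f, cls L (wderiv L f)))"
    (is "_ \<longleftrightarrow> _ \<and> ?R")
proof (intro iffI conjI)
  assume f: "f \<in> H1_0 L"
  then show fH: "f \<in> H1 L" by (simp add: H1_0_def)
  have "\<forall>n. \<exists>\<eta> \<zeta>. test_function L \<eta> \<and> test_function L \<zeta> \<and> (\<forall>x. (\<eta> has_vector_derivative \<zeta> x) (at x)) \<and>
      H1_norm L (f - \<eta>) < 1 / real (Suc n)"
  proof
    fix n
    obtain \<eta> where \<eta>: "test_function L \<eta>" "H1_norm L (f - \<eta>) < 1 / real (Suc n)"
      using f unfolding H1_0_def by (auto dest!: spec[of _ "1 / real (Suc n)"])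
    then show "\<exists>\<eta> \<zeta>. test_function L \<eta> \<and> test_function L \<zeta> \<and> (\<forall>x. (\<eta> has_vector_derivative \<zeta> x) (at x)) \<and>
      H1_norm L (f - \<eta>) < 1 / real (Suc n)" by (metis test_functionE)
  qed
  then obtain \<eta> \<zeta> where t: "\<And>n. test_function L (\<eta> n)" "\<And>n. test_function L (\<zeta> n)"
    "\<And>n x. (\<eta> n has_vector_derivative \<zeta> n x) (at x)" and le: "\<And>n. H1_norm L (f - \<eta> n) < 1 / real (Suc n)"
    by metis
  have "(\<lambda>n. (cls L (\<eta> n), cls L (\<zeta> n)) - (cls L f, cls L (wderiv L f))) \<longlonglongrightarrow> 0"
  proof (rule Lim_null_comparison[OF always_eventually LIMSEQ_inverse_real_of_nat], rule allI)
    fix n show "norm ((cls L (\<eta> n), cls L (\<zeta> n)) - (cls L f, cls L (wderiv L f))) \<le> inverse (real (Suc n))"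
      using le[of n] H1_norm_diff_test[OF fH t(1)[of n] t(2)[of n] t(3)[of n] L]
      by (simp add: norm_minus_commute inverse_eq_divide del: diff_Pair)
  qed
  then show ?R using t LIM_zero_iff by blast
next
  assume *: "f \<in> H1 L \<and> ?R"
  then obtain \<eta> \<zeta> where t: "\<And>n. test_function L (\<eta> n)" "\<And>n. test_function L (\<zeta> n)"
    "\<And>n x. (\<eta> n has_vector_derivative \<zeta> n x) (at x)"
    and lim: "(\<lambda>n. (cls L (\<eta> n), cls L (\<zeta> n))) \<longlonglongrightarrow> (cls L f, cls L (wderiv L f))" by auto
  show "f \<in> H1_0 L" unfolding H1_0_def
  proof (intro CollectI conjI allI impI)
    fix e :: real assume "0 < e"
    then obtain n where "dist (cls L (\<eta> n), cls L (\<zeta> n)) (cls L f, cls L (wderiv L f)) < e"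
      using lim unfolding LIMSEQ_iff_nz lim_sequentially by blast
    then show "\<exists>\<eta>. test_function L \<eta> \<and> H1_norm L (f - \<eta>) < e"
      using t * by (intro exI[of _ "\<eta> n"]) (simp add: H1_norm_diff_test[OF _ t L] dist_norm norm_minus_commute del: diff_Pair)
  qed (use * in auto)
qed

lemma H1_0_E:
  assumes "f \<in> H1_0 L" "0 < L"
  obtains \<eta> \<zeta> where "\<And>n. test_function L (\<eta> n)" "\<And>n. test_function L (\<zeta> n)"
    "\<And>n x. (\<eta> n has_vector_derivative \<zeta> n x) (at x)"
    "(\<lambda>n. cls L (\<eta> n)) \<longlonglongrightarrow> cls L f" "(\<lambda>n. cls L (\<zeta> n)) \<longlonglongrightarrow> cls L (wderiv L f)"
proof -
  obtain \<eta> \<zeta> where t: "\<And>n. test_function L (\<eta> n)" "\<And>n. test_function L (\<zeta> n)"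
    "\<And>n x. (\<eta> n has_vector_derivative \<zeta> n x) (at x)"
    and lim: "(\<lambda>n. (cls L (\<eta> n), cls L (\<zeta> n))) \<longlonglongrightarrow> (cls L f, cls L (wderiv L f))"
    using assms(1) unfolding H1_0_iff[OF assms(2)] by blast
  from that[OF t] tendsto_fst[OF lim] tendsto_snd[OF lim] show ?thesis by simp
qed

lemma H1_0_H1: "f \<in> H1_0 L \<Longrightarrow> f \<in> H1 L"
  by (simp add: H1_0_def)

lemma H1_0_lincomb:
  assumes f: "f \<in> H1_0 L" and g: "g \<in> H1_0 L" and L: "0 < L"
  shows "(\<lambda>x. c * f x + d * g x) \<in> H1_0 L"
proof -
  have H: "f \<in> H1 L" "g \<in> H1 L" using f g H1_0_H1 by auto
  obtain \<eta> \<zeta> where t: "\<And>n. test_function L (\<eta> n)" "\<And>n. test_function L (\<zeta> n)"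
    "\<And>n x. (\<eta> n has_vector_derivative \<zeta> n x) (at x)"
    and l: "(\<lambda>n. cls L (\<eta> n)) \<longlonglongrightarrow> cls L f" "(\<lambda>n. cls L (\<zeta> n)) \<longlonglongrightarrow> cls L (wderiv L f)"
    using H1_0_E[OF f L] by blast
  obtain \<eta>' \<zeta>' where t': "\<And>n. test_function L (\<eta>' n)" "\<And>n. test_function L (\<zeta>' n)"
    "\<And>n x. (\<eta>' n has_vector_derivative \<zeta>' n x) (at x)"
    and l': "(\<lambda>n. cls L (\<eta>' n)) \<longlonglongrightarrow> cls L g" "(\<lambda>n. cls L (\<zeta>' n)) \<longlonglongrightarrow> cls L (wderiv L g)"
    using H1_0_E[OF g L] by blast
  have lin: "(\<lambda>n. cls L (\<lambda>x. c * a n x + d * b n x)) \<longlonglongrightarrow> cls L (\<lambda>x. c * u x + d * w x)"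
    if "(\<lambda>n. cls L (a n)) \<longlonglongrightarrow> cls L u" "(\<lambda>n. cls L (b n)) \<longlonglongrightarrow> cls L w"
      "\<And>n. a n \<in> L2 L" "\<And>n. b n \<in> L2 L" "u \<in> L2 L" "w \<in> L2 L" for a b u w
    using that by (simp add: cls_add L2_cmult) (intro tendsto_add cls_cmult_tendsto)
  have "test_function L (\<lambda>x. c * \<eta> n x + d * \<eta>' n x) \<and> test_function L (\<lambda>x. c * \<zeta> n x + d * \<zeta>' n x) \<and>
      (\<forall>x. ((\<lambda>x. c * \<eta> n x + d * \<eta>' n x) has_vector_derivative c * \<zeta> n x + d * \<zeta>' n x) (at x))" for n
    by (intro conjI allI test_function_lincomb t t' has_vector_derivative_add has_vector_derivative_mult_right)
  moreover have "(\<lambda>n. (cls L (\<lambda>x. c * \<eta> n x + d * \<eta>' n x), cls L (\<lambda>x. c * \<zeta> n x + d * \<zeta>' n x))) \<longlonglongrightarrow>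
      (cls L (\<lambda>x. c * f x + d * g x), cls L (wderiv L (\<lambda>x. c * f x + d * g x)))"
    unfolding cls_wderiv_lincomb[OF H]
    using H t t' l l' by (intro tendsto_Pair lin) (auto intro: test_function_L2 H1_L2 wderiv_L2)
  ultimately show ?thesis
    unfolding H1_0_iff[OF L] using H1_lincomb[OF H]
    by (intro conjI exI[of _ "\<lambda>n x. c * \<eta> n x + d * \<eta>' n x"] exI[of _ "\<lambda>n x. c * \<zeta> n x + d * \<zeta>' n x"]) auto
qed

lemma prim_wderiv:
  assumes f: "f \<in> H1_0 L" and L: "0 < L" shows "prim L (cls L (wderiv L f)) = cls L f"
proof -
  obtain \<eta> \<zeta> where t: "\<And>n. test_function L (\<eta> n)" "\<And>n. test_function L (\<zeta> n)"
    "\<And>n x. (\<eta> n has_vector_derivative \<zeta> n x) (at x)"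
    and l: "(\<lambda>n. cls L (\<eta> n)) \<longlonglongrightarrow> cls L f" "(\<lambda>n. cls L (\<zeta> n)) \<longlonglongrightarrow> cls L (wderiv L f)"
    using H1_0_E[OF f L] by blast
  have "(\<lambda>n. prim L (cls L (\<zeta> n))) \<longlonglongrightarrow> prim L (cls L (wderiv L f))"
    by (rule bounded_linear.tendsto[OF bounded_linear_prim l(2)]) (use L in simp)
  then have "(\<lambda>n. cls L (\<eta> n)) \<longlonglongrightarrow> prim L (cls L (wderiv L f))" by (simp add: prim_test[OF t])
  then show ?thesis using l(1) LIMSEQ_unique by blast
qed

lemma weak_ibp:
  assumes f: "f \<in> H1_0 L" and g: "g \<in> H1 L" and L: "0 < L"
  shows "inner (cls L (wderiv L f)) (cls L g) = - inner (cls L f) (cls L (wderiv L g))"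
proof -
  obtain \<eta> \<zeta> where t: "\<And>n. test_function L (\<eta> n)" "\<And>n. test_function L (\<zeta> n)"
    "\<And>n x. (\<eta> n has_vector_derivative \<zeta> n x) (at x)"
    and l: "(\<lambda>n. cls L (\<eta> n)) \<longlonglongrightarrow> cls L f" "(\<lambda>n. cls L (\<zeta> n)) \<longlonglongrightarrow> cls L (wderiv L f)"
    using H1_0_E[OF f L] by blast
  have "inner (cls L (\<zeta> n)) (cls L g) = - inner (cls L (\<eta> n)) (cls L (wderiv L g))" for n
    using weak_deriv_inner[OF H1_wderiv[OF g] t] by (simp add: inner_commute)
  moreover have "(\<lambda>n. inner (cls L (\<zeta> n)) (cls L g)) \<longlonglongrightarrow> inner (cls L (wderiv L f)) (cls L g)"
    "(\<lambda>n. - inner (cls L (\<eta> n)) (cls L (wderiv L g))) \<longlonglongrightarrow> - inner (cls L f) (cls L (wderiv L g))"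
    by (intro tendsto_intros l)+
  ultimately show ?thesis using LIMSEQ_unique by simp
qed

section \<open>Mean values and pairings with primitives\<close>

lemma mean_le:
  assumes f: "f \<in> L2 L"
  shows "cmod (LINT x|lebesgue_on {0<..<L}. f x) \<le> sqrt (measure lebesgue {0<..<L}) * norm (cls L f)"
proof -
  have "(LINT x|lebesgue_on {0<..<L}. f x) = (LINT x|lebesgue. indicator {0<..<L} x *\<^sub>R f x)"
    by (subst integral_restrict_space) auto
  also have "\<dots> = (LINT x|lebesgue. indicator {0<..<L} x *\<^sub>R ext L f x)"
    by (intro Bochner_Integration.integral_cong) (auto simp: ext_def indicator_def)
  finally show ?thesis
    using norm_integral_indicator_le[OF lmeasurable_Ioo ext_square_integrable[OF f], of 0 L] by (simp add: cls_def)
qed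

lemma mean_tendsto:
  assumes "\<And>n. f n \<in> L2 L" "g \<in> L2 L" "(\<lambda>n. cls L (f n)) \<longlonglongrightarrow> cls L g"
  shows "(\<lambda>n. LINT x|lebesgue_on {0<..<L}. f n x) \<longlonglongrightarrow> (LINT x|lebesgue_on {0<..<L}. g x)"
proof -
  let ?s = "sqrt (measure lebesgue {0<..<L})"
  have "cmod ((LINT x|lebesgue_on {0<..<L}. f n x) - (LINT x|lebesgue_on {0<..<L}. g x))
      \<le> ?s * norm (cls L (f n) - cls L g)" for n
    using mean_le[OF L2_diff[OF assms(1)[of n] assms(2)]] assms
    by (simp add: cls_diff integrable_L2)
  moreover have "(\<lambda>n. ?s * norm (cls L (f n) - cls L g)) \<longlonglongrightarrow> ?s * norm (cls L g - cls L g)"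
    by (intro tendsto_intros assms)
  then have "(\<lambda>n. ?s * norm (cls L (f n) - cls L g)) \<longlonglongrightarrow> 0" by simp
  ultimately show ?thesis
    unfolding Lim_null[of _ "LINT x|lebesgue_on {0<..<L}. g x"]
    by (rule Lim_null_comparison[OF always_eventually[OF allI]])
qed

text \<open>This keeps the momentum components of \<open>A1\<close> in the space of zero
  mean.\<close>

lemma mean_wderiv:
  assumes f: "f \<in> H1_0 L" and L: "0 < L" shows "(LINT x|lebesgue_on {0<..<L}. wderiv L f x) = 0"
proof -
  obtain \<eta> \<zeta> where t: "\<And>n. test_function L (\<eta> n)" "\<And>n. test_function L (\<zeta> n)"
    "\<And>n x. (\<eta> n has_vector_derivative \<zeta> n x) (at x)"
    and l: "(\<lambda>n. cls L (\<eta> n)) \<longlonglongrightarrow> cls L f" "(\<lambda>n. cls L (\<zeta> n)) \<longlonglongrightarrow> cls L (wderiv L f)"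
    using H1_0_E[OF f L] by blast
  have "(\<lambda>n. LINT x|lebesgue_on {0<..<L}. \<zeta> n x) \<longlonglongrightarrow> (LINT x|lebesgue_on {0<..<L}. wderiv L f x)"
    by (rule mean_tendsto) (use t l f in \<open>auto intro: test_function_L2 wderiv_L2 H1_0_H1\<close>)
  then show ?thesis
    using integral_test_deriv_0[OF t] L by (simp add: LIMSEQ_const_iff)
qed

lemma test_function_mean_one:
  assumes L: "0 < L"
  obtains \<eta> where "test_function L \<eta>" "(LINT x|lebesgue_on {0<..<L}. \<eta> x) = 1"
proof -
  have "\<exists>\<eta>. test_function L \<eta> \<and> (LINT x|lebesgue_on {0<..<L}. \<eta> x) \<noteq> 0"
  proof (rule ccontr)
    assume "\<not> ?thesis"
    then have z: "\<And>\<eta>. test_function L \<eta> \<Longrightarrow> (LINT x|lebesgue_on {0<..<L}. \<eta> x) = 0" by auto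
    have one: "(\<lambda>x. 1) \<in> L2 L" by (rule L2_bounded[of _ _ 1]) auto
    obtain \<eta> where \<eta>: "\<And>n. test_function L (\<eta> n)" "(\<lambda>n. cls L (\<eta> n)) \<longlonglongrightarrow> cls L (\<lambda>x. 1)"
      using tests_denseE[OF one] by blast
    have "(\<lambda>n. LINT x|lebesgue_on {0<..<L}. \<eta> n x) \<longlonglongrightarrow> (LINT x|lebesgue_on {0<..<L}. 1)"
      by (rule mean_tendsto) (use \<eta> one in \<open>auto intro: test_function_L2\<close>)
    then have "(LINT x|lebesgue_on {0<..<L}. 1 :: complex) = 0" using z[OF \<eta>(1)] by (simp add: LIMSEQ_const_iff)
    then show False using L by (simp add: measure_restrict_space)
  qed
  then obtain \<eta> where \<eta>: "test_function L \<eta>" "(LINT x|lebesgue_on {0<..<L}. \<eta> x) \<noteq> 0" by auto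
  then show ?thesis
    using that[OF test_function_cmult[OF \<eta>(1), of "1 / (LINT x|lebesgue_on {0<..<L}. \<eta> x)"]] by simp
qed

text \<open>Test functions approximating \<open>h\<close> are corrected by multiples of a fixed one
  of mean 1, so that they have mean zero. Their primitives are then test functions, and the
  definition of the weak derivative of \<open>g\<close> applies. The corrections vanish in the limit
  because \<open>h\<close> has mean zero.\<close>

lemma weak_ibp_prim:
  assumes g: "g \<in> H1 L" and h: "h \<in> L2_star L" and L: "0 < L"
  shows "inner (cls L (wderiv L g)) (prim L (cls L h)) = - inner (cls L g) (cls L h)"
proof -
  let ?I = "\<lambda>f. LINT x|lebesgue_on {0<..<L}. f x"
  have hL: "h \<in> L2 L" and mean: "?I h = 0" using h by (auto simp: L2_star_def)
  obtain \<eta> where \<eta>: "\<And>n. test_function L (\<eta> n)" "(\<lambda>n. cls L (\<eta> n)) \<longlonglongrightarrow> cls L h"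
    using tests_denseE[OF hL] by blast
  obtain \<omega> where \<omega>: "test_function L \<omega>" "?I \<omega> = 1" using test_function_mean_one[OF L] by blast
  have \<omega>L: "\<omega> \<in> L2 L" and \<eta>L: "\<And>n. \<eta> n \<in> L2 L" using \<omega> \<eta> test_function_L2 by auto
  define \<zeta> where "\<zeta> n x = 1 * \<eta> n x + (- ?I (\<eta> n)) * \<omega> x" for n x
  have \<zeta>: "test_function L (\<zeta> n)" for n unfolding \<zeta>_def by (intro test_function_lincomb \<eta> \<omega>)
  have m\<zeta>: "?I (\<zeta> n) = 0" for n
    unfolding \<zeta>_def using \<omega> \<eta>L \<omega>L by (simp add: integrable_L2 L2_cmult)
  have "(\<lambda>n. ?I (\<eta> n)) \<longlonglongrightarrow> 0" using mean_tendsto[OF \<eta>L hL \<eta>(2)] mean by simp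
  then have "(\<lambda>n. cmod (?I (\<eta> n)) * norm (cls L \<omega>)) \<longlonglongrightarrow> cmod 0 * norm (cls L \<omega>)"
    by (intro tendsto_intros)
  then have lim0: "(\<lambda>n. cmod (?I (\<eta> n)) * norm (cls L \<omega>)) \<longlonglongrightarrow> 0" by simp
  have "norm (cls L (\<lambda>x. (- ?I (\<eta> n)) * \<omega> x)) = cmod (?I (\<eta> n)) * norm (cls L \<omega>)" for n
    by (simp add: norm_cls \<omega>L L2_cmult[OF \<omega>L, of "- ?I (\<eta> n)", simplified] L2_norm_def norm_mult power_mult_distrib real_sqrt_mult)
  then have "(\<lambda>n. cls L (\<lambda>x. (- ?I (\<eta> n)) * \<omega> x)) \<longlonglongrightarrow> 0"
    by (subst tendsto_norm_zero_iff[symmetric]) (simp only: lim0)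
  note sum = tendsto_add[OF \<eta>(2) this]
  have \<zeta>lim: "(\<lambda>n. cls L (\<zeta> n)) \<longlonglongrightarrow> cls L h"
  proof -
    have "\<zeta> n = (\<lambda>x. \<eta> n x + (- ?I (\<eta> n)) * \<omega> x)" for n by (simp add: \<zeta>_def fun_eq_iff)
    then have "cls L (\<zeta> n) = cls L (\<eta> n) + cls L (\<lambda>x. (- ?I (\<eta> n)) * \<omega> x)" for n
      by (simp only: cls_add[OF \<eta>L L2_cmult[OF \<omega>L]])
    then show ?thesis using sum by (simp only: add_0_right)
  qed
  have eq: "inner (cls L (wderiv L g)) (prim L (cls L (\<zeta> n))) = - inner (cls L g) (cls L (\<zeta> n))" for n
  proof -
    obtain \<xi> where \<xi>: "test_function L \<xi>" "\<And>x. (\<xi> has_vector_derivative \<zeta> n x) (at x)"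
      using test_function_primitive[OF \<zeta> L m\<zeta>] by blast
    show ?thesis
      using weak_deriv_inner[OF H1_wderiv[OF g] \<xi>(1) \<zeta> \<xi>(2)] by (simp add: prim_test[OF \<xi>(1) \<zeta> \<xi>(2)])
  qed
  have "(\<lambda>n. inner (cls L (wderiv L g)) (prim L (cls L (\<zeta> n)))) \<longlonglongrightarrow> inner (cls L (wderiv L g)) (prim L (cls L h))"
    by (intro tendsto_intros bounded_linear.tendsto[OF bounded_linear_prim \<zeta>lim]) (use L in simp)
  moreover have "(\<lambda>n. - inner (cls L g) (cls L (\<zeta> n))) \<longlonglongrightarrow> - inner (cls L g) (cls L h)"
    by (intro tendsto_intros \<zeta>lim)
  ultimately show ?thesis unfolding eq using LIMSEQ_unique by blast
qed

section \<open>Decay of the beam semigroup\<close>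

text \<open>The quantities whose squares make up the energy. States with the same image are exactly
  those at energy distance 0, so the image models the quotient space.\<close>

definition obs :: "real \<Rightarrow> state \<Rightarrow> l2 vec9" where
  "obs L = (\<lambda>(u, v, \<phi>, \<Phi>, \<psi>, \<Psi>, \<theta>, q).
     (cls L v, cls L (wderiv L u), cls L \<Phi>, cls L \<Psi>, cls L (wderiv L \<psi>), cls L (\<lambda>x. \<phi> x - u x),
      cls L (\<lambda>x. wderiv L \<phi> x + \<psi> x), cls L \<theta>, cls L q))"

lemma L2_star_lincomb:
  "\<lbrakk>f \<in> L2_star L; g \<in> L2_star L\<rbrakk> \<Longrightarrow> (\<lambda>x. c * f x + d * g x) \<in> L2_star L"
  by (simp add: L2_star_def L2_add L2_cmult integrable_L2)

lemma H1_star_lincomb: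
  "\<lbrakk>f \<in> H1_star L; g \<in> H1_star L\<rbrakk> \<Longrightarrow> (\<lambda>x. c * f x + d * g x) \<in> H1_star L"
  by (simp add: H1_star_def L2_star_lincomb H1_lincomb)

lemma L2_lincomb: "\<lbrakk>f \<in> L2 L; g \<in> L2 L\<rbrakk> \<Longrightarrow> (\<lambda>x. c * f x + d * g x) \<in> L2 L"
  by (intro L2_add L2_cmult)

lemma cls_lincomb:
  "\<lbrakk>f \<in> L2 L; g \<in> L2 L\<rbrakk> \<Longrightarrow> cls L (\<lambda>x. of_real c * f x + of_real d * g x) = c *\<^sub>R cls L f + d *\<^sub>R cls L g"
  by (simp add: cls_add L2_cmult cls_scaleR)

lemma cls_wderiv_lincomb_real:
  "\<lbrakk>f \<in> H1 L; g \<in> H1 L\<rbrakk> \<Longrightarrow> cls L (wderiv L (\<lambda>x. of_real c * f x + of_real d * g x))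
     = c *\<^sub>R cls L (wderiv L f) + d *\<^sub>R cls L (wderiv L g)"
  by (simp add: cls_wderiv_lincomb cls_lincomb wderiv_L2)

lemma state_lincomb:
  "scale_state c (u, v, \<phi>, \<Phi>, \<psi>, \<Psi>, \<theta>, q) + scale_state d (u', v', \<phi>', \<Phi>', \<psi>', \<Psi>', \<theta>', q')
   = (\<lambda>x. c * u x + d * u' x, \<lambda>x. c * v x + d * v' x, \<lambda>x. c * \<phi> x + d * \<phi>' x, \<lambda>x. c * \<Phi> x + d * \<Phi>' x,
      \<lambda>x. c * \<psi> x + d * \<psi>' x, \<lambda>x. c * \<Psi> x + d * \<Psi>' x, \<lambda>x. c * \<theta> x + d * \<theta>' x, \<lambda>x. c * q x + d * q' x)"
  by (simp add: plus_fun_def)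

lemma state_cases:
  fixes U :: state
  obtains u v \<phi> \<Phi> \<psi> \<Psi> \<theta> q where "U = (u, v, \<phi>, \<Phi>, \<psi>, \<Psi>, \<theta>, q)"
  by (metis prod.collapse)

lemma state_diff: "U - V = scale_state 1 U + scale_state (- 1) V" for U V :: state
  by (cases U rule: state_cases, cases V rule: state_cases) (simp add: plus_fun_def fun_diff_def)

lemma scale_state_eq_lincomb: "scale_state c U = scale_state c U + scale_state 0 U"
  by (cases U rule: state_cases) (simp add: plus_fun_def)

lemma state_space_lincomb:
  assumes "U \<in> state_space L" "V \<in> state_space L" "0 < L"
  shows "scale_state c U + scale_state d V \<in> state_space L"
  using assms by (cases U rule: state_cases, cases V rule: state_cases)
    (simp only: state_space_def mem_Sigma_iff state_lincomb,
      blast intro: L2_star_lincomb H1_star_lincomb L2_lincomb H1_0_lincomb)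

lemma obs_lincomb:
  assumes "U \<in> state_space L" "V \<in> state_space L"
  shows "obs L (scale_state (of_real c) U + scale_state (of_real d) V) = c *\<^sub>R obs L U + d *\<^sub>R obs L V"
proof -
  obtain u v \<phi> \<Phi> \<psi> \<Psi> \<theta> q where U: "U = (u, v, \<phi>, \<Phi>, \<psi>, \<Psi>, \<theta>, q)" by (rule state_cases)
  obtain u' v' \<phi>' \<Phi>' \<psi>' \<Psi>' \<theta>' q' where V: "V = (u', v', \<phi>', \<Phi>', \<psi>', \<Psi>', \<theta>', q')" by (rule state_cases)
  have m: "u \<in> H1 L" "v \<in> L2 L" "\<phi> \<in> H1 L" "\<Phi> \<in> L2 L" "\<psi> \<in> H1 L" "\<Psi> \<in> L2 L" "\<theta> \<in> L2 L" "q \<in> L2 L"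
    "u' \<in> H1 L" "v' \<in> L2 L" "\<phi>' \<in> H1 L" "\<Phi>' \<in> L2 L" "\<psi>' \<in> H1 L" "\<Psi>' \<in> L2 L" "\<theta>' \<in> L2 L" "q' \<in> L2 L"
    using assms by (auto simp: U V state_space_def H1_star_def L2_star_def H1_0_def)
  note mL = H1_L2[OF m(1)] H1_L2[OF m(3)] H1_L2[OF m(5)] H1_L2[OF m(9)] H1_L2[OF m(11)] H1_L2[OF m(13)]
    wderiv_L2[OF m(1)] wderiv_L2[OF m(3)] wderiv_L2[OF m(5)] wderiv_L2[OF m(9)] wderiv_L2[OF m(11)] wderiv_L2[OF m(13)]
  have "cls L (\<lambda>x. (of_real c * \<phi> x + of_real d * \<phi>' x) - (of_real c * u x + of_real d * u' x))
      = c *\<^sub>R cls L (\<lambda>x. \<phi> x - u x) + d *\<^sub>R cls L (\<lambda>x. \<phi>' x - u' x)"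
    using mL by (simp add: cls_diff L2_lincomb cls_lincomb scaleR_diff_right)
  moreover have "cls L (\<lambda>x. wderiv L (\<lambda>x. of_real c * \<phi> x + of_real d * \<phi>' x) x + (of_real c * \<psi> x + of_real d * \<psi>' x))
      = c *\<^sub>R cls L (\<lambda>x. wderiv L \<phi> x + \<psi> x) + d *\<^sub>R cls L (\<lambda>x. wderiv L \<phi>' x + \<psi>' x)"
    using mL m wderiv_L2[OF H1_lincomb[OF m(3,11)]]
    by (simp add: cls_add L2_lincomb cls_lincomb cls_wderiv_lincomb_real scaleR_add_right)
  ultimately show ?thesis
    using m by (simp add: U V state_lincomb obs_def cls_lincomb cls_wderiv_lincomb_real del: scale_state.simps)
qed

lemma A1_state_space:
  assumes "U \<in> dom_A1 L" "0 < L"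
  shows "A1 L \<rho> \<rho>\<^sub>1 \<rho>\<^sub>2 \<rho>\<^sub>3 \<alpha> \<kappa> b \<tau> \<sigma> \<beta> \<gamma> m U \<in> state_space L"
proof -
  obtain u v \<phi> \<Phi> \<psi> \<Psi> \<theta> q where U: "U = (u, v, \<phi>, \<Phi>, \<psi>, \<Psi>, \<theta>, q)" by (rule state_cases)
  have dom: "u \<in> H1_star L" "v \<in> H1_star L" "\<phi> \<in> H1_star L" "\<Phi> \<in> H1_star L" "\<psi> \<in> H1_0 L" "\<Psi> \<in> H1_0 L"
    "\<theta> \<in> H1_0 L" "q \<in> H1 L" "wderiv L u \<in> H1_0 L" "wderiv L \<phi> \<in> H1_0 L" "wderiv L \<psi> \<in> H1 L"
    using assms(1) by (auto simp: U dom_A1_def state_space_def H2_def)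
  have s: "(\<lambda>x. wderiv L \<phi> x + \<psi> x) \<in> H1_0 L" using H1_0_lincomb[OF dom(10,5) assms(2), of 1 1] by simp
  have w_star: "wderiv L f \<in> L2_star L" if "f \<in> H1_0 L" for f
    using that mean_wderiv[OF that assms(2)] by (simp add: L2_star_def wderiv_L2 H1_0_H1)
  have star: "u \<in> L2_star L" "v \<in> L2_star L" "\<phi> \<in> L2_star L" using dom by (auto simp: H1_star_def)
  have L2: "\<phi> \<in> L2 L" "\<psi> \<in> L2 L" "\<theta> \<in> L2 L" "q \<in> L2 L" "\<Psi> \<in> L2 L" "wderiv L (wderiv L \<psi>) \<in> L2 L" "wderiv L \<phi> \<in> L2 L"
    "wderiv L q \<in> L2 L" "wderiv L \<Phi> \<in> L2 L" "wderiv L \<theta> \<in> L2 L"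
    using dom by (auto intro: H1_L2 wderiv_L2 H1_0_H1 simp: H1_star_def)
  \<comment> \<open>The factors 1 and the summand with factor 0 give every layer the shape
    \<open>c * f x + d * g x\<close> of \<open>L2_star_lincomb\<close>.\<close>
  have "(\<lambda>x. of_real (1 / \<rho>) * (1 * (of_real \<alpha> * wderiv L (wderiv L u) x + of_real \<beta> * (1 * \<phi> x + (- 1) * u x)) + of_real (- \<gamma>) * v x)
      + 0 * v x) \<in> L2_star L"
    by (intro L2_star_lincomb star w_star dom)
  then have 2: "(\<lambda>x. (\<alpha> * wderiv L (wderiv L u) x + \<beta> * (\<phi> x - u x) - \<gamma> * v x) / \<rho>) \<in> L2_star L"
    by (simp add: divide_inverse mult.commute)
  have "(\<lambda>x. of_real (1 / \<rho>\<^sub>1) * (1 * (of_real \<kappa> * wderiv L (\<lambda>y. wderiv L \<phi> y + \<psi> y) x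
      + of_real (- \<beta>) * (1 * \<phi> x + (- 1) * u x)) + of_real (- m) * wderiv L \<theta> x) + 0 * v x) \<in> L2_star L"
    by (intro L2_star_lincomb star w_star dom s)
  then have 4: "(\<lambda>x. (\<kappa> * wderiv L (\<lambda>y. wderiv L \<phi> y + \<psi> y) x - \<beta> * (\<phi> x - u x) - m * wderiv L \<theta> x) / \<rho>\<^sub>1) \<in> L2_star L"
    by (simp add: divide_inverse mult.commute)
  have "(\<lambda>x. of_real (1 / \<rho>\<^sub>2) * (1 * (of_real b * wderiv L (wderiv L \<psi>) x
      + of_real (- \<kappa>) * (1 * wderiv L \<phi> x + 1 * \<psi> x)) + of_real m * \<theta> x) + 0 * q x) \<in> L2 L"
    by (intro L2_lincomb L2)
  then have 6: "(\<lambda>x. (b * wderiv L (wderiv L \<psi>) x - \<kappa> * (wderiv L \<phi> x + \<psi> x) + m * \<theta> x) / \<rho>\<^sub>2) \<in> L2 L"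
    by (simp add: divide_inverse mult.commute)
  have "(\<lambda>x. of_real (1 / \<rho>\<^sub>3) * ((- 1) * wderiv L q x + of_real (- m) * (1 * wderiv L \<Phi> x + 1 * \<Psi> x)) + 0 * q x) \<in> L2 L"
    by (intro L2_lincomb L2)
  then have 7: "(\<lambda>x. (- wderiv L q x - m * (wderiv L \<Phi> x + \<Psi> x)) / \<rho>\<^sub>3) \<in> L2 L"
    by (simp add: divide_inverse mult.commute)
  have "(\<lambda>x. of_real (1 / \<tau>) * (of_real (- \<sigma>) * q x + (- 1) * wderiv L \<theta> x) + 0 * q x) \<in> L2 L"
    by (intro L2_lincomb L2)
  then have 8: "(\<lambda>x. (- \<sigma> * q x - wderiv L \<theta> x) / \<tau>) \<in> L2 L"
    by (simp add: divide_inverse mult.commute)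
  show ?thesis unfolding U A1.simps state_space_def using dom 2 4 6 7 8 by simp
qed

section \<open>Domain states as solutions of the abstract equations\<close>

locale beam_state = coupled_beam \<rho> \<rho>\<^sub>1 \<rho>\<^sub>2 \<rho>\<^sub>3 \<alpha> \<kappa> b \<tau> \<sigma> \<beta> \<gamma> m "prim L"
  for \<rho> \<rho>\<^sub>1 \<rho>\<^sub>2 \<rho>\<^sub>3 \<alpha> \<kappa> b \<tau> \<sigma> \<beta> \<gamma> m L +
  assumes L: "L > 0"
begin

abbreviation "SN \<equiv> state_norm L \<rho> \<rho>\<^sub>1 \<rho>\<^sub>2 \<rho>\<^sub>3 \<alpha> \<kappa> b \<tau> \<beta>"
abbreviation "AA \<equiv> A1 L \<rho> \<rho>\<^sub>1 \<rho>\<^sub>2 \<rho>\<^sub>3 \<alpha> \<kappa> b \<tau> \<sigma> \<beta> \<gamma> m"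

lemma state_norm_obs:
  assumes "U \<in> state_space L" shows "SN U = sqrt (en (obs L U) (obs L U))"
proof -
  obtain u v \<phi> \<Phi> \<psi> \<Psi> \<theta> q where U: "U = (u, v, \<phi>, \<Phi>, \<psi>, \<Psi>, \<theta>, q)" by (rule state_cases)
  have m: "u \<in> H1 L" "v \<in> L2 L" "\<phi> \<in> H1 L" "\<Phi> \<in> L2 L" "\<psi> \<in> H1 L" "\<Psi> \<in> L2 L" "\<theta> \<in> L2 L" "q \<in> L2 L"
    using assms by (auto simp: U state_space_def H1_star_def L2_star_def H1_0_def)
  have L2: "(\<lambda>x. \<phi> x - u x) \<in> L2 L" "(\<lambda>x. wderiv L \<phi> x + \<psi> x) \<in> L2 L"
    by (intro L2_diff L2_add H1_L2 wderiv_L2 m)+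
  show ?thesis
    using m L2 by (simp add: U obs_def en_def wderiv_L2 norm_cls[symmetric] power2_norm_eq_inner)
qed

text \<open>Integrations by parts use that u_x, \<psi>, \<Psi>, \<theta> and s vanish at the ends in
  the sense of \<open>H1_0\<close>; the two pairings with the primitive of \<Phi> use its zero mean
  instead.\<close>

lemma config_obs:
  assumes "U \<in> dom_A1 L" shows "config (obs L U) (obs L (AA U))"
proof -
  obtain u v \<phi> \<Phi> \<psi> \<Psi> \<theta> q where U: "U = (u, v, \<phi>, \<Phi>, \<psi>, \<Psi>, \<theta>, q)" by (rule state_cases)
  have dom: "u \<in> H1_star L" "v \<in> H1_star L" "\<phi> \<in> H1_star L" "\<Phi> \<in> H1_star L" "\<psi> \<in> H1_0 L" "\<Psi> \<in> H1_0 L"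
    "\<theta> \<in> H1_0 L" "q \<in> H1 L" "wderiv L u \<in> H1_0 L" "wderiv L \<phi> \<in> H1_0 L" "wderiv L \<psi> \<in> H1 L"
    using assms(1) by (auto simp: U dom_A1_def state_space_def H2_def)
  have H: "u \<in> H1 L" "v \<in> H1 L" "\<phi> \<in> H1 L" "\<Phi> \<in> H1 L" "\<psi> \<in> H1 L" "\<Psi> \<in> H1 L"
    "\<theta> \<in> H1 L" "wderiv L u \<in> H1 L" "wderiv L \<phi> \<in> H1 L"
    using dom by (auto simp: H1_star_def intro: H1_0_H1)
  have star: "v \<in> L2_star L" "\<Phi> \<in> L2_star L" using dom by (auto simp: H1_star_def)
  define s z where "s = (\<lambda>x. wderiv L \<phi> x + \<psi> x)" and "z = (\<lambda>x. \<phi> x - u x)"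
  have s: "s \<in> H1_0 L" using H1_0_lincomb[OF dom(10,5) L, of 1 1] by (simp add: s_def)
  have z: "z \<in> H1 L" using H1_lincomb[OF H(3,1), of 1 "-1"] by (simp add: z_def)
  note mem = H1_L2[OF H(1)] H1_L2[OF H(2)] H1_L2[OF H(3)] H1_L2[OF H(4)] H1_L2[OF H(5)] H1_L2[OF H(6)]
    H1_L2[OF H(7)] H1_L2[OF dom(8)] H1_L2[OF z] H1_L2[OF H1_0_H1[OF s]]
    wderiv_L2[OF H(1)] wderiv_L2[OF H(2)] wderiv_L2[OF H(3)] wderiv_L2[OF H(4)] wderiv_L2[OF H(5)]
    wderiv_L2[OF H(6)] wderiv_L2[OF H(7)] wderiv_L2[OF dom(8)] wderiv_L2[OF z] wderiv_L2[OF H1_0_H1[OF s]]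
    wderiv_L2[OF H(8)] wderiv_L2[OF H(9)] wderiv_L2[OF dom(11)]
  have cs: "cls L s = cls L (wderiv L \<phi>) + cls L \<psi>" unfolding s_def using mem by (simp add: cls_add)
  have wz: "cls L (wderiv L z) = cls L (wderiv L \<phi>) - cls L (wderiv L u)"
    using cls_wderiv_lincomb_real[OF H(3,1), of 1 "-1"] by (simp add: z_def)
  have pp: "prim L (cls L (wderiv L \<psi>)) = cls L \<psi>" by (rule prim_wderiv[OF dom(5) L])
  have zx: "cls L s - prim L (cls L (wderiv L \<psi>)) - cls L (wderiv L u) = cls L (wderiv L z)"
    unfolding pp cs wz by simp
  have \<Phi>x: "cls L (\<lambda>x. wderiv L \<Phi> x + \<Psi> x) - cls L \<Psi> = cls L (wderiv L \<Phi>)"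
    using mem by (simp add: cls_add)
  have scaled: "r *\<^sub>R cls L (\<lambda>x. f x / of_real r) = cls L f" if "r > 0" "f \<in> L2 L" for r f
    using that L2_cmult[OF that(2), of "1 / of_real r"]
    by (simp add: cls_scaleR[symmetric])
  note lin = cls_add cls_diff cls_scaleR L2_add L2_diff L2_cmult
  have eqs: 
    "\<rho> *\<^sub>R cls L (\<lambda>x. (\<alpha> * wderiv L (wderiv L u) x + \<beta> * z x - \<gamma> * v x) / \<rho>)
      = \<alpha> *\<^sub>R cls L (wderiv L (wderiv L u)) + \<beta> *\<^sub>R cls L z - \<gamma> *\<^sub>R cls L v"
    "\<rho>\<^sub>1 *\<^sub>R cls L (\<lambda>x. (\<kappa> * wderiv L s x - \<beta> * z x - m * wderiv L \<theta> x) / \<rho>\<^sub>1)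
      = \<kappa> *\<^sub>R cls L (wderiv L s) - \<beta> *\<^sub>R cls L z - m *\<^sub>R cls L (wderiv L \<theta>)"
    "\<rho>\<^sub>2 *\<^sub>R cls L (\<lambda>x. (b * wderiv L (wderiv L \<psi>) x - \<kappa> * s x + m * \<theta> x) / \<rho>\<^sub>2)
      = b *\<^sub>R cls L (wderiv L (wderiv L \<psi>)) - \<kappa> *\<^sub>R cls L s + m *\<^sub>R cls L \<theta>"
    using pos mem by (simp_all add: scaled lin)
  \<comment> \<open>Writing the sign as a real scalar brings the term under
    \<open>cls_scaleR\<close>.\<close>
  have "\<rho>\<^sub>3 *\<^sub>R cls L (\<lambda>x. (of_real (- 1) * wderiv L q x - m * (wderiv L \<Phi> x + \<Psi> x)) / \<rho>\<^sub>3)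
      = (- 1) *\<^sub>R cls L (wderiv L q) - m *\<^sub>R cls L (\<lambda>x. wderiv L \<Phi> x + \<Psi> x)"
    using pos mem by (simp add: scaled lin del: of_real_minus)
  then have eq4: "\<rho>\<^sub>3 *\<^sub>R cls L (\<lambda>x. (- wderiv L q x - m * (wderiv L \<Phi> x + \<Psi> x)) / \<rho>\<^sub>3)
      = - cls L (wderiv L q) - m *\<^sub>R cls L (\<lambda>x. wderiv L \<Phi> x + \<Psi> x)" by simp
  have "\<tau> *\<^sub>R cls L (\<lambda>x. (of_real (- \<sigma>) * q x - wderiv L \<theta> x) / \<tau>) = (- \<sigma>) *\<^sub>R cls L q - cls L (wderiv L \<theta>)"
    using pos mem by (simp add: scaled lin del: of_real_minus)
  then have eq5: "\<tau> *\<^sub>R cls L (\<lambda>x. (- complex_of_real \<sigma> * q x - wderiv L \<theta> x) / \<tau>) = - \<sigma> *\<^sub>R cls L q - cls L (wderiv L \<theta>)"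
    by simp
  have eq6: "cls L (\<lambda>x. \<Phi> x - v x) = cls L \<Phi> - cls L v" using mem by (simp add: cls_diff)
  have pp2: "inner (cls L (wderiv L \<psi>)) (cls L (wderiv L \<psi>))
      = - inner (prim L (cls L (wderiv L \<psi>))) (cls L (wderiv L (wderiv L \<psi>)))"
    unfolding pp by (rule weak_ibp[OF dom(5,11) L])
  note expand = s_def z_def
  show ?thesis
    unfolding U obs_def A1.simps prod.case config_def zx[unfolded expand] \<Phi>x
    by (rule exI[of _ "cls L (wderiv L (wderiv L u))"], rule exI[of _ "cls L (wderiv L (\<lambda>x. wderiv L \<phi> x + \<psi> x))"],
      rule exI[of _ "cls L (wderiv L \<theta>)"], rule exI[of _ "cls L (wderiv L q)"],
      rule exI[of _ "cls L (wderiv L (wderiv L \<psi>))"],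
      intro conjI eqs[unfolded expand] eq4 eq5 eq6 pp2 prim_wderiv weak_ibp_prim weak_ibp
        dom s[unfolded expand] z[unfolded expand] H star L)
qed

lemma obs_sub:
  assumes "U \<in> state_space L" "V \<in> state_space L"
  shows "U - V \<in> state_space L" "obs L (U - V) = obs L U - obs L V"
proof -
  show "U - V \<in> state_space L" unfolding state_diff by (rule state_space_lincomb[OF assms L])
  show "obs L (U - V) = obs L U - obs L V"
    unfolding state_diff using obs_lincomb[OF assms, of 1 "-1"] by simp
qed

lemma obs_scale:
  assumes "U \<in> state_space L"
  shows "scale_state (of_real c) U \<in> state_space L" "obs L (scale_state (of_real c) U) = c *\<^sub>R obs L U"
proof -
  show "scale_state (of_real c) U \<in> state_space L"
    by (subst scale_state_eq_lincomb) (rule state_space_lincomb[OF assms assms L])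
  show "obs L (scale_state (of_real c) U) = c *\<^sub>R obs L U"
    by (subst scale_state_eq_lincomb) (use obs_lincomb[OF assms assms, of c 0] in simp)
qed

lemma state_norm_equiv:
  "\<exists>e\<^sub>0 e\<^sub>1. e\<^sub>0 > 0 \<and> e\<^sub>1 > 0 \<and> (\<forall>y. e\<^sub>0 * (norm y)\<^sup>2 \<le> en y y) \<and>
    (\<forall>U\<in>state_space L. e\<^sub>0 * norm (obs L U) \<le> SN U \<and> SN U \<le> e\<^sub>1 * norm (obs L U))"
proof -
  obtain c\<^sub>0 where c\<^sub>0: "c\<^sub>0 > 0" "\<And>y. c\<^sub>0 * (norm y)\<^sup>2 \<le> en y y" using en_coercive by blast
  obtain c\<^sub>1 where c\<^sub>1: "c\<^sub>1 > 0" "\<And>x y. norm (en x y) \<le> norm x * norm y * c\<^sub>1"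
    using bounded_bilinear.pos_bounded[OF bounded_bilinear_forms(1)] by blast
  \<comment> \<open>The minimum makes one constant serve both the quadratic bound and its square
    root.\<close>
  define e\<^sub>0 where "e\<^sub>0 = min c\<^sub>0 (sqrt c\<^sub>0)"
  have e\<^sub>0: "e\<^sub>0 > 0" "e\<^sub>0 \<le> c\<^sub>0" "e\<^sub>0 \<le> sqrt c\<^sub>0" using c\<^sub>0 by (auto simp: e\<^sub>0_def)
  have 1: "e\<^sub>0 * (norm y)\<^sup>2 \<le> en y y" for y
    using mult_right_mono[OF e\<^sub>0(2), of "(norm y)\<^sup>2"] c\<^sub>0(2)[of y] by simp
  have 2: "e\<^sub>0 * norm (obs L U) \<le> SN U" if "U \<in> state_space L" for U
  proof -
    have "e\<^sub>0 * norm (obs L U) \<le> sqrt c\<^sub>0 * norm (obs L U)" by (intro mult_right_mono e\<^sub>0) auto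
    also have "\<dots> = sqrt (c\<^sub>0 * (norm (obs L U))\<^sup>2)" by (simp add: real_sqrt_mult)
    also have "\<dots> \<le> SN U" unfolding state_norm_obs[OF that] by (intro real_sqrt_le_mono c\<^sub>0)
    finally show ?thesis .
  qed
  have 3: "SN U \<le> sqrt c\<^sub>1 * norm (obs L U)" if "U \<in> state_space L" for U
  proof -
    have "SN U \<le> sqrt (c\<^sub>1 * (norm (obs L U))\<^sup>2)" unfolding state_norm_obs[OF that]
      using c\<^sub>1(2)[of "obs L U" "obs L U"] by (intro real_sqrt_le_mono) (simp add: power2_eq_square mult.commute)
    then show ?thesis by (simp add: real_sqrt_mult)
  qed
  have "sqrt c\<^sub>1 > 0" using c\<^sub>1(1) by simp
  then show ?thesis using e\<^sub>0(1) 1 2 3 by (intro exI[of _ e\<^sub>0] exI[of _ "sqrt c\<^sub>1"] conjI ballI allI)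
qed

section \<open>Transfer of the semigroup to classes\<close>

theorem semigroup_decay:
  assumes C0: "C0_semigroup (state_space L) SN S"
    and G: "is_generator (state_space L) SN S (dom_A1 L) AA"
  shows "\<exists>C>0. \<forall>t\<ge>0. \<forall>U\<in>dom_A1 L. (1 + t) * (SN (S t U))\<^sup>2 \<le> C * (SN (AA U))\<^sup>2"
proof -
  let ?X = "state_space L" and ?J = "obs L"
  define N A where "N = SN" and "A = AA"
  note C0 = C0[folded N_def] and G = G[folded N_def A_def]
  obtain e\<^sub>0 e\<^sub>1 where equiv: "e\<^sub>0 > 0 \<and> e\<^sub>1 > 0 \<and> (\<forall>y. e\<^sub>0 * (norm y)\<^sup>2 \<le> en y y) \<and>
    (\<forall>U\<in>?X. e\<^sub>0 * norm (?J U) \<le> N U \<and> N U \<le> e\<^sub>1 * norm (?J U))"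
    using state_norm_equiv[folded N_def] by (elim exE) (rule that)
  note rest = equiv[THEN conjunct2, THEN conjunct2]
  have e: "e\<^sub>0 > 0" "e\<^sub>1 > 0" "\<And>y. e\<^sub>0 * (norm y)\<^sup>2 \<le> en y y"
    by (rule equiv[THEN conjunct1], rule equiv[THEN conjunct2, THEN conjunct1], rule rest[THEN conjunct1, THEN spec])
  have le: "e\<^sub>0 * norm (?J U) \<le> N U" "N U \<le> e\<^sub>1 * norm (?J U)" if "U \<in> ?X" for U
    by (rule rest[THEN conjunct2, THEN bspec, OF that, THEN conjunct1],
        rule rest[THEN conjunct2, THEN bspec, OF that, THEN conjunct2])
  have zero: "N U = 0 \<longleftrightarrow> ?J U = 0" if "U \<in> ?X" for U
  proof
    assume "N U = 0"
    then have "e\<^sub>0 * norm (?J U) \<le> 0" using le(1)[OF that] by simp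
    then show "?J U = 0" using e(1) by (simp add: mult_le_0_iff)
  next
    assume "?J U = 0"
    then show "N U = 0" using le[OF that] by simp
  qed
  have eq: "?J U = ?J V" if "U \<in> ?X" "V \<in> ?X" "N (U - V) = 0" for U V
    using that zero[of "U - V"] by (simp add: obs_sub)
  have lim: "((\<lambda>h. N (g h)) \<longlongrightarrow> 0) F \<longleftrightarrow> ((\<lambda>h. ?J (g h)) \<longlongrightarrow> 0) F"
    if "\<forall>\<^sub>F h in F. g h \<in> ?X" for g and F :: "real filter"
  proof
    assume "((\<lambda>h. N (g h)) \<longlongrightarrow> 0) F"
    then have "((\<lambda>h. N (g h) / e\<^sub>0) \<longlongrightarrow> 0) F" using tendsto_divide_zero by blast
    then show "((\<lambda>h. ?J (g h)) \<longlongrightarrow> 0) F"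
      by (rule Lim_null_comparison[rotated])
        (use that in eventually_elim, use le(1) e in \<open>simp add: field_simps\<close>)
  next
    assume "((\<lambda>h. ?J (g h)) \<longlongrightarrow> 0) F"
    then have "((\<lambda>h. e\<^sub>1 * norm (?J (g h))) \<longlongrightarrow> 0) F" by (intro tendsto_mult_right_zero tendsto_norm_zero)
    then show "((\<lambda>h. N (g h)) \<longlongrightarrow> 0) F"
    proof (rule Lim_null_comparison[rotated])
      show "\<forall>\<^sub>F h in F. norm (N (g h)) \<le> e\<^sub>1 * norm (?J (g h))"
        using that
      proof eventually_elim
        fix h assume g: "g h \<in> ?X"
        have "0 \<le> e\<^sub>0 * norm (?J (g h))" using e by simp
        then show "norm (N (g h)) \<le> e\<^sub>1 * norm (?J (g h))" using le[OF g] by simp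
      qed
    qed
  qed
  note C0s = C0[unfolded C0_semigroup_def]
  note C0_in = C0s[THEN conjunct1, rule_format]
    and C0_lin = C0s[THEN conjunct2, THEN conjunct1, rule_format]
    and C0_bd = C0s[THEN conjunct2, THEN conjunct2, THEN conjunct1, rule_format]
    and C0_0 = C0s[THEN conjunct2, THEN conjunct2, THEN conjunct2, THEN conjunct1, rule_format]
    and C0_add = C0s[THEN conjunct2, THEN conjunct2, THEN conjunct2, THEN conjunct2, THEN conjunct1, rule_format]
    and C0_cont = C0s[THEN conjunct2, THEN conjunct2, THEN conjunct2, THEN conjunct2, THEN conjunct2, rule_format]
  have S_in: "S t U \<in> ?X" if "0 \<le> t" "U \<in> ?X" for t U using that by (rule C0_in)
  have S_lin: "?J (S t (scale_state (of_real c) U + scale_state (of_real d) V)) = c *\<^sub>R ?J (S t U) + d *\<^sub>R ?J (S t V)"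
    if "0 \<le> t" "U \<in> ?X" "V \<in> ?X" for t U V c d
  proof -
    have "N (S t (scale_state (of_real c) U + scale_state (of_real d) V)
           - (scale_state (of_real c) (S t U) + scale_state (of_real d) (S t V))) = 0"
      using that by (rule C0_lin)
    from eq[OF _ _ this] show ?thesis using that
      by (simp add: S_in state_space_lincomb L obs_lincomb)
  qed
  have S_bd: "\<exists>M. \<forall>U\<in>?X. norm (?J (S t U)) \<le> M * norm (?J U)" if "0 \<le> t" for t
  proof -
    obtain M where M: "\<And>U. U \<in> ?X \<Longrightarrow> N (S t U) \<le> M * N U"
      using C0_bd[OF \<open>0 \<le> t\<close>] by blast
    have "norm (?J (S t U)) \<le> \<bar>M\<bar> * e\<^sub>1 / e\<^sub>0 * norm (?J U)" if U: "U \<in> ?X" for U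
    proof -
      have "0 \<le> e\<^sub>0 * norm (?J U)" using e by simp
      then have "0 \<le> N U" using le(1)[OF U] by linarith
      have "e\<^sub>0 * norm (?J (S t U)) \<le> M * N U" using le(1)[OF S_in[OF \<open>0 \<le> t\<close> U]] M[OF U] by linarith
      also have "\<dots> \<le> \<bar>M\<bar> * (e\<^sub>1 * norm (?J U))"
        using \<open>0 \<le> N U\<close> le(2)[OF U] by (intro mult_mono) auto
      finally show ?thesis using e by (simp add: field_simps)
    qed
    then show ?thesis by blast
  qed
  \<comment> \<open>The chosen representative does not matter: two of them differ by a state with
    image 0, and linearity and boundedness send it to a state with image 0.\<close>
  define T where "T t y = ?J (S t (SOME U. U \<in> ?X \<and> ?J U = y))" for t y
  have T: "T t (?J U) = ?J (S t U)" if t: "0 \<le> t" and U: "U \<in> ?X" for t U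
  proof -
    define V where "V = (SOME V. V \<in> ?X \<and> ?J V = ?J U)"
    have V: "V \<in> ?X \<and> ?J V = ?J U" unfolding V_def by (rule someI[of _ U]) (use U in simp)
    obtain M where M: "\<And>U. U \<in> ?X \<Longrightarrow> norm (?J (S t U)) \<le> M * norm (?J U)" using S_bd[OF t] by blast
    have "?J (S t (scale_state (of_real 1) V + scale_state (of_real (- 1)) U)) = ?J (S t V) - ?J (S t U)"
      using S_lin[OF t, of V U 1 "-1"] V U by simp
    moreover have "?J (scale_state (of_real 1) V + scale_state (of_real (- 1)) U) = 0"
      using obs_lincomb[of V L U 1 "-1"] V U by simp
    ultimately have "norm (?J (S t V) - ?J (S t U)) \<le> 0"
      using M[of "scale_state (of_real 1) V + scale_state (of_real (- 1)) U"] V U L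
      by (simp add: state_space_lincomb)
    then show ?thesis by (simp add: T_def V_def[symmetric])
  qed
  interpret sg: semigroup_on "?J ` ?X" T
  proof
    show "subspace (?J ` ?X)"
      unfolding subspace_def
    proof (intro conjI ballI allI)
      have z: "(\<lambda>x. 0) \<in> H1_0 L"
      proof -
        \<comment> \<open>Zero is obtained as a test function by scaling a bump with 0.\<close>
        have "test_function L (\<lambda>x. of_real (bump (L/3) (L/2) 1 x))" by (rule test_function_bump) (use L in auto)
        from test_function_cmult[OF this, of 0] have t: "test_function L (\<lambda>x. 0)" by simp
        show ?thesis unfolding H1_0_iff[OF L]
          using test_weak_deriv[OF t t _ L] cls_wderiv[OF test_weak_deriv[OF t t _ L]] H1_I t
          by (intro conjI exI[of _ "\<lambda>n x. 0"]) auto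
      qed
      have "(\<lambda>x. 0) \<in> L2_star L" using H1_L2[OF H1_0_H1[OF z]] by (simp add: L2_star_def)
      then have "(\<lambda>x. 0, \<lambda>x. 0, \<lambda>x. 0, \<lambda>x. 0, \<lambda>x. 0, \<lambda>x. 0, \<lambda>x. 0, \<lambda>x. 0) \<in> ?X"
        using z H1_0_H1[OF z] by (simp add: state_space_def H1_star_def L2_star_def)
      from obs_scale[OF this, of 0] show "0 \<in> ?J ` ?X" by (metis image_eqI scaleR_zero_left)
    next
      fix x y assume "x \<in> ?J ` ?X" "y \<in> ?J ` ?X"
      then obtain U V where UV: "U \<in> ?X" "V \<in> ?X" "x = ?J U" "y = ?J V" by blast
      have "x + y = ?J (scale_state (of_real 1) U + scale_state (of_real 1) V)"
        unfolding obs_lincomb[OF UV(1,2)] UV(3,4) scaleR_one ..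
      then show "x + y \<in> ?J ` ?X"
        by (rule image_eqI) (rule state_space_lincomb[OF UV(1,2) L])
    next
      fix x c assume "x \<in> ?J ` ?X"
      then obtain U where U: "U \<in> ?X" "x = ?J U" by auto
      show "c *\<^sub>R x \<in> ?J ` ?X"
        unfolding U(2) obs_scale(2)[OF U(1), symmetric] by (rule imageI) (rule obs_scale(1)[OF U(1)])
    qed
    show "T t y \<in> ?J ` ?X" if "0 \<le> t" "y \<in> ?J ` ?X" for t y using that S_in T by auto
    show "T t (c *\<^sub>R x + d *\<^sub>R y) = c *\<^sub>R T t x + d *\<^sub>R T t y"
      if t: "0 \<le> t" and xy: "x \<in> ?J ` ?X" "y \<in> ?J ` ?X" for t x y c d
    proof -
      obtain U V where UV: "U \<in> ?X" "V \<in> ?X" "x = ?J U" "y = ?J V" using xy by blast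
      show ?thesis unfolding UV obs_lincomb[OF UV(1,2), symmetric]
        by (simp only: T[OF t] UV state_space_lincomb L S_lin[OF t])
    qed
    show "\<exists>M. \<forall>y\<in>?J ` ?X. norm (T t y) \<le> M * norm y" if "0 \<le> t" for t
      using S_bd[OF that] T[OF that] by simp
    show "T 0 y = y" if y: "y \<in> ?J ` ?X" for y
    proof -
      obtain U where U: "U \<in> ?X" "y = ?J U" using y by blast
      have "N (S 0 U - U) = 0" using U(1) by (rule C0_0)
      then show ?thesis using eq[of "S 0 U" U] U by (simp add: T S_in)
    qed
    show "T (s + t) y = T s (T t y)" if st: "0 \<le> s" "0 \<le> t" and y: "y \<in> ?J ` ?X" for s t y
    proof -
      obtain U where U: "U \<in> ?X" "y = ?J U" using y by blast
      have "N (S (s + t) U - S s (S t U)) = 0" using st U(1) by (rule C0_add)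
      then show ?thesis using eq[of "S (s + t) U" "S s (S t U)"] U st by (simp add: T S_in)
    qed
    show "((\<lambda>t. T t y) \<longlongrightarrow> y) (at_right 0)" if y: "y \<in> ?J ` ?X" for y
    proof -
      obtain U where U: "U \<in> ?X" "y = ?J U" using y by blast
      have "((\<lambda>t. N (S t U - U)) \<longlongrightarrow> 0) (at_right 0)" using U(1) by (rule C0_cont)
      then have "((\<lambda>t. ?J (S t U - U)) \<longlongrightarrow> 0) (at_right 0)"
        by (subst (asm) lim) (use U in \<open>auto simp: eventually_at_filter S_in obs_sub\<close>)
      then have "((\<lambda>t. T t y - y) \<longlongrightarrow> 0) (at_right 0)"
        by (rule Lim_transform_eventually) (use U in \<open>auto simp: eventually_at_filter S_in obs_sub T\<close>)
      then show ?thesis by (rule LIM_zero_cancel)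
    qed
  qed
  have AX: "A U \<in> ?X" if "U \<in> dom_A1 L" for U unfolding A_def by (rule A1_state_space[OF that L])
  have DX: "U \<in> ?X" if "U \<in> dom_A1 L" for U using that by (auto simp: dom_A1_def)
  have gen_iff: "((\<lambda>h. (1 / h) *\<^sub>R (T h (?J U) - ?J U)) \<longlongrightarrow> ?J F) (at_right 0) \<longleftrightarrow> U \<in> dom_A1 L \<and> N (A U - F) = 0"
    if U: "U \<in> ?X" and F: "F \<in> ?X" for U F
  proof -
    let ?q = "\<lambda>h. scale_state (of_real (1 / h)) (S h U - U) - F"
    have q: "?q h \<in> ?X \<and> ?J (?q h) = (1 / h) *\<^sub>R (T h (?J U) - ?J U) - ?J F" if "h > 0" for h
      using that U F by (simp only: obs_sub obs_scale S_in T less_imp_le simp_thms)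
    have "((\<lambda>h. N (?q h)) \<longlongrightarrow> 0) (at_right 0) \<longleftrightarrow> ((\<lambda>h. ?J (?q h)) \<longlongrightarrow> 0) (at_right 0)"
      by (rule lim) (use q in \<open>auto simp: eventually_at_filter\<close>)
    also have "\<dots> \<longleftrightarrow> ((\<lambda>h. (1 / h) *\<^sub>R (T h (?J U) - ?J U) - ?J F) \<longlongrightarrow> 0) (at_right 0)"
      by (rule filterlim_cong[OF refl refl]) (use q in \<open>auto simp: eventually_at_filter\<close>)
    also have "\<dots> \<longleftrightarrow> ((\<lambda>h. (1 / h) *\<^sub>R (T h (?J U) - ?J U)) \<longlongrightarrow> ?J F) (at_right 0)"
      by (rule LIM_zero_iff)
    finally show ?thesis using G[unfolded is_generator_def, rule_format, OF U F] by blast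
  qed
  \<comment> \<open>The characterisation of the generator concerns states, so states are chosen for
    both classes. The first then lies in the domain, and its image under the operator has the class
    of the second.\<close>
  have gen_config: "config y f" if gf: "sg.gen y f" for y f
  proof -
    obtain U F where U: "U \<in> ?X" "F \<in> ?X" "y = ?J U" "f = ?J F" using gf unfolding sg.gen_def by blast
    then have "U \<in> dom_A1 L" "N (A U - F) = 0" using gen_iff[OF U(1,2)] gf unfolding sg.gen_def U(3,4) by blast+
    then show ?thesis using config_obs[of U, folded A_def] eq[OF AX U(2)] U by simp
  qed
  have gen_A: "sg.gen (?J U) (?J (A U))" if "U \<in> dom_A1 L" for U
  proof -
    have "N (A U - A U) = 0" using AX[OF that] zero[of "A U - A U"] by (simp only: obs_sub) simp
    then show ?thesis using gen_iff[OF DX AX, OF that that] that DX AX by (simp add: sg.gen_def)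
  qed
  interpret ds: dissipative_semigroup "?J ` ?X" T en e\<^sub>0 "min \<gamma> \<sigma>" "\<lambda>y. (v\<^sub>c y, q\<^sub>c y)"
  proof (intro dissipative_semigroup.intro dissipative_semigroup_axioms.intro)
    show "semigroup_on (?J ` ?X) T" by (rule sg.semigroup_on_axioms)
    show "bounded_bilinear en" by (rule bounded_bilinear_forms)
    show "en x y = en y x" for x y by (simp add: en_def inner_commute)
    show "bounded_linear (\<lambda>y::l2 vec9. (v\<^sub>c y, q\<^sub>c y))"
      by (intro bounded_linear_Pair bounded_linear_fst_comp bounded_linear_snd_comp bounded_linear_ident)
    show "en f y \<le> - min \<gamma> \<sigma> * (norm (v\<^sub>c y, q\<^sub>c y))\<^sup>2" if "sg.gen y f" for y f
      by (rule dissipation_le[OF gen_config[OF that]])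
    show "e\<^sub>0 * (norm y)\<^sup>2 \<le> en y y" for y by (rule e(3))
    show "min \<gamma> \<sigma> > 0" using pos by simp
  qed (rule e(1))
  obtain g c C where g: "bounded_bilinear g" "c > 0" "C > 0"
    and mult: "\<And>y y'. config y y' \<Longrightarrow>
     c * (norm y)\<^sup>2 \<le> g y' y + g y y' + C * ((norm (v\<^sub>c y, q\<^sub>c y))\<^sup>2 + (norm (v\<^sub>c y', q\<^sub>c y'))\<^sup>2)"
    using multiplier_estimate by blast
  obtain K where K: "K > 0" "\<And>y f t. sg.gen y f \<Longrightarrow> 0 \<le> t \<Longrightarrow> (1 + t) * (norm (T t y))\<^sup>2 \<le> K * (norm f)\<^sup>2"
    using ds.polynomial_decay[OF g mult[OF gen_config]] by blast
  have "(1 + t) * (N (S t U))\<^sup>2 \<le> e\<^sub>1\<^sup>2 * K / e\<^sub>0\<^sup>2 * (N (A U))\<^sup>2" if t: "0 \<le> t" and U: "U \<in> dom_A1 L" for t U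
  proof -
    note mem = S_in[OF t DX[OF U]]
    have nonneg: "0 \<le> N V" if "V \<in> ?X" for V
      by (rule order_trans[OF _ le(1)[OF that]]) (use e in simp)
    have "(N (S t U))\<^sup>2 \<le> (e\<^sub>1 * norm (T t (?J U)))\<^sup>2"
      using le(2)[OF mem] nonneg[OF mem] T[OF t DX[OF U]] by (intro power_mono) auto
    then have "(1 + t) * (N (S t U))\<^sup>2 \<le> (1 + t) * (e\<^sub>1\<^sup>2 * (norm (T t (?J U)))\<^sup>2)"
      using t by (intro mult_left_mono) (auto simp: power_mult_distrib)
    also have "\<dots> = e\<^sub>1\<^sup>2 * ((1 + t) * (norm (T t (?J U)))\<^sup>2)" by simp
    also have "\<dots> \<le> e\<^sub>1\<^sup>2 * (K * (norm (?J (A U)))\<^sup>2)"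
      by (intro mult_left_mono K gen_A U t) auto
    also have "\<dots> = e\<^sub>1\<^sup>2 * K / e\<^sub>0\<^sup>2 * (e\<^sub>0 * norm (?J (A U)))\<^sup>2" using e by (simp add: power_mult_distrib)
    also have "\<dots> \<le> e\<^sub>1\<^sup>2 * K / e\<^sub>0\<^sup>2 * (N (A U))\<^sup>2"
      using le(1)[OF AX[OF U]] e K by (intro mult_left_mono power_mono) auto
    finally show ?thesis .
  qed
  moreover have "e\<^sub>1\<^sup>2 * K / e\<^sub>0\<^sup>2 > 0" using e K by simp
  ultimately show ?thesis unfolding N_def A_def by blast
qed

end

section \<open>The decay rates\<close>

text \<open>A power of t with exponent between 0 and 1 is at most 1 for t below 1 and at most t
  beyond, hence always at most 1 + t. One estimate thus yields both rates, including times near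
  0.\<close>

lemma decay_powr:
  assumes N: "(1 + t) * N\<^sup>2 \<le> C * M\<^sup>2" and "0 \<le> N" "0 \<le> M" "0 < C" "0 < t" "0 \<le> r" "2 * r \<le> 1"
  shows "N \<le> sqrt C / t powr r * M"
proof (rule power2_le_imp_le)
  have "t powr (2 * r) \<le> 1 + t"
  proof (cases "t \<le> 1")
    case True then show ?thesis using powr_le_one_le[of t "2 * r"] powr_mono2[of "2 * r" t 1] assms by simp
  next
    case False then show ?thesis using powr_mono[of "2 * r" 1 t] assms by simp
  qed
  then have "t powr (2 * r) * N\<^sup>2 \<le> (1 + t) * N\<^sup>2" by (intro mult_right_mono) auto
  then have "(t powr r)\<^sup>2 * N\<^sup>2 \<le> C * M\<^sup>2" using N by (simp add: power2_eq_square powr_add[symmetric])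
  then have "N\<^sup>2 \<le> C * M\<^sup>2 / (t powr r)\<^sup>2" using assms by (simp add: field_simps)
  then show "N\<^sup>2 \<le> (sqrt C / t powr r * M)\<^sup>2" using assms by (simp add: power_mult_distrib power_divide)
qed (use assms in simp)

theorem theorem2p2:
  fixes L \<rho> \<rho>\<^sub>1 \<rho>\<^sub>2 \<rho>\<^sub>3 \<alpha> \<kappa> b \<tau> \<sigma> \<beta> \<gamma> m :: real
    and S :: "real \<Rightarrow> state \<Rightarrow> state"
  assumes "L > 0" "\<rho> > 0" "\<rho>\<^sub>1 > 0" "\<rho>\<^sub>2 > 0" "\<rho>\<^sub>3 > 0" "\<alpha> > 0" "\<kappa> > 0" "b > 0"
    "\<tau> > 0" "\<sigma> > 0" "\<beta> > 0" "\<gamma> > 0" "m \<noteq> 0"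
    and "C0_semigroup (state_space L) (state_norm L \<rho> \<rho>\<^sub>1 \<rho>\<^sub>2 \<rho>\<^sub>3 \<alpha> \<kappa> b \<tau> \<beta>) S"
    and "is_generator (state_space L) (state_norm L \<rho> \<rho>\<^sub>1 \<rho>\<^sub>2 \<rho>\<^sub>3 \<alpha> \<kappa> b \<tau> \<beta>) S
           (dom_A1 L) (A1 L \<rho> \<rho>\<^sub>1 \<rho>\<^sub>2 \<rho>\<^sub>3 \<alpha> \<kappa> b \<tau> \<sigma> \<beta> \<gamma> m)"
  shows "(\<rho>\<^sub>1 / \<kappa> = \<rho>\<^sub>2 / b \<longrightarrow>
            (\<exists>C>0. \<forall>t>0. \<forall>U\<^sub>0\<in>dom_A1 L.
               state_norm L \<rho> \<rho>\<^sub>1 \<rho>\<^sub>2 \<rho>\<^sub>3 \<alpha> \<kappa> b \<tau> \<beta> (S t U\<^sub>0)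
               \<le> C / t powr (1/2) *
                 state_norm L \<rho> \<rho>\<^sub>1 \<rho>\<^sub>2 \<rho>\<^sub>3 \<alpha> \<kappa> b \<tau> \<beta>
                   (A1 L \<rho> \<rho>\<^sub>1 \<rho>\<^sub>2 \<rho>\<^sub>3 \<alpha> \<kappa> b \<tau> \<sigma> \<beta> \<gamma> m U\<^sub>0))) \<and>
         (\<rho>\<^sub>1 / \<kappa> \<noteq> \<rho>\<^sub>2 / b \<longrightarrow>
            (\<exists>C>0. \<forall>t>0. \<forall>U\<^sub>0\<in>dom_A1 L.
               state_norm L \<rho> \<rho>\<^sub>1 \<rho>\<^sub>2 \<rho>\<^sub>3 \<alpha> \<kappa> b \<tau> \<beta> (S t U\<^sub>0)
               \<le> C / t powr (1/4) *
                 state_norm L \<rho> \<rho>\<^sub>1 \<rho>\<^sub>2 \<rho>\<^sub>3 \<alpha> \<kappa> b \<tau> \<beta>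
                   (A1 L \<rho> \<rho>\<^sub>1 \<rho>\<^sub>2 \<rho>\<^sub>3 \<alpha> \<kappa> b \<tau> \<sigma> \<beta> \<gamma> m U\<^sub>0)))"
proof -
  interpret beam_state \<rho> \<rho>\<^sub>1 \<rho>\<^sub>2 \<rho>\<^sub>3 \<alpha> \<kappa> b \<tau> \<sigma> \<beta> \<gamma> m L
    by (intro beam_state.intro coupled_beam.intro beam_state_axioms.intro) (use assms bounded_linear_prim[of L] in auto)
  obtain C where C: "C > 0" "\<And>t U. t \<ge> 0 \<Longrightarrow> U \<in> dom_A1 L \<Longrightarrow> (1 + t) * (SN (S t U))\<^sup>2 \<le> C * (SN (AA U))\<^sup>2"
    using semigroup_decay[OF assms(14,15)] by blast
  have nonneg: "0 \<le> SN U" for U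
    using assms by (cases U rule: state_cases) (auto intro!: add_nonneg_nonneg mult_nonneg_nonneg)
  have "SN (S t U) \<le> sqrt C / t powr r * SN (AA U)"
    if "t > 0" "U \<in> dom_A1 L" "0 \<le> r" "2 * r \<le> 1" for t U r
    using that C(1) by (intro decay_powr C(2) nonneg) auto
  from this[where r = "1/2"] this[where r = "1/4"] C(1) show ?thesis
    by (intro conjI impI exI[of _ "sqrt C"]) auto
qed

end
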